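(* Let $n\ge1$. For all $\varphi\in\mathcal D_{(n-1,n-1)}$ and all $\delta>0$, there exist $c>0$ and $L_j^0=L_j^0(\varphi,\delta,n)$, $j=1,\dots,n$, such that for all $L=(L_1,\dots,L_n)$ with $L_j\ge L_j^0$, $j=1,\dots,n$, \[ \mathbb P\bigl[\,|I_L(\varphi)-\mathbb E[I_L(\varphi)]|>\delta\,\mathbb E[I_L(\varphi)]\,\bigr]\le e^{-c\left(\sum_{j=1}^n L_j\right)\left(\prod_{j=1}^n L_j\right)}. \]
   Context: $\mathbb D^n=\{z\in\mathbb C^n: |z_j|<1,\ j=1,\dots,n\}$ is the unit polydisk. For $L=(L_1,\dots,L_n)$ with all $L_j>0$, the hyperbolic Gaussian analytic function of intensity $L$ is \[ f_L(z)=\sum_{\alpha\in\mathbb N^n}a_\alpha\prod_{j=1}^n\left(\frac{\Gamma(L_j+\alpha_j)}{\alpha_j!\,\Gamma(L_j)}\right)^{1/2}z^\alpha,\qquad z\in\mathbb D^n, \] where $\mathbb N$ includes $0$ and the $a_\alpha$ are i.i.d. standard complex Gaussians $N_{\mathbb C}(0,1)$ (mean $0$, variance $1$). Its covariance kernel is $K_L(z,w)=\prod_{j=1}^n(1-z_j\bar w_j)^{-L_j}$. $Z_{f_L}$ is the zero variety of $f_L$ in $\mathbb D^n$, with integration current (counting multiplicities) $[Z_{f_L}]=\frac{i}{2\pi}\partial\bar\partial\log|f_L|^2$. $\mathcal D_{(n-1,n-1)}$ is the space of real-valued, compactly supported, $\mathcal C^2$ differential forms of bidegree $(n-1,n-1)$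 on $\mathbb D^n$. For $\varphi\in\mathcal D_{(n-1,n-1)}$, $I_L(\varphi)=\int_{Z_{f_L}}\varphi=\int_{\mathbb D^n}\varphi\wedge[Z_{f_L}]$. One has $\mathbb E[I_L(\varphi)]=\int_{\mathbb D^n}\varphi\wedge\omega_L$ with $\omega_L(z)=\sum_{j=1}^n\frac{L_j}{(1-|z_j|^2)^2}\frac{i}{2\pi}dz_j\wedge d\bar z_j$.
   Formalization: It is additionally assumed that the integral of φ ∧ (1-|z_j|²)^{-2}(i/2π)dz_j∧dz̄_j is positive for every j; without this the claim fails, e.g. for n=1 and φ=-ψ with ψ≥0 nonzero, where E[I_L(φ)]<0 and the event has probability 1. *)

theory Defs
  imports "HOL-Probability.Probability"
begin

section \<open>Differential forms on the unit polydisk\<close>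

definition polydisk :: "(complex ^ 'n) set" where
  "polydisk = {z. \<forall>j. cmod (z $ j) < 1}"

text \<open>
  A differential form is given by its coefficients: \<open>\<phi> z J K\<close> is the coefficient at the point
  \<open>z\<close> of \<open>dz\<^sub>J \<and> dzbar\<^sub>K\<close>, where for \<open>J = {j\<^sub>1 < ... < j\<^sub>p}\<close> one puts
  \<open>dz\<^sub>J = dz\<^sub>j\<^sub>1 \<and> ... \<and> dz\<^sub>j\<^sub>p\<close>, and likewise for \<open>dzbar\<^sub>K\<close>. The linear order on the
  index type serves only to fix this basis. Only the values at points of \<open>polydisk\<close> matter.
\<close>

type_synonym 'n dform = "complex ^ 'n \<Rightarrow> 'n set \<Rightarrow> 'n set \<Rightarrow> complex"

definition bidegree :: "nat \<Rightarrow> nat \<Rightarrow> 'n::finite dform \<Rightarrow> bool" where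
  "bidegree p q \<phi> \<longleftrightarrow>
     (\<forall>z\<in>polydisk. \<forall>J K. \<phi> z J K \<noteq> 0 \<longrightarrow> card J = p \<and> card K = q)"

text \<open>
  \<open>dz\<^sub>A \<and> dz\<^sub>B = shuffle_sign A B \<sqdot> dz\<^sub>A\<^sub>\<union>\<^sub>B\<close> for disjoint \<open>A\<close> and \<open>B\<close>.
\<close>

definition shuffle_sign :: "'n::{finite,linorder} set \<Rightarrow> 'n set \<Rightarrow> complex" where
  "shuffle_sign A B = (- 1) ^ card {(a, b). a \<in> A \<and> b \<in> B \<and> b < a}"

text \<open>
  The factor \<open>(- 1) ^ (card K1 * card (J - J1))\<close> comes from moving the differentials
  \<open>dzbar\<close> of the first form past the differentials \<open>dz\<close> of the second one.
\<close>

definition wedge :: "'n::{finite,linorder} dform \<Rightarrow> 'n dform \<Rightarrow> 'n dform" where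
  "wedge \<phi> \<psi> = (\<lambda>z J K. \<Sum>J1\<in>Pow J. \<Sum>K1\<in>Pow K.
     (- 1) ^ (card K1 * card (J - J1)) * shuffle_sign J1 (J - J1) * shuffle_sign K1 (K - K1)
       * \<phi> z J1 K1 * \<psi> z (J - J1) (K - K1))"

text \<open>
  The complex conjugate of \<open>g dz\<^sub>J \<and> dzbar\<^sub>K\<close> is
  \<open>cnj g dzbar\<^sub>J \<and> dz\<^sub>K = (- 1) ^ (card J * card K) cnj g dz\<^sub>K \<and> dzbar\<^sub>J\<close>.
\<close>

definition cnj_form :: "'n::finite dform \<Rightarrow> 'n dform" where
  "cnj_form \<phi> = (\<lambda>z J K. (- 1) ^ (card J * card K) * cnj (\<phi> z K J))"

definition real_form :: "'n::finite dform \<Rightarrow> bool" where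
  "real_form \<phi> \<longleftrightarrow> (\<forall>z\<in>polydisk. cnj_form \<phi> z = \<phi> z)"

definition wirtinger :: "'n::finite \<Rightarrow> (complex ^ 'n \<Rightarrow> complex) \<Rightarrow> complex ^ 'n \<Rightarrow> complex" where
  "wirtinger j g z =
     (frechet_derivative g (at z) (axis j 1) - \<i> * frechet_derivative g (at z) (axis j \<i>)) / 2"

definition wirtinger_bar :: "'n::finite \<Rightarrow> (complex ^ 'n \<Rightarrow> complex) \<Rightarrow> complex ^ 'n \<Rightarrow> complex" where
  "wirtinger_bar j g z =
     (frechet_derivative g (at z) (axis j 1) + \<i> * frechet_derivative g (at z) (axis j \<i>)) / 2"

definition del :: "'n::{finite,linorder} dform \<Rightarrow> 'n dform" where
  "del \<phi> = (\<lambda>z J K. \<Sum>j\<in>J. shuffle_sign {j} (J - {j})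
     * wirtinger j (\<lambda>w. \<phi> w (J - {j}) K) z)"

definition delbar :: "'n::{finite,linorder} dform \<Rightarrow> 'n dform" where
  "delbar \<phi> = (\<lambda>z J K. \<Sum>k\<in>K. (- 1) ^ card J * shuffle_sign {k} (K - {k})
     * wirtinger_bar k (\<lambda>w. \<phi> w J (K - {k})) z)"

text \<open>
  Integral over the polydisk of the part of bidegree \<open>(n, n)\<close>. With the standard orientation,
  \<open>dz\<^sub>j \<and> dzbar\<^sub>j\<close> is \<open>- 2 \<i>\<close> times the area form, and sorting
  \<open>dz\<^sub>1 \<and> ... \<and> dz\<^sub>n \<and> dzbar\<^sub>1 \<and> ... \<and> dzbar\<^sub>n\<close> into
  \<open>dz\<^sub>1 \<and> dzbar\<^sub>1 \<and> ... \<and> dz\<^sub>n \<and> dzbar\<^sub>n\<close> takes \<open>n (n - 1) / 2\<close> transpositions.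
\<close>

definition form_integral :: "'n::finite dform \<Rightarrow> complex" where
  "form_integral \<eta> = (- 1) ^ (CARD('n) * (CARD('n) - 1) div 2) * (- 2 * \<i>) ^ CARD('n)
     * (LINT z:polydisk|lborel. \<eta> z UNIV UNIV)"

definition C2_on :: "'a::real_normed_vector set \<Rightarrow> ('a \<Rightarrow> 'b::real_normed_vector) \<Rightarrow> bool" where
  "C2_on S g \<longleftrightarrow>
     (\<exists>(g' :: 'a \<Rightarrow> 'a \<Rightarrow>\<^sub>L 'b) (g'' :: 'a \<Rightarrow> 'a \<Rightarrow>\<^sub>L 'a \<Rightarrow>\<^sub>L 'b).
        (\<forall>x\<in>S. (g has_derivative blinfun_apply (g' x)) (at x)) \<and>
        (\<forall>x\<in>S. (g' has_derivative blinfun_apply (g'' x)) (at x)) \<and>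
        continuous_on S g'')"

definition test_forms :: "nat \<Rightarrow> nat \<Rightarrow> 'n::finite dform set" where
  "test_forms p q = {\<phi>. bidegree p q \<phi> \<and> real_form \<phi> \<and>
     (\<forall>J K. C2_on polydisk (\<lambda>z. \<phi> z J K)) \<and>
     (\<exists>S. compact S \<and> S \<subseteq> polydisk \<and> (\<forall>z\<in>polydisk - S. \<forall>J K. \<phi> z J K = 0))}"

section \<open>The hyperbolic Gaussian analytic function and its zeros\<close>

definition std_complex_gaussian :: "'w measure \<Rightarrow> ('w \<Rightarrow> complex) \<Rightarrow> bool" where
  "std_complex_gaussian M X \<longleftrightarrow>
     distributed M lborel X (\<lambda>z. ennreal (exp (- (cmod z)\<^sup>2) / pi))"

definition iid_std_complex_gaussian :: "'w measure \<Rightarrow> ('i \<Rightarrow> 'w \<Rightarrow> complex) \<Rightarrow> bool" where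
  "iid_std_complex_gaussian M a \<longleftrightarrow> prob_space M \<and>
     prob_space.indep_vars M (\<lambda>_. borel) a UNIV \<and> (\<forall>\<alpha>. std_complex_gaussian M (a \<alpha>))"

text \<open>
  Almost surely the series converges absolutely at every point of the polydisk.
\<close>

definition hyp_GAF ::
  "real ^ 'n \<Rightarrow> (nat ^ 'n \<Rightarrow> 'w \<Rightarrow> complex) \<Rightarrow> 'w \<Rightarrow> complex ^ 'n::finite \<Rightarrow> complex" where
  "hyp_GAF L a \<omega> z = (\<Sum>\<^sub>\<infinity>\<alpha>\<in>UNIV. a \<alpha> \<omega>
     * (\<Prod>j\<in>UNIV. complex_of_real
          (sqrt (Gamma (L $ j + real (\<alpha> $ j)) / (fact (\<alpha> $ j) * Gamma (L $ j)))))
     * (\<Prod>j\<in>UNIV. (z $ j) ^ (\<alpha> $ j)))"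

text \<open>
  The pairing of the current \<open>(\<i> / 2\<pi>) \<partial>\<partial>bar u\<close> with a test form \<open>\<phi>\<close> of bidegree
  \<open>(n - 1, n - 1)\<close>: derivatives of currents are defined by duality, and the two signs for
  \<open>\<partial>\<close> and \<open>\<partial>bar\<close> cancel. For real \<open>u\<close> and \<open>\<phi>\<close> the integral is real.
\<close>

definition ddbar_pairing ::
  "(complex ^ ('n::{finite,linorder}) \<Rightarrow> real) \<Rightarrow> 'n dform \<Rightarrow> real" where
  "ddbar_pairing u \<phi> = Re (form_integral
     (\<lambda>z J K. complex_of_real (u z) * (\<i> / (2 * complex_of_real pi) * del (delbar \<phi>) z J K)))"

text \<open>
  The zero current of \<open>f\<close>, zeros counted with multiplicity, is
  \<open>(\<i> / 2\<pi>) \<partial>\<partial>bar log \<bar>f\<bar>\<^sup>2\<close>.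
\<close>

definition zero_current :: "(complex ^ ('n::{finite,linorder}) \<Rightarrow> complex) \<Rightarrow> 'n dform \<Rightarrow> real" where
  "zero_current f = ddbar_pairing (\<lambda>z. ln ((cmod (f z))\<^sup>2))"

definition I_stat ::
  "real ^ ('n::{finite,linorder}) \<Rightarrow> (nat ^ ('n::{finite,linorder}) \<Rightarrow> 'w \<Rightarrow> complex) \<Rightarrow> 'n dform \<Rightarrow> 'w \<Rightarrow> real" where
  "I_stat L a \<phi> \<omega> = zero_current (hyp_GAF L a \<omega>) \<phi>"

definition omega_form :: "real ^ 'n \<Rightarrow> 'n::finite dform" where
  "omega_form L = (\<lambda>z J K. \<Sum>j\<in>UNIV. if J = {j} \<and> K = {j}
     then complex_of_real (L $ j / (1 - (cmod (z $ j))\<^sup>2)\<^sup>2) * (\<i> / (2 * complex_of_real pi))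
     else 0)"

text \<open>
  \<open>mean_form_integral L \<phi>\<close> is the integral of \<open>\<phi> \<and> \<omega>\<^sub>L\<close>, which is the expectation of
  \<open>I_stat L a \<phi>\<close>. It is linear in \<open>L\<close>, so it is determined by its values on the unit vectors
  \<open>axis j 1\<close>. These are all positive iff the expectation is at least a positive constant times
  the sum of the \<open>L\<^sub>j\<close>; a bound on deviations relative to the expectation needs such a
  condition, because for \<open>- \<phi>\<close> in place of such a \<open>\<phi>\<close> the event has probability 1.
\<close>

definition mean_form_integral :: "real ^ ('n::{finite,linorder}) \<Rightarrow> 'n dform \<Rightarrow> real" where
  "mean_form_integral L \<phi> = Re (form_integral (wedge \<phi> (omega_form L)))"

end

theory Submission
  imports Defs "HOL-Real_Asymp.Real_Asymp"
begin

text \<open>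
  Write \<open>log \<bar>f\<bar>\<^sup>2 = log K + D\<close> with \<open>K(z) = K\<^sub>L(z, z)\<close>. Integrating by parts twice, \<open>log K\<close>
  contributes exactly the integral of \<open>\<phi> \<and> \<omega>\<^sub>L\<close> to \<open>I\<^sub>L(\<phi>)\<close>, so the deviation is at most a
  constant times the average \<open>X\<close> of \<open>\<bar>D\<bar>\<close> over a closed polydisk containing the support of \<open>\<phi>\<close>.

  Rotating the \<open>j\<close>-th coordinate of a point by the \<open>m\<^sub>j\<close>-th roots of unity gives an orbit of
  \<open>N = m\<^sub>1 \<cdots> m\<^sub>n\<close> points \<open>z\<^sub>k\<close>, where \<open>m\<^sub>j\<close> is about \<open>\<theta> L\<^sub>j\<close>. The values of \<open>f / \<surd>K\<close> on the orbit
  depend on the \<open>N\<close> Gaussian coefficients in a suitable window through a discrete Fourier matrix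
  times a diagonal matrix with entries of size at least \<open>exp (- \<epsilon> (L\<^sub>1 + \<dots> + L\<^sub>n))\<close>. Their
  joint density is therefore at most \<open>exp (O(\<epsilon> N (L\<^sub>1 + \<dots> + L\<^sub>n)))\<close>, and
  \<open>E exp (1/8 \<Sum>\<^sub>k \<bar>D(z\<^sub>k)\<bar>) \<le> exp (N G(z))\<close> with an integrable function \<open>G\<close> whose average is at most \<open>\<epsilon> (L\<^sub>1 + \<dots> + L\<^sub>n)\<close>. Jensen's inequality over the points \<open>z\<close> turns this
  into \<open>E exp (N (X/8 - \<epsilon> (L\<^sub>1 + \<dots> + L\<^sub>n))) \<le> 1\<close>. As \<open>N\<close> is comparable to \<open>L\<^sub>1 \<cdots> L\<^sub>n\<close>, Markov's
  inequality bounds the tail of \<open>X\<close>; the same estimate bounds \<open>E X\<close>, so the expectation of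
  \<open>I\<^sub>L(\<phi>)\<close> need not be computed exactly.
\<close>

section \<open>Lebesgue measure and linear maps\<close>

text \<open>Controlling the deviation at a single point could only give an exponent linear in the
  \<open>L $ j\<close>; the additional factor \<open>\<Prod>j\<in>UNIV. L $ j\<close> calls for
  about that many values that behave as if independent. The obstacle is the lower tail:
  \<open>log \<bar>f\<bar>\<close> is unbounded near the zeros, so negative powers of many
  correlated values have to be integrated jointly. On an orbit the correlation is explicit: the
  characters are orthogonal, and the joint density is distorted only by the unequal sizes of the
  terms in the window. Across \<open>m j\<close> consecutive indices the squared sizes may fall by
  the factor \<open>(cmod (z $ j)) ^ (2 * m j)\<close>, which costs \<open>m j\<close> times the
  logarithm of \<open>1 / (cmod (z $ j))\<^sup>2\<close> per orbit point. Hence \<open>m j\<close>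
  is only a small multiple \<theta> of \<open>L $ j\<close>: the cost is linear in \<theta>, while
  the orbit keeps a fixed share of the product of the \<open>L $ j\<close>. The remaining losses are
  polynomial in the \<open>L $ j\<close> and become logarithms in the exponent. Coefficients outside
  the window act as an unknown shift, and every bound is uniform in it.\<close>

lemma translation_invariant_measure_swap:
  fixes \<nu> :: "'a::euclidean_space measure"
  assumes sf: "sigma_finite_measure \<nu>" and [measurable_cong]: "sets \<nu> = sets borel"
    and inv: "\<And>g x. g \<in> borel_measurable borel \<Longrightarrow> (\<integral>\<^sup>+y. g (x + y) \<partial>\<nu>) = (\<integral>\<^sup>+y. g y \<partial>\<nu>)"
    and [measurable]: "A \<in> sets borel" "B \<in> sets borel"
  shows "emeasure \<nu> A * emeasure lborel B = emeasure lborel A * emeasure \<nu> (uminus -` B)"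
proof -
  interpret sigma_finite_measure \<nu> by fact
  interpret pair_sigma_finite \<nu> "lborel :: 'a measure" ..
  have mB: "uminus -` B \<in> sets borel"
    using measurable_sets[of uminus borel borel B] by simp
  have "emeasure \<nu> A * emeasure lborel B
      = (\<integral>\<^sup>+y. indicator B y * (\<integral>\<^sup>+x. indicator A x \<partial>\<nu>) \<partial>lborel)"
    by (simp add: nn_integral_multc mult.commute)
  \<comment> \<open>Invariance of \<nu> inserts the translation by \<open>y\<close>; after the
    exchange of integrals, invariance of \<open>lborel\<close> moves it to the other factor, and a
    last translation under \<nu> decouples the two sets.\<close>
  also have "\<dots> = (\<integral>\<^sup>+y. indicator B y * (\<integral>\<^sup>+x. indicator A (y + x) \<partial>\<nu>) \<partial>lborel)"
    by (subst inv) auto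
  also have "\<dots> = (\<integral>\<^sup>+y. \<integral>\<^sup>+x. indicator B y * indicator A (y + x) \<partial>\<nu> \<partial>lborel)"
    by (subst nn_integral_cmult) auto
  also have "\<dots> = (\<integral>\<^sup>+x. \<integral>\<^sup>+y. indicator B y * indicator A (y + x) \<partial>lborel \<partial>\<nu>)"
    by (rule Fubini') measurable
  also have "\<dots> = (\<integral>\<^sup>+x. \<integral>\<^sup>+y. indicator B (y - x) * indicator A y \<partial>lborel \<partial>\<nu>)"
  proof (rule nn_integral_cong)
    fix x
    have "(\<integral>\<^sup>+y. indicator B (y - x) * indicator A y \<partial>lborel)
       = (\<integral>\<^sup>+y. indicator B (y - x) * indicator A y \<partial>distr lborel borel ((+) x))"
      by (simp add: lborel_distr_plus)
    also have "\<dots> = (\<integral>\<^sup>+y. indicator B y * indicator A (y + x) \<partial>lborel)"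
      by (subst nn_integral_distr) (auto simp: add.commute)
    finally show "(\<integral>\<^sup>+y. indicator B y * indicator A (y + x) \<partial>lborel)
       = (\<integral>\<^sup>+y. indicator B (y - x) * indicator A y \<partial>lborel)" ..
  qed
  also have "\<dots> = (\<integral>\<^sup>+y. \<integral>\<^sup>+x. indicator B (y - x) * indicator A y \<partial>\<nu> \<partial>lborel)"
    by (rule Fubini'[symmetric]) measurable
  also have "\<dots> = (\<integral>\<^sup>+y. (\<integral>\<^sup>+x. indicator B (y - x) \<partial>\<nu>) * indicator A y \<partial>lborel)"
    by (subst nn_integral_multc) auto
  also have "\<dots> = (\<integral>\<^sup>+y. (\<integral>\<^sup>+x. indicator (uminus -` B) x \<partial>\<nu>) * indicator A y \<partial>lborel)"
  proof (rule nn_integral_cong)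
    fix y :: 'a
    have "(\<integral>\<^sup>+x. indicator B (y - x) \<partial>\<nu>) = (\<integral>\<^sup>+x. indicator B (y - (y + x)) \<partial>\<nu>)"
      by (rule inv[symmetric]) measurable
    also have "\<dots> = (\<integral>\<^sup>+x. indicator (uminus -` B) x \<partial>\<nu>)"
      by (intro nn_integral_cong) (auto simp: indicator_def)
    finally show "(\<integral>\<^sup>+x. indicator B (y - x) \<partial>\<nu>) * indicator A y
        = (\<integral>\<^sup>+x. indicator (uminus -` B) x \<partial>\<nu>) * (indicator A y :: ennreal)"
      by simp
  qed
  also have "\<dots> = emeasure lborel A * emeasure \<nu> (uminus -` B)"
    using mB by (subst nn_integral_cmult) (auto simp: mult.commute assms(2))
  finally show ?thesis .
qed

text \<open>Uniqueness of Haar measure: \<open>f\<close> is linear and onto, so the push-forward is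
  translation invariant, and the exchange identity with the unit ball, which is symmetric, makes it
  a multiple of \<open>lborel\<close>. The preimage of a ball of radius \<open>r\<close> has radius
  \<open>r / c\<close>, which determines the multiple without a determinant. Multiplication by a
  complex number and rotation of coordinates are both of this kind.\<close>

lemma distr_lborel_similarity:
  fixes f :: "'a::euclidean_space \<Rightarrow> 'a"
  assumes lin: "linear f" and c: "c > 0" and nrm: "\<And>x. norm (f x) = c * norm x"
  shows "distr lborel borel f = scale_measure (ennreal (1 / c ^ DIM('a))) lborel"
proof -
  define \<nu> where "\<nu> = distr lborel borel f"
  have cont: "continuous_on UNIV f"
    using lin by (simp add: linear_continuous_on linear_linear)
  then have [measurable]: "f \<in> borel_measurable borel"
    by (rule borel_measurable_continuous_onI)
  have sets_\<nu>[simp, measurable_cong]: "sets \<nu> = sets borel" by (simp add: \<nu>_def)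
  have inj: "inj f"
    unfolding linear_injective_0[OF lin] using c nrm by (metis mult_eq_0_iff norm_eq_zero norm_zero less_irrefl)
  then have surj: "surj f" by (rule linear_inj_imp_surj[OF lin])
  have preball: "f -` ball 0 r = ball 0 (r / c)" for r
    using c nrm by (auto simp: field_simps)
  have \<nu>ball: "emeasure \<nu> (ball 0 r) = emeasure lborel (ball (0::'a) (r / c))" for r
    by (simp add: \<nu>_def emeasure_distr preball)
  have sf: "sigma_finite_measure \<nu>"
  proof
    show "\<exists>A. countable A \<and> A \<subseteq> sets \<nu> \<and> \<Union>A = space \<nu> \<and> (\<forall>a\<in>A. emeasure \<nu> a \<noteq> \<infinity>)"
    proof (intro exI conjI)
      show "countable (range (\<lambda>n::nat. ball (0::'a) (real n)))" by simp
      show "range (\<lambda>n::nat. ball (0::'a) (real n)) \<subseteq> sets \<nu>" by auto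
      show "\<Union>(range (\<lambda>n::nat. ball (0::'a) (real n))) = space \<nu>"
        using reals_Archimedean2 by (auto simp: \<nu>_def)
      show "\<forall>a\<in>range (\<lambda>n::nat. ball (0::'a) (real n)). emeasure \<nu> a \<noteq> \<infinity>"
        using emeasure_lborel_ball_finite[of "0::'a"] by (auto simp: \<nu>ball less_top)
    qed
  qed
  have inv: "(\<integral>\<^sup>+y. g (x + y) \<partial>\<nu>) = (\<integral>\<^sup>+y. g y \<partial>\<nu>)" if [measurable]: "g \<in> borel_measurable borel"
    for g and x :: 'a
  proof -
    obtain x' where x': "x = f x'" using surj by blast
    have "(\<integral>\<^sup>+y. g (x + y) \<partial>\<nu>) = (\<integral>\<^sup>+y. g (x + f y) \<partial>lborel)"
      by (simp add: \<nu>_def nn_integral_distr)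
    also have "\<dots> = (\<integral>\<^sup>+y. g (f (x' + y)) \<partial>lborel)"
      by (simp add: x' linear_add[OF lin])
    also have "\<dots> = (\<integral>\<^sup>+y. g (f y) \<partial>distr lborel borel ((+) x'))"
      by (subst nn_integral_distr) auto
    also have "\<dots> = (\<integral>\<^sup>+y. g y \<partial>\<nu>)"
      by (simp add: lborel_distr_plus \<nu>_def nn_integral_distr)
    finally show ?thesis .
  qed
  have "emeasure \<nu> A = emeasure (scale_measure (ennreal (1 / c ^ DIM('a))) lborel) A" if "A \<in> sets \<nu>" for A
  proof -
    let ?B = "ball (0::'a) 1"
    have mball: "(uminus -` ?B) = ?B" by auto
    have v: "emeasure lborel ?B = ennreal (unit_ball_vol (real DIM('a)))"
      by (simp add: emeasure_ball)
    have "emeasure \<nu> A * emeasure lborel ?B = emeasure lborel A * emeasure \<nu> ?B"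
      using translation_invariant_measure_swap[OF sf sets_\<nu> inv, of A ?B] that mball by simp
    also have "emeasure \<nu> ?B = ennreal (1 / c ^ DIM('a)) * emeasure lborel ?B"
      unfolding \<nu>ball using c by (simp add: emeasure_ball power_divide mult.commute flip: ennreal_mult)
    finally have "emeasure \<nu> A * emeasure lborel ?B
        = (ennreal (1 / c ^ DIM('a)) * emeasure lborel A) * emeasure lborel ?B"
      by (simp add: mult_ac)
    moreover have "emeasure lborel ?B \<noteq> 0" "emeasure lborel ?B \<noteq> \<infinity>"
      unfolding v by (simp_all add: ennreal_eq_0_iff not_le unit_ball_vol_pos)
    ultimately show ?thesis
      by (auto simp: ennreal_mult_cancel_left mult.commute[of _ "emeasure lborel ?B"])
  qed
  then show ?thesis
    by (intro measure_eqI) (auto simp: \<nu>_def)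
qed

lemma nn_integral_lborel_similarity:
  fixes f :: "'a::euclidean_space \<Rightarrow> 'a"
  assumes lin: "linear f" and c: "c > 0" and nrm: "\<And>x. norm (f x) = c * norm x"
    and g[measurable]: "g \<in> borel_measurable borel"
  shows "(\<integral>\<^sup>+x. g (f x) \<partial>lborel) = ennreal (1 / c ^ DIM('a)) * (\<integral>\<^sup>+x. g x \<partial>lborel)"
proof -
  have [measurable]: "f \<in> borel_measurable borel"
    using lin by (intro borel_measurable_continuous_onI) (simp add: linear_continuous_on linear_linear)
  have "(\<integral>\<^sup>+x. g (f x) \<partial>lborel) = (\<integral>\<^sup>+x. g x \<partial>distr lborel borel f)"
    by (simp add: nn_integral_distr)
  also have "\<dots> = ennreal (1 / c ^ DIM('a)) * (\<integral>\<^sup>+x. g x \<partial>lborel)"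
    unfolding distr_lborel_similarity[OF lin c nrm] by (rule nn_integral_scale_measure) simp
  finally show ?thesis .
qed

lemma nn_integral_lborel_complex_affine:
  fixes p u :: complex
  assumes p: "p \<noteq> 0" and [measurable]: "g \<in> borel_measurable borel"
  shows "(\<integral>\<^sup>+x. g (p * x + u) \<partial>lborel) = ennreal (1 / (cmod p)\<^sup>2) * (\<integral>\<^sup>+x. g x \<partial>lborel)"
proof -
  have "(\<integral>\<^sup>+x. g (p * x + u) \<partial>lborel) = ennreal (1 / (cmod p)\<^sup>2) * (\<integral>\<^sup>+x. g (x + u) \<partial>lborel)"
    using nn_integral_lborel_similarity[of "(*) p" "cmod p" "\<lambda>x. g (x + u)"] p
    by (simp add: norm_mult linear_times)
  also have "(\<integral>\<^sup>+x. g (x + u) \<partial>lborel) = (\<integral>\<^sup>+x. g x \<partial>distr lborel borel ((+) u))"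
    by (subst nn_integral_distr) (auto simp: add.commute)
  finally show ?thesis by (simp add: lborel_distr_plus)
qed

text \<open>Gaussian elimination: a row with a large entry in the chosen column always exists, and the
  Schur complement inherits the lower bound on the matrix, so no determinant is needed.\<close>
lemma nn_integral_prod_linear_forms_le:
  fixes M :: "'k \<Rightarrow> 'a \<Rightarrow> complex" and h :: "'k \<Rightarrow> complex \<Rightarrow> ennreal"
  assumes "finite A" "finite K" "card K = card A" "card A \<le> N" "s > 0" "C \<ge> 0"
    and "\<And>x. s * (\<Sum>\<alpha>\<in>A. (cmod (x \<alpha>))\<^sup>2) \<le> (\<Sum>k\<in>K. (cmod (\<Sum>\<alpha>\<in>A. M k \<alpha> * x \<alpha>))\<^sup>2)"
    and "\<And>k. h k \<in> borel_measurable borel"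
    and "\<And>k. k \<in> K \<Longrightarrow> (\<integral>\<^sup>+y. h k y \<partial>lborel) \<le> ennreal C"
  shows "(\<integral>\<^sup>+a. (\<Prod>k\<in>K. h k (\<Sum>\<alpha>\<in>A. M k \<alpha> * a \<alpha>)) \<partial>PiM A (\<lambda>_. lborel)) \<le> ennreal ((C * N / s) ^ card A)"
  using assms
proof (induction A arbitrary: K M h rule: finite_induct)
  case empty
  then show ?case by (simp add: nn_integral_count_space_finite PiM_empty)
next
  case (insert \<beta> A)
  interpret product_sigma_finite "\<lambda>_::'a. lborel :: complex measure" ..
  interpret PA: sigma_finite_measure "PiM A (\<lambda>_::'a. lborel :: complex measure)"
    by (rule sigma_finite) (rule insert.hyps)
  interpret pair_sigma_finite "lborel :: complex measure" "PiM A (\<lambda>_::'a. lborel :: complex measure)" ..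
  note [measurable] = insert.prems(7)
  have N: "N > 0" using insert.prems insert.hyps by (auto)
  have low: "s * (\<Sum>\<alpha>\<in>insert \<beta> A. (cmod (x \<alpha>))\<^sup>2) \<le> (\<Sum>k\<in>K. (cmod (\<Sum>\<alpha>\<in>insert \<beta> A. M k \<alpha> * x \<alpha>))\<^sup>2)" for x
    by (rule insert.prems)
  \<comment> \<open>Pigeonhole: the lower bound at the unit vector of \<beta> shows that column
    \<beta> has squared norm at least \<open>s\<close>, and it has at most \<open>N\<close>
    entries.\<close>
  have "\<exists>k\<in>K. s / N \<le> (cmod (M k \<beta>))\<^sup>2"
  proof (rule ccontr)
    assume "\<not> ?thesis"
    then have lt: "\<And>k. k \<in> K \<Longrightarrow> (cmod (M k \<beta>))\<^sup>2 < s / N" by force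
    have "s \<le> (\<Sum>k\<in>K. (cmod (M k \<beta>))\<^sup>2)"
      using low[of "\<lambda>\<alpha>. if \<alpha> = \<beta> then 1 else 0"] insert.hyps
      by (simp add: if_distrib[of cmod] if_distrib[of "\<lambda>x. x^2"] if_distrib[of "\<lambda>x. _ * x"] sum.delta' cong: if_cong)
    also have "\<dots> < (\<Sum>k\<in>K. s / N)"
      using insert.prems insert.hyps by (intro sum_strict_mono lt) auto
    also have "\<dots> = card K * (s / N)" by simp
    also have "\<dots> \<le> s"
      using mult_left_mono[of "real (Suc (card A))" "real N" s] insert.prems(2-4) insert.hyps N by (simp add: field_simps)
    finally show False by simp
  qed
  then obtain k where k: "k \<in> K" and piv: "s / N \<le> (cmod (M k \<beta>))\<^sup>2" by blast
  define p where "p = M k \<beta>"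
  have p: "p \<noteq> 0" using piv N insert.prems(4) by (auto simp: p_def divide_le_0_iff)
  define K' where "K' = K - {k}"
  have K: "K = insert k K'" "k \<notin> K'" "finite K'" using k insert.prems by (auto simp: K'_def)
  \<comment> \<open>\<open>M'\<close> is the Schur complement of the pivot. In the new variable
    \<open>y = p * x + u k a\<close> every other row becomes a row of \<open>M'\<close> plus a
    multiple of \<open>y\<close>, and for fixed \<open>y\<close> that multiple merely shifts the
    argument of \<open>h k'\<close>.\<close>
  define M' where "M' = (\<lambda>k' \<alpha>. M k' \<alpha> - M k' \<beta> * M k \<alpha> / p)"
  define u where "u = (\<lambda>k' a. \<Sum>\<alpha>\<in>A. M k' \<alpha> * a \<alpha>)"
  define G where "G = (\<lambda>a y. h k y * (\<Prod>k'\<in>K'. h k' ((\<Sum>\<alpha>\<in>A. M' k' \<alpha> * a \<alpha>) + M k' \<beta> / p * y)))"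
  have M'u: "(\<Sum>\<alpha>\<in>A. M' k' \<alpha> * a \<alpha>) = u k' a - M k' \<beta> / p * u k a" for k' a
    by (simp add: M'_def u_def sum_subtractf sum_distrib_left algebra_simps)
  have IH: "(\<integral>\<^sup>+a. (\<Prod>k'\<in>K'. h k' ((\<Sum>\<alpha>\<in>A. M' k' \<alpha> * a \<alpha>) + M k' \<beta> / p * y)) \<partial>PiM A (\<lambda>_. lborel))
      \<le> ennreal ((C * N / s) ^ card A)" for y
  proof (rule insert.IH)
    show "card K' = card A" "card A \<le> N" using insert.prems insert.hyps K by auto
    show "s * (\<Sum>\<alpha>\<in>A. (cmod (x \<alpha>))\<^sup>2) \<le> (\<Sum>k\<in>K'. (cmod (\<Sum>\<alpha>\<in>A. M' k \<alpha> * x \<alpha>))\<^sup>2)" for x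
    proof -
      \<comment> \<open>The entry at \<beta> is chosen to annihilate the pivot row. The remaining
        rows then act on \<open>x'\<close> as \<open>M'\<close> acts on \<open>x\<close>, so the
        lower bound passes on with the same \<open>s\<close>.\<close>
      define x' where "x' = x(\<beta> := - u k x / p)"
      have row: "(\<Sum>\<alpha>\<in>insert \<beta> A. M k' \<alpha> * x' \<alpha>) = (\<Sum>\<alpha>\<in>A. M' k' \<alpha> * x \<alpha>)" for k'
      proof -
        have "(\<Sum>\<alpha>\<in>A. M k' \<alpha> * x' \<alpha>) = u k' x"
          unfolding u_def using insert.hyps by (intro sum.cong) (auto simp: x'_def)
        then show ?thesis using insert.hyps by (simp add: M'u x'_def)
      qed
      have row0: "(\<Sum>\<alpha>\<in>A. M' k \<alpha> * x \<alpha>) = 0"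
        using p by (simp add: M'u) (simp add: p_def)
      have "(\<Sum>\<alpha>\<in>A. (cmod (x \<alpha>))\<^sup>2) = (\<Sum>\<alpha>\<in>A. (cmod (x' \<alpha>))\<^sup>2)"
        using insert.hyps by (intro sum.cong) (auto simp: x'_def)
      also have "\<dots> \<le> (\<Sum>\<alpha>\<in>insert \<beta> A. (cmod (x' \<alpha>))\<^sup>2)"
        using insert.hyps by simp
      finally have "s * (\<Sum>\<alpha>\<in>A. (cmod (x \<alpha>))\<^sup>2) \<le> s * (\<Sum>\<alpha>\<in>insert \<beta> A. (cmod (x' \<alpha>))\<^sup>2)"
        using insert.prems by simp
      also have "\<dots> \<le> (\<Sum>k\<in>K. (cmod (\<Sum>\<alpha>\<in>insert \<beta> A. M k \<alpha> * x' \<alpha>))\<^sup>2)" by (rule low)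
      also have "\<dots> = (\<Sum>k\<in>K'. (cmod (\<Sum>\<alpha>\<in>A. M' k \<alpha> * x \<alpha>))\<^sup>2)"
        unfolding row using K row0 by simp
      finally show ?thesis .
    qed
    show "(\<integral>\<^sup>+ya. h k' (ya + M k' \<beta> / p * y) \<partial>lborel) \<le> ennreal C" if "k' \<in> K'" for k'
      using nn_integral_lborel_complex_affine[of 1 "h k'" "M k' \<beta> / p * y"] insert.prems(8)[of k'] that K
      by simp
  qed (use insert.prems K in auto)
  have "(\<integral>\<^sup>+a. (\<Prod>k\<in>K. h k (\<Sum>\<alpha>\<in>insert \<beta> A. M k \<alpha> * a \<alpha>)) \<partial>PiM (insert \<beta> A) (\<lambda>_. lborel))
      = (\<integral>\<^sup>+a. \<integral>\<^sup>+x. (\<Prod>k\<in>K. h k (\<Sum>\<alpha>\<in>insert \<beta> A. M k \<alpha> * (a(\<beta> := x)) \<alpha>)) \<partial>lborel \<partial>PiM A (\<lambda>_. lborel))"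
    using insert.hyps by (intro product_nn_integral_insert) measurable
  also have "\<dots> = (\<integral>\<^sup>+a. \<integral>\<^sup>+x. G a (p * x + u k a) \<partial>lborel \<partial>PiM A (\<lambda>_. lborel))"
  proof (intro nn_integral_cong)
    fix a x
    have r1: "(\<Sum>\<alpha>\<in>insert \<beta> A. M k' \<alpha> * (a(\<beta> := x)) \<alpha>) = M k' \<beta> * x + u k' a" for k'
    proof -
      have "(\<Sum>\<alpha>\<in>A. M k' \<alpha> * (a(\<beta> := x)) \<alpha>) = u k' a"
        unfolding u_def using insert.hyps by (intro sum.cong) auto
      then show ?thesis using insert.hyps by simp
    qed
    have r2: "M k' \<beta> * x + u k' a = (\<Sum>\<alpha>\<in>A. M' k' \<alpha> * a \<alpha>) + M k' \<beta> / p * (p * x + u k a)" for k'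
      unfolding M'u using p by (simp add: field_simps)
    have "(\<Prod>k\<in>K. h k (\<Sum>\<alpha>\<in>insert \<beta> A. M k \<alpha> * (a(\<beta> := x)) \<alpha>))
        = (\<Prod>k\<in>K. h k (M k \<beta> * x + u k a))"
      by (simp only: r1)
    also have "\<dots> = h k (p * x + u k a) * (\<Prod>k\<in>K'. h k (M k \<beta> * x + u k a))"
      using K by (simp add: p_def)
    also have "\<dots> = G a (p * x + u k a)"
      by (simp only: r2 G_def)
    finally show "(\<Prod>k\<in>K. h k (\<Sum>\<alpha>\<in>insert \<beta> A. M k \<alpha> * (a(\<beta> := x)) \<alpha>)) = G a (p * x + u k a)" .
  qed
  also have "\<dots> = (\<integral>\<^sup>+a. ennreal (1 / (cmod p)\<^sup>2) * (\<integral>\<^sup>+x. G a x \<partial>lborel) \<partial>PiM A (\<lambda>_. lborel))"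
  proof (intro nn_integral_cong)
    fix a
    show "(\<integral>\<^sup>+x. G a (p * x + u k a) \<partial>lborel) = ennreal (1 / (cmod p)\<^sup>2) * (\<integral>\<^sup>+x. G a x \<partial>lborel)"
      by (rule nn_integral_lborel_complex_affine[OF p]) (simp add: G_def)
  qed
  also have "\<dots> = ennreal (1 / (cmod p)\<^sup>2) * (\<integral>\<^sup>+a. (\<integral>\<^sup>+x. G a x \<partial>lborel) \<partial>PiM A (\<lambda>_. lborel))"
    by (rule nn_integral_cmult) (simp add: G_def)
  also have "(\<integral>\<^sup>+a. (\<integral>\<^sup>+x. G a x \<partial>lborel) \<partial>PiM A (\<lambda>_. lborel))
      = (\<integral>\<^sup>+x. (\<integral>\<^sup>+a. G a x \<partial>PiM A (\<lambda>_. lborel)) \<partial>lborel)"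
    by (rule Fubini') (simp add: G_def)
  also have "\<dots> \<le> (\<integral>\<^sup>+x. h k x * ennreal ((C * N / s) ^ card A) \<partial>lborel)"
  proof (rule nn_integral_mono)
    fix x
    have "(\<integral>\<^sup>+a. G a x \<partial>PiM A (\<lambda>_. lborel))
        = h k x * (\<integral>\<^sup>+a. (\<Prod>k'\<in>K'. h k' ((\<Sum>\<alpha>\<in>A. M' k' \<alpha> * a \<alpha>) + M k' \<beta> / p * x)) \<partial>PiM A (\<lambda>_. lborel))"
      unfolding G_def by (rule nn_integral_cmult) measurable
    also have "\<dots> \<le> h k x * ennreal ((C * N / s) ^ card A)"
      by (intro mult_left_mono IH) simp
    finally show "(\<integral>\<^sup>+a. G a x \<partial>PiM A (\<lambda>_. lborel)) \<le> h k x * ennreal ((C * N / s) ^ card A)" .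
  qed
  also have "\<dots> \<le> ennreal C * ennreal ((C * N / s) ^ card A)"
    using insert.prems(8)[OF k] by (subst nn_integral_multc) (auto intro!: mult_right_mono)
  finally have "(\<integral>\<^sup>+a. (\<Prod>k\<in>K. h k (\<Sum>\<alpha>\<in>insert \<beta> A. M k \<alpha> * a \<alpha>)) \<partial>PiM (insert \<beta> A) (\<lambda>_. lborel))
      \<le> ennreal (1 / (cmod p)\<^sup>2) * (ennreal C * ennreal ((C * N / s) ^ card A))"
    by (simp add: mult_left_mono)
  \<comment> \<open>The choice of the pivot bounds the Jacobian. Since \<open>N\<close> stays fixed
    during the induction, each elimination contributes the same factor
    \<open>C * N / s\<close>.\<close>
  also have "\<dots> \<le> ennreal (N / s) * (ennreal C * ennreal ((C * N / s) ^ card A))"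
    using piv p N insert.prems by (intro mult_right_mono ennreal_leI) (auto simp: field_simps p_def)
  also have "\<dots> = ennreal ((C * N / s) ^ card (insert \<beta> A))"
    using insert.hyps insert.prems N by (simp flip: ennreal_mult)
  finally show ?case .
qed

section \<open>Complex Gaussian variables\<close>

text \<open>Sum and integral of a non-summable family are both 0 by convention, so the identity is
  unconditional. It gives access to measurability of integrals depending on a parameter for series
  that converge only almost surely.\<close>

lemma infsum_eq_integral_count_space:
  fixes f :: "'i \<Rightarrow> complex"
  shows "infsum f A = integral\<^sup>L (count_space A) f"
proof (cases "f summable_on A")
  case True
  then have "Infinite_Sum.abs_summable_on f A" by (simp add: summable_on_iff_abs_summable_on_complex)
  then have "Infinite_Set_Sum.abs_summable_on f A" by (simp add: abs_summable_equivalent)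
  then show ?thesis by (simp add: infsetsum_infsum[symmetric] infsetsum_def)
next
  case False
  then have "\<not> Infinite_Sum.abs_summable_on f A" by (simp add: summable_on_iff_abs_summable_on_complex)
  then have "\<not> Infinite_Set_Sum.abs_summable_on f A" by (simp add: abs_summable_equivalent)
  then have "\<not> integrable (count_space A) f" by (simp add: Infinite_Set_Sum.abs_summable_on_def)
  with False show ?thesis by (simp add: infsum_not_exists not_integrable_integral_eq)
qed

lemma summable_on_iff_integrable_count_space:
  fixes f :: "'i \<Rightarrow> complex"
  shows "f summable_on A \<longleftrightarrow> integrable (count_space A) f"
  by (simp add: summable_on_iff_abs_summable_on_complex abs_summable_equivalent Infinite_Set_Sum.abs_summable_on_def)

lemma borel_measurable_infsum:
  fixes f :: "'i \<Rightarrow> 'a \<Rightarrow> complex"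
  assumes "countable A" and [measurable]: "\<And>i. i \<in> A \<Longrightarrow> f i \<in> borel_measurable M"
  shows "(\<lambda>x. infsum (\<lambda>i. f i x) A) \<in> borel_measurable M"
proof -
  interpret sigma_finite_measure "count_space A"
    by (rule sigma_finite_measure_count_space_countable) fact
  have "(\<lambda>(x, i). f i x) \<in> borel_measurable (M \<Otimes>\<^sub>M count_space A)"
    using measurable_pair_swap[OF measurable_pair_measure_countable1[of A "\<lambda>(i, x). f i x" M borel]] assms
    by simp
  then show ?thesis
    unfolding infsum_eq_integral_count_space by (rule borel_measurable_lebesgue_integral)
qed

text \<open>The power mean inequality for a weight of total mass at most \<open>S\<close>, obtained
  by integrating a tangent line of \<open>t ^ N\<close>. Values in \<open>ennreal\<close> avoid
  integrability conditions on \<open>y\<close>.\<close>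

lemma nn_integral_power_le:
  fixes w y :: "'a \<Rightarrow> ennreal"
  assumes [measurable]: "w \<in> borel_measurable Q" "y \<in> borel_measurable Q"
    and S: "(\<integral>\<^sup>+x. w x \<partial>Q) \<le> ennreal S" "S > 0" and N: "N > 0"
  shows "(\<integral>\<^sup>+x. w x * y x \<partial>Q) ^ N \<le> ennreal (S ^ (N - 1)) * (\<integral>\<^sup>+x. w x * y x ^ N \<partial>Q)"
proof -
  define U V where "U = (\<integral>\<^sup>+x. w x * y x \<partial>Q)" and "V = (\<integral>\<^sup>+x. w x * y x ^ N \<partial>Q)"
  \<comment> \<open>Bernoulli's inequality at \<open>r / c - 1\<close>, multiplied by
    \<open>c ^ N\<close>: the graph of \<open>t ^ N\<close> lies above its tangent at
    \<open>c\<close>.\<close>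
  have tangent: "ennreal (real N * c ^ (N - 1)) * t \<le> t ^ N + ennreal (real (N - 1) * c ^ N)" if "c > 0" for c t
  proof (cases t)
    case (real r)
    have "1 + real N * (r / c - 1) \<le> (1 + (r / c - 1)) ^ N"
      using real that by (intro Bernoulli_inequality) (auto simp: field_simps)
    then have "c ^ N * (1 + real N * (r / c - 1)) \<le> c ^ N * (r / c) ^ N"
      using that by simp
    also have "\<dots> = r ^ N" using that by (simp add: power_divide)
    also have "c ^ N * (1 + real N * (r / c - 1)) = real N * c ^ (N - 1) * r - (real N - 1) * c ^ N"
      using that N by (cases N) (auto simp: field_simps)
    finally have "real N * c ^ (N - 1) * r \<le> r ^ N + (real N - 1) * c ^ N" by simp
    then have "ennreal (real N * c ^ (N - 1) * r) \<le> ennreal (r ^ N + real (N - 1) * c ^ N)"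
      using N by (intro ennreal_leI) (simp add: of_nat_diff)
    then show ?thesis using real that N
      by (simp add: ennreal_mult ennreal_power)
  next
    case top
    then show ?thesis using N by simp
  qed
  have main: "ennreal (real N * c ^ (N - 1)) * U \<le> V + ennreal (real (N - 1) * c ^ N * S)" if c: "c > 0" for c
  proof -
    have "ennreal (real N * c ^ (N - 1)) * U = (\<integral>\<^sup>+x. w x * (ennreal (real N * c ^ (N - 1)) * y x) \<partial>Q)"
      unfolding U_def by (subst nn_integral_cmult[symmetric]) (auto simp: mult_ac)
    also have "\<dots> \<le> (\<integral>\<^sup>+x. w x * (y x ^ N + ennreal (real (N - 1) * c ^ N)) \<partial>Q)"
      by (intro nn_integral_mono mult_left_mono tangent c) auto
    also have "\<dots> = V + ennreal (real (N - 1) * c ^ N) * (\<integral>\<^sup>+x. w x \<partial>Q)"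
      unfolding V_def by (simp add: distrib_left nn_integral_add nn_integral_multc mult.commute)
    also have "\<dots> \<le> V + ennreal (real (N - 1) * c ^ N) * ennreal S"
      by (intro add_left_mono mult_left_mono S) auto
    finally show ?thesis using c S(2) by (simp add: ennreal_mult)
  qed
  show ?thesis
  proof (cases U)
    case (real u)
    show ?thesis
    proof (cases "V = \<infinity> \<or> u = 0")
      case True
      then show ?thesis
        using real N S unfolding U_def[symmetric] V_def[symmetric]
        by (auto simp: ennreal_mult_top zero_power)
    next
      case False
      then obtain v where v: "V = ennreal v" "v \<ge> 0" by (cases V) auto
      have u: "u > 0" using False real by auto
      \<comment> \<open>At this tangent point \<open>c ^ N * S\<close> equals
        \<open>c ^ (N - 1) * u\<close>, so the correction term cancels all but one of the
        \<open>N\<close> copies on the left.\<close>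
      define c where "c = u / S"
      have c: "c > 0" using u S by (simp add: c_def)
      have "ennreal (real N * c ^ (N - 1) * u) \<le> ennreal (v + real (N - 1) * c ^ N * S)"
        using main[OF c] v real c S by (simp flip: ennreal_mult ennreal_plus)
      then have "real N * c ^ (N - 1) * u \<le> v + real (N - 1) * c ^ N * S"
        using v c S by (subst (asm) ennreal_le_iff) (auto intro!: add_nonneg_nonneg mult_nonneg_nonneg)
      also have "real (N - 1) * c ^ N * S = (real N - 1) * (c ^ (N - 1) * u)"
        using N S by (cases N) (auto simp: c_def)
      finally have "c ^ (N - 1) * u \<le> v" using N by (simp add: algebra_simps of_nat_diff)
      then have "u ^ N \<le> S ^ (N - 1) * v"
        using N S u by (cases N) (auto simp: c_def power_divide field_simps)
      then show ?thesis unfolding U_def[symmetric] V_def[symmetric] v real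
        using S v u real by (simp add: ennreal_power ennreal_leI flip: ennreal_mult)
    qed
  next
    case top
    have "V = \<top>" using main[of 1] top N by (auto simp: ennreal_mult_top top_unique)
    then show ?thesis unfolding U_def[symmetric] V_def[symmetric] using S
      by (simp add: ennreal_mult_top)
  qed
qed

section \<open>The standard complex Gaussian law and its absolute moments\<close>

definition complex_gaussian :: "complex measure" where
  "complex_gaussian = density lborel (\<lambda>z. ennreal (exp (- (cmod z)\<^sup>2) / pi))"

lemma sets_complex_gaussian[simp, measurable_cong]: "sets complex_gaussian = sets borel"
  by (simp add: complex_gaussian_def)

lemma space_complex_gaussian[simp]: "space complex_gaussian = UNIV"
  by (simp add: complex_gaussian_def)

lemma nn_integral_exp_norm_square:
  assumes "\<kappa> > 0"
  shows "(\<integral>\<^sup>+z. ennreal (exp (- (cmod z)\<^sup>2 / \<kappa>)) \<partial>lborel) = ennreal (pi * \<kappa>)"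
proof -
  have one: "(\<integral>\<^sup>+x. ennreal (exp (- x\<^sup>2 / \<kappa>)) \<partial>lborel) = ennreal (sqrt (pi * \<kappa>))"
  proof -
    interpret prob_space "density lborel (\<lambda>x. ennreal (normal_density 0 (sqrt (\<kappa> / 2)) x))"
      by (rule prob_space_normal_density) (use assms in simp)
    have nd: "normal_density 0 (sqrt (\<kappa> / 2)) x = exp (- x\<^sup>2 / \<kappa>) / sqrt (pi * \<kappa>)" for x
      using assms by (simp add: normal_density_def)
    have "(\<integral>\<^sup>+x. ennreal (exp (- x\<^sup>2 / \<kappa>)) \<partial>lborel)
       = (\<integral>\<^sup>+x. ennreal (sqrt (pi * \<kappa>)) * ennreal (normal_density 0 (sqrt (\<kappa> / 2)) x) \<partial>lborel)"
      using assms by (intro nn_integral_cong) (simp add: nd flip: ennreal_mult)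
    also have "\<dots> = ennreal (sqrt (pi * \<kappa>)) * (\<integral>\<^sup>+x. ennreal (normal_density 0 (sqrt (\<kappa> / 2)) x) \<partial>lborel)"
      by (rule nn_integral_cmult) simp
    also have "(\<integral>\<^sup>+x. ennreal (normal_density 0 (sqrt (\<kappa> / 2)) x) \<partial>lborel) = 1"
      using emeasure_space_1 by (simp add: emeasure_density)
    finally show ?thesis by simp
  qed
  have "(\<integral>\<^sup>+z. ennreal (exp (- (cmod z)\<^sup>2 / \<kappa>)) \<partial>lborel)
     = (\<integral>\<^sup>+z. (\<Prod>b\<in>Basis. ennreal (exp (- ((z::complex) \<bullet> b)\<^sup>2 / \<kappa>))) \<partial>lborel)"
  proof (rule nn_integral_cong)
    fix z :: complex
    have "(\<Prod>b\<in>Basis. ennreal (exp (- (z \<bullet> b)\<^sup>2 / \<kappa>)))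
       = ennreal (exp (- (Re z)\<^sup>2 / \<kappa>)) * ennreal (exp (- (Im z)\<^sup>2 / \<kappa>))"
      by (simp add: Basis_complex_def inner_complex_def complex_eq_iff)
    also have "\<dots> = ennreal (exp (- (cmod z)\<^sup>2 / \<kappa>))"
      by (simp add: cmod_power2 diff_divide_distrib flip: ennreal_mult exp_add)
    finally show "ennreal (exp (- (cmod z)\<^sup>2 / \<kappa>)) = (\<Prod>b\<in>Basis. ennreal (exp (- (z \<bullet> b)\<^sup>2 / \<kappa>)))" ..
  qed
  also have "\<dots> = (\<Prod>b\<in>(Basis::complex set). ennreal (sqrt (pi * \<kappa>)))"
    by (subst nn_integral_lborel_prod) (simp_all add: one[simplified])
  also have "\<dots> = ennreal (pi * \<kappa>)"
    using assms by (simp add: ennreal_power)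
  finally show ?thesis .
qed

lemma prob_space_complex_gaussian: "prob_space complex_gaussian"
proof
  have "emeasure complex_gaussian (space complex_gaussian)
     = (\<integral>\<^sup>+z. ennreal (1 / pi) * ennreal (exp (- (cmod z)\<^sup>2 / 1)) \<partial>lborel)"
    unfolding complex_gaussian_def
    by (simp add: emeasure_density) (simp flip: ennreal_mult)
  also have "\<dots> = ennreal (1 / pi) * ennreal (pi * 1)"
    by (subst nn_integral_cmult) (simp_all only: nn_integral_exp_norm_square[of 1] zero_less_one, auto)
  finally show "emeasure complex_gaussian (space complex_gaussian) = 1"
    by (simp flip: ennreal_mult)
qed

lemma power_le_fact_mult_exp:
  fixes r :: real
  assumes "r \<ge> 0"
  shows "r ^ N \<le> fact N * exp r"
proof -
  have "(\<Sum>n\<in>{N}. inverse (fact n) * r ^ n) \<le> (\<Sum>n. inverse (fact n) * r ^ n)"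
    using assms by (intro sum_le_suminf summable_exp) auto
  then show ?thesis using assms
    by (simp add: exp_def field_simps)
qed

text \<open>From \<open>r ^ N \<le> fact N * exp r\<close> and
  \<open>exp (r - r\<^sup>2) \<le> 2 * exp (- r\<^sup>2 / 2)\<close>; the Gaussian integral
  \<open>2 * pi\<close> against the density factor \<open>1 / pi\<close> turns the 2 into 4. The
  factorial is far from sharp, but later only its \<open>N\<close>-th root matters, which is at most
  \<open>N\<close>.\<close>

lemma complex_gaussian_moment:
  "(\<integral>\<^sup>+z. ennreal (cmod z) ^ N \<partial>complex_gaussian) \<le> ennreal (4 * fact N)"
proof -
  have "(\<integral>\<^sup>+z. ennreal (cmod z) ^ N \<partial>complex_gaussian)
     = (\<integral>\<^sup>+z. ennreal (exp (- (cmod z)\<^sup>2) / pi) * ennreal (cmod z) ^ N \<partial>lborel)"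
    unfolding complex_gaussian_def by (subst nn_integral_density) auto
  also have "\<dots> \<le> (\<integral>\<^sup>+z. ennreal (2 * fact N / pi) * ennreal (exp (- (cmod z)\<^sup>2 / 2)) \<partial>lborel)"
  proof (rule nn_integral_mono)
    fix z :: complex
    define r where "r = cmod z"
    have "exp (- r\<^sup>2) * exp r \<le> exp (1/2) * exp (- r\<^sup>2 / 2)"
      using sum_squares_bound[of r 1] by (simp flip: exp_add)
    also have "exp (1/2 :: real) \<le> 2"
      using exp_bound_half[of "1/2::real"] by simp
    finally have *: "exp (- r\<^sup>2) * exp r \<le> 2 * exp (- r\<^sup>2 / 2)" by simp
    have "exp (- r\<^sup>2) * r ^ N \<le> exp (- r\<^sup>2) * (fact N * exp r)"
      by (intro mult_left_mono power_le_fact_mult_exp) (auto simp: r_def)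
    also have "\<dots> \<le> fact N * (2 * exp (- r\<^sup>2 / 2))"
      using mult_left_mono[OF *, of "fact N"] by (simp add: mult_ac)
    finally have "exp (- r\<^sup>2) / pi * r ^ N \<le> 2 * fact N / pi * exp (- r\<^sup>2 / 2)"
      by (simp add: field_simps)
    then show "ennreal (exp (- (cmod z)\<^sup>2) / pi) * ennreal (cmod z) ^ N
        \<le> ennreal (2 * fact N / pi) * ennreal (exp (- (cmod z)\<^sup>2 / 2))"
      by (simp add: ennreal_power r_def ennreal_leI flip: ennreal_mult)
  qed
  also have "\<dots> = ennreal (2 * fact N / pi) * ennreal (pi * 2)"
    using nn_integral_exp_norm_square[of 2] by (subst nn_integral_cmult) simp_all
  also have "\<dots> = ennreal (4 * fact N)"
    by (simp flip: ennreal_mult)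
  finally show ?thesis .
qed

section \<open>Integrability of inverse square root singularities\<close>

lemma nn_integral_inverse_sqrt_unit_interval:
  "(\<integral>\<^sup>+x. inverse (ennreal (sqrt \<bar>x\<bar>)) * indicator {-1..1} x \<partial>lborel) < \<infinity>"
proof -
  let ?f = "\<lambda>x::real. inverse (ennreal (sqrt \<bar>x\<bar>))"
  have "((\<lambda>x. x powr (-1/2)) has_integral (1 powr (-1/2 + 1) / (-1/2 + 1))) {0..1::real}"
    by (rule has_integral_powr_from_0) auto
  then have "((\<lambda>x. x powr (-1/2)) has_integral 2) {0..1::real}" by simp
  then have "(\<integral>\<^sup>+x. ennreal (indicator {0..1} x * x powr (-1/2)) \<partial>lborel) = ennreal 2"
    by (intro nn_integral_has_integral_lebesgue[where \<Omega>="{0..1}", THEN trans[rotated], simplified]) 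
       (auto simp: nn_integral_completion)
  moreover have "(\<integral>\<^sup>+x. ?f x * indicator {0..1} x \<partial>lborel)
      = (\<integral>\<^sup>+x. ennreal (indicator {0..1} x * x powr (-1/2)) \<partial>lborel)"
  proof (rule nn_integral_cong_AE)
    have "AE x in lborel. x \<noteq> (0::real)" by (rule AE_lborel_singleton)
    then show "AE x in lborel. ?f x * indicator {0..1} x = ennreal (indicator {0..1} x * x powr (-1/2))"
      by eventually_elim
        (auto simp: indicator_def inverse_ennreal powr_minus powr_half_sqrt)
  qed
  ultimately have half: "(\<integral>\<^sup>+x. ?f x * indicator {0..1} x \<partial>lborel) = 2" by simp
  have refl: "(\<integral>\<^sup>+x. ?f x * indicator {-1..0} x \<partial>lborel) = (\<integral>\<^sup>+x. ?f x * indicator {0..1} x \<partial>lborel)"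
    by (subst nn_integral_real_affine[where c="-1" and t=0]) (auto intro!: nn_integral_cong simp: indicator_def)
  have "(\<integral>\<^sup>+x. ?f x * indicator {-1..1} x \<partial>lborel)
     \<le> (\<integral>\<^sup>+x. ?f x * indicator {-1..0} x + ?f x * indicator {0..1} x \<partial>lborel)"
    by (intro nn_integral_mono) (auto simp: indicator_def)
  also have "\<dots> = 2 + 2"
    by (subst nn_integral_add) (simp_all add: refl half)
  finally show ?thesis
    by (rule order.strict_trans1) (simp add: less_top[symmetric])
qed

text \<open>One real coordinate carries the singularity, so the integral factors over
  \<open>Basis\<close>. This covers both the modulus in the plane and the modulus of one complex
  coordinate in several variables, since each dominates the absolute value of its real part.\<close>

lemma nn_integral_inverse_sqrt_cbox:
  fixes b :: "'a::euclidean_space"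
  assumes b: "b \<in> Basis"
  shows "(\<integral>\<^sup>+x. inverse (ennreal (sqrt \<bar>x \<bullet> b\<bar>)) * indicator (cbox (- One) One) x \<partial>lborel) < \<infinity>"
proof -
  define f where "f = (\<lambda>b' x. (if b' = b then inverse (ennreal (sqrt \<bar>x\<bar>)) else 1) * indicator {-1..1::real} x)"
  have [measurable]: "f b' \<in> borel_measurable borel" for b' by (simp add: f_def)
  have "inverse (ennreal (sqrt \<bar>x \<bullet> b\<bar>)) * indicator (cbox (- One) One) x = (\<Prod>b'\<in>Basis. f b' (x \<bullet> b'))" for x
  proof -
    have "(\<Prod>b'\<in>Basis. if b' = b then inverse (ennreal (sqrt \<bar>x \<bullet> b'\<bar>)) else 1) = inverse (ennreal (sqrt \<bar>x \<bullet> b\<bar>))"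
      using b by (subst prod.delta) auto
    moreover have "(\<Prod>b'\<in>Basis. indicator {-1..1::real} (x \<bullet> b')) = (indicator (cbox (- One) One) x :: ennreal)"
      by (auto simp: indicator_def mem_box prod_eq_1_iff inner_minus_left)
    ultimately show ?thesis
      by (simp add: f_def prod.distrib)
  qed
  then have "(\<integral>\<^sup>+x. inverse (ennreal (sqrt \<bar>x \<bullet> b\<bar>)) * indicator (cbox (- One) One) x \<partial>lborel)
     = (\<Prod>b'\<in>Basis. (\<integral>\<^sup>+x. f b' x \<partial>lborel))"
    by (simp add: nn_integral_lborel_prod)
  also have "\<dots> < \<infinity>"
  proof -
    have "(\<integral>\<^sup>+x. f b' x \<partial>lborel) \<noteq> \<top>" for b'
      using nn_integral_inverse_sqrt_unit_interval by (cases "b' = b") (auto simp: f_def less_top)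
    then show ?thesis
      by (simp add: less_top[symmetric] ennreal_prod_eq_top)
  qed
  finally show ?thesis .
qed

lemma inverse_ennreal_antimono:
  fixes a b :: ennreal
  assumes "a \<le> b"
  shows "inverse b \<le> inverse a"
proof (cases "a = 0 \<or> b = \<top>")
  case False
  then obtain r q where r: "a = ennreal r" "r > 0" and q: "b = ennreal q" "q > 0"
    using assms by (cases a; cases b) (auto simp: top_unique ennreal_le_iff2)
  with assms have "r \<le> q" by (simp add: ennreal_le_iff)
  then show ?thesis using r q by (simp add: inverse_ennreal ennreal_leI)
qed auto

definition singular_mass :: real where
  "singular_mass = enn2real (\<integral>\<^sup>+y. inverse (ennreal (sqrt (cmod y))) * indicator (ball 0 1) y \<partial>lborel)"

lemma singular_mass_nonneg: "singular_mass \<ge> 0"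
  by (simp add: singular_mass_def)

text \<open>The modulus is at least the absolute value of the real part and the disk lies in a
  square, so the integral is finite and \<open>enn2real\<close> in \<open>singular_mass\<close>
  loses nothing.\<close>

lemma nn_integral_singular_mass:
  "(\<integral>\<^sup>+y. inverse (ennreal (sqrt (cmod y))) * indicator (ball 0 1) y \<partial>lborel) = ennreal singular_mass"
proof -
  have "(\<integral>\<^sup>+y. inverse (ennreal (sqrt (cmod y))) * indicator (ball 0 1) y \<partial>lborel)
     \<le> (\<integral>\<^sup>+y. inverse (ennreal (sqrt \<bar>y \<bullet> (1::complex)\<bar>)) * indicator (cbox (- One) One) y \<partial>lborel)"
  proof (intro nn_integral_mono mult_mono)
    fix y :: complex
    have "\<bar>y \<bullet> 1\<bar> \<le> cmod y" using abs_Re_le_cmod[of y] by (simp add: inner_complex_def)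
    then show "inverse (ennreal (sqrt (cmod y))) \<le> inverse (ennreal (sqrt \<bar>y \<bullet> 1\<bar>))"
      by (intro inverse_ennreal_antimono ennreal_leI) simp
    have "y \<in> cbox (- One) One" if "cmod y < 1"
      using abs_Re_le_cmod[of y] abs_Im_le_cmod[of y] that by (auto simp: mem_box Basis_complex_def inner_complex_def)
    then show "indicator (ball 0 1) y \<le> (indicator (cbox (- One) One) y :: ennreal)"
      by (auto simp: indicator_def)
  qed auto
  also have "\<dots> < \<infinity>"
    by (rule nn_integral_inverse_sqrt_cbox) (simp add: Basis_complex_def)
  finally show ?thesis
    by (simp add: singular_mass_def less_top)
qed

text \<open>Uniformity in \<eta> is the point: \<eta> will be the contribution of the coefficients
  outside the window. Where \<open>cmod (y + \<eta>) \<ge> 1\<close> the inverse root is at most 1;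
  elsewhere the Gaussian factor is at most 1 and the singularity has mass
  \<open>singular_mass\<close> wherever it sits.\<close>

lemma nn_integral_singular_gaussian_le:
  assumes \<kappa>: "\<kappa> > 0"
  shows "(\<integral>\<^sup>+y. (1 + inverse (ennreal (sqrt (cmod (y + \<eta>))))) * ennreal (exp (- (cmod y)\<^sup>2 / \<kappa>)) \<partial>lborel)
    \<le> ennreal (2 * pi * \<kappa> + singular_mass)"
proof -
  let ?i = "\<lambda>y. inverse (ennreal (sqrt (cmod y)))"
  let ?e = "\<lambda>y. ennreal (exp (- (cmod y)\<^sup>2 / \<kappa>))"
  have [measurable]: "ball (0::complex) 1 \<in> sets borel" by simp
  have ptw: "(1 + ?i (y + \<eta>)) * ?e y \<le> 2 * ?e y + ?i (y + \<eta>) * indicator (ball 0 1) (y + \<eta>)" for y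
  proof (cases "cmod (y + \<eta>) < 1")
    case True
    have "(1 + ?i (y + \<eta>)) * ?e y = ?e y + ?i (y + \<eta>) * ?e y" by (simp add: distrib_right)
    also have "\<dots> \<le> 2 * ?e y + ?i (y + \<eta>) * 1"
      using \<kappa> by (intro add_mono mult_left_mono) (auto simp: mult_2)
    finally show ?thesis using True by simp
  next
    case False
    have "?i (y + \<eta>) \<le> inverse (ennreal 1)"
      using False by (intro inverse_ennreal_antimono ennreal_leI) simp
    then have "?i (y + \<eta>) \<le> 1" by simp
    then have "(1 + ?i (y + \<eta>)) * ?e y \<le> (1 + 1) * ?e y" by (intro mult_right_mono add_left_mono) auto
    then show ?thesis using False by simp
  qed
  have e2: "(\<integral>\<^sup>+y. 2 * ?e y \<partial>lborel) = 2 * (\<integral>\<^sup>+y. ?e y \<partial>lborel)"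
    by (rule nn_integral_cmult) measurable
  have "(\<integral>\<^sup>+y. (1 + ?i (y + \<eta>)) * ?e y \<partial>lborel)
      \<le> (\<integral>\<^sup>+y. 2 * ?e y + ?i (y + \<eta>) * indicator (ball 0 1) (y + \<eta>) \<partial>lborel)"
    by (intro nn_integral_mono ptw)
  also have "\<dots> = 2 * (\<integral>\<^sup>+y. ?e y \<partial>lborel) + (\<integral>\<^sup>+y. ?i (y + \<eta>) * indicator (ball 0 1) (y + \<eta>) \<partial>lborel)"
    unfolding e2[symmetric] by (rule nn_integral_add) measurable
  also have "(\<integral>\<^sup>+y. ?e y \<partial>lborel) = ennreal (pi * \<kappa>)"
    using nn_integral_exp_norm_square[OF \<kappa>] by simp
  also have "(\<integral>\<^sup>+y. ?i (y + \<eta>) * indicator (ball 0 1) (y + \<eta>) \<partial>lborel) = ennreal singular_mass"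
    using nn_integral_lborel_complex_affine[of 1 "\<lambda>y. ?i y * indicator (ball 0 1) y" \<eta>]
    by (simp add: nn_integral_singular_mass)
  also have "2 * ennreal (pi * \<kappa>) + ennreal singular_mass = ennreal (2 * pi * \<kappa> + singular_mass)"
    using \<kappa> singular_mass_nonneg by (simp add: ennreal_mult mult.assoc ennreal_numeral[symmetric] del: ennreal_numeral)
  finally show ?thesis .
qed

lemma PiM_density_lborel:
  fixes f :: "'b::euclidean_space \<Rightarrow> ennreal" and A :: "'i set"
  assumes A: "finite A" and [measurable]: "f \<in> borel_measurable borel"
    and sf: "sigma_finite_measure (density lborel f)"
  shows "PiM A (\<lambda>_. density lborel f) = density (PiM A (\<lambda>_. lborel)) (\<lambda>x. \<Prod>i\<in>A. f (x i))"
proof -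
  interpret L: product_sigma_finite "\<lambda>_::'i. lborel :: 'b measure"
    by (rule product_sigma_finite.intro) (rule lborel.sigma_finite_measure_axioms)
  interpret D: product_sigma_finite "\<lambda>_::'i. density lborel f"
    by (rule product_sigma_finite.intro) (rule sf)
  show ?thesis
  proof (rule D.PiM_eqI[OF A, symmetric])
    show "sets (density (Pi\<^sub>M A (\<lambda>_. lborel)) (\<lambda>x. \<Prod>i\<in>A. f (x i))) = sets (Pi\<^sub>M A (\<lambda>_. density lborel f))"
      unfolding sets_density by (rule sets_PiM_cong) simp_all
    fix X assume X: "\<And>i. i \<in> A \<Longrightarrow> X i \<in> sets (density lborel f)"
    then have [measurable]: "\<And>i. i \<in> A \<Longrightarrow> X i \<in> sets borel" by simp
    have "emeasure (density (Pi\<^sub>M A (\<lambda>_. lborel)) (\<lambda>x. \<Prod>i\<in>A. f (x i))) (Pi\<^sub>E A X)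
      = (\<integral>\<^sup>+x. (\<Prod>i\<in>A. f (x i)) * indicator (Pi\<^sub>E A X) x \<partial>PiM A (\<lambda>_. lborel))"
      using A by (intro emeasure_density) (auto intro!: sets_PiM_I_finite)
    also have "\<dots> = (\<integral>\<^sup>+x. (\<Prod>i\<in>A. f (x i) * indicator (X i) (x i)) \<partial>PiM A (\<lambda>_. lborel))"
    proof (rule nn_integral_cong)
      fix x assume x: "x \<in> space (PiM A (\<lambda>_::'i. lborel :: 'b measure))"
      have "indicator (Pi\<^sub>E A X) x = (\<Prod>i\<in>A. indicator (X i) (x i) :: ennreal)"
      proof (cases "\<forall>i\<in>A. x i \<in> X i")
        case True
        then show ?thesis using x by (simp add: space_PiM PiE_iff)
      next
        case False
        then obtain i where i: "i \<in> A" "x i \<notin> X i" by blast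
        then have "x \<notin> Pi\<^sub>E A X" by auto
        moreover have "(\<Prod>i\<in>A. indicator (X i) (x i) :: ennreal) = 0"
          using i A by (intro prod_zero bexI[of _ i]) auto
        ultimately show ?thesis by simp
      qed
      then show "(\<Prod>i\<in>A. f (x i)) * indicator (Pi\<^sub>E A X) x = (\<Prod>i\<in>A. f (x i) * indicator (X i) (x i))"
        by (simp add: prod.distrib)
    qed
    also have "\<dots> = (\<Prod>i\<in>A. \<integral>\<^sup>+x. f x * indicator (X i) x \<partial>lborel)"
      using A by (intro L.product_nn_integral_prod) auto
    also have "\<dots> = (\<Prod>i\<in>A. emeasure (density lborel f) (X i))"
      by (intro prod.cong refl) (simp add: emeasure_density)
    finally show "emeasure (density (Pi\<^sub>M A (\<lambda>_. lborel)) (\<lambda>x. \<Prod>i\<in>A. f (x i))) (Pi\<^sub>E A X)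
      = (\<Prod>i\<in>A. emeasure (density lborel f) (X i))" .
  qed
qed

section \<open>Series with independent Gaussian coefficients\<close>

lemma iid_measurable:
  assumes "iid_std_complex_gaussian M a"
  shows "a i \<in> borel_measurable M"
  using assms unfolding iid_std_complex_gaussian_def std_complex_gaussian_def
  by (auto dest!: distributed_measurable)

lemma iid_distr:
  assumes "iid_std_complex_gaussian M a"
  shows "distr M borel (a i) = complex_gaussian"
proof -
  have "distr M lborel (a i) = complex_gaussian"
    using assms unfolding iid_std_complex_gaussian_def std_complex_gaussian_def complex_gaussian_def
    by (auto simp: distributed_def)
  moreover have "distr M lborel (a i) = distr M borel (a i)"
    by (rule distr_cong) auto
  ultimately show ?thesis by simp
qed

lemma iid_nn_integral:
  assumes "iid_std_complex_gaussian M a" "g \<in> borel_measurable borel"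
  shows "(\<integral>\<^sup>+\<omega>. g (a i \<omega>) \<partial>M) = (\<integral>\<^sup>+z. g z \<partial>complex_gaussian)"
  unfolding iid_distr[OF assms(1), symmetric, of i]
  using assms iid_measurable[OF assms(1), of i] by (subst nn_integral_distr) auto

lemma borel_measurable_nn_integral_count_space:
  fixes f :: "'i::countable \<Rightarrow> 'a \<Rightarrow> ennreal"
  assumes [measurable]: "\<And>i. f i \<in> borel_measurable M"
  shows "(\<lambda>\<omega>. \<integral>\<^sup>+i. f i \<omega> \<partial>count_space UNIV) \<in> borel_measurable M"
proof -
  interpret C: sigma_finite_measure "count_space (UNIV::'i set)"
    by (rule sigma_finite_measure_count_space_countable) auto
  have "(\<lambda>(i, \<omega>). f i \<omega>) \<in> borel_measurable (count_space UNIV \<Otimes>\<^sub>M M)"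
    by (rule measurable_pair_measure_countable1) auto
  from measurable_pair_swap[OF this] show ?thesis
    by (intro C.borel_measurable_nn_integral) (simp add: case_prod_beta')
qed

text \<open>The power mean inequality moves the power inside the weighted series and leaves an
  absolute moment of a single coefficient.\<close>

lemma iid_series_moment_le:
  fixes a :: "'i::countable \<Rightarrow> 'w \<Rightarrow> complex"
  assumes iid: "iid_std_complex_gaussian M a"
    and w: "(\<integral>\<^sup>+i. w i \<partial>count_space UNIV) \<le> ennreal S" and S: "S > 0" and N: "N > 0"
  shows "(\<integral>\<^sup>+\<omega>. (\<integral>\<^sup>+i. w i * ennreal (cmod (a i \<omega>)) \<partial>count_space UNIV) ^ N \<partial>M)
    \<le> ennreal (S ^ N * (4 * fact N))"
proof -
  note [measurable] = iid_measurable[OF iid]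
  interpret prob_space M using iid by (simp add: iid_std_complex_gaussian_def)
  interpret C: sigma_finite_measure "count_space (UNIV::'i set)"
    by (rule sigma_finite_measure_count_space_countable) auto
  interpret pair_sigma_finite "count_space (UNIV::'i set)" M ..
  have meas: "(\<lambda>(i, \<omega>). w i * ennreal (cmod (a i \<omega>)) ^ N) \<in> borel_measurable (count_space UNIV \<Otimes>\<^sub>M M)"
    by (rule measurable_pair_measure_countable1) auto
  have "(\<integral>\<^sup>+\<omega>. (\<integral>\<^sup>+i. w i * ennreal (cmod (a i \<omega>)) \<partial>count_space UNIV) ^ N \<partial>M)
     \<le> (\<integral>\<^sup>+\<omega>. ennreal (S ^ (N - 1)) * (\<integral>\<^sup>+i. w i * ennreal (cmod (a i \<omega>)) ^ N \<partial>count_space UNIV) \<partial>M)"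
    using w S N by (intro nn_integral_mono nn_integral_power_le) auto
  also have "\<dots> = ennreal (S ^ (N - 1)) * (\<integral>\<^sup>+\<omega>. (\<integral>\<^sup>+i. w i * ennreal (cmod (a i \<omega>)) ^ N \<partial>count_space UNIV) \<partial>M)"
    by (intro nn_integral_cmult borel_measurable_nn_integral_count_space) measurable
  also have "(\<integral>\<^sup>+\<omega>. (\<integral>\<^sup>+i. w i * ennreal (cmod (a i \<omega>)) ^ N \<partial>count_space UNIV) \<partial>M)
     = (\<integral>\<^sup>+i. (\<integral>\<^sup>+\<omega>. w i * ennreal (cmod (a i \<omega>)) ^ N \<partial>M) \<partial>count_space UNIV)"
    using Fubini'[OF meas] .
  also have "\<dots> \<le> (\<integral>\<^sup>+i. w i * ennreal (4 * fact N) \<partial>count_space UNIV)"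
  proof (rule nn_integral_mono)
    fix i
    have "(\<integral>\<^sup>+\<omega>. w i * ennreal (cmod (a i \<omega>)) ^ N \<partial>M) = w i * (\<integral>\<^sup>+\<omega>. ennreal (cmod (a i \<omega>)) ^ N \<partial>M)"
      by (rule nn_integral_cmult) measurable
    also have "(\<integral>\<^sup>+\<omega>. ennreal (cmod (a i \<omega>)) ^ N \<partial>M) = (\<integral>\<^sup>+z. ennreal (cmod z) ^ N \<partial>complex_gaussian)"
      by (rule iid_nn_integral[OF iid]) measurable
    also have "w i * \<dots> \<le> w i * ennreal (4 * fact N)"
      by (intro mult_left_mono complex_gaussian_moment) simp
    finally show "(\<integral>\<^sup>+\<omega>. w i * ennreal (cmod (a i \<omega>)) ^ N \<partial>M) \<le> w i * ennreal (4 * fact N)" .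
  qed
  also have "\<dots> = (\<integral>\<^sup>+i. w i \<partial>count_space UNIV) * ennreal (4 * fact N)"
    by (rule nn_integral_multc) simp
  also have "\<dots> \<le> ennreal S * ennreal (4 * fact N)"
    using w by (intro mult_right_mono) auto
  finally have "(\<integral>\<^sup>+\<omega>. (\<integral>\<^sup>+i. w i * ennreal (cmod (a i \<omega>)) \<partial>count_space UNIV) ^ N \<partial>M)
      \<le> ennreal (S ^ (N - 1)) * (ennreal S * ennreal (4 * fact N))"
    by (simp add: mult_left_mono)
  also have "\<dots> = ennreal (S ^ N * (4 * fact N))"
    using S N by (cases N) (simp_all add: mult_ac flip: ennreal_mult)
  finally show ?thesis .
qed

lemma iid_series_AE_summable:
  fixes a :: "'i::countable \<Rightarrow> 'w \<Rightarrow> complex"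
  assumes iid: "iid_std_complex_gaussian M a"
    and b: "(\<integral>\<^sup>+i. ennreal (cmod (b i)) \<partial>count_space UNIV) < \<infinity>"
  shows "AE \<omega> in M. (\<lambda>i. a i \<omega> * b i) summable_on UNIV"
proof -
  note [measurable] = iid_measurable[OF iid]
  interpret prob_space M using iid by (simp add: iid_std_complex_gaussian_def)
  define T where "T = (\<lambda>\<omega>. \<integral>\<^sup>+i. ennreal (cmod (b i)) * ennreal (cmod (a i \<omega>)) \<partial>count_space UNIV)"
  have [measurable]: "T \<in> borel_measurable M"
    unfolding T_def by (rule borel_measurable_nn_integral_count_space) measurable
  obtain S where S: "(\<integral>\<^sup>+i. ennreal (cmod (b i)) \<partial>count_space UNIV) = ennreal S" "S \<ge> 0"
    using b by (cases "\<integral>\<^sup>+i. ennreal (cmod (b i)) \<partial>count_space UNIV") auto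
  have "(\<integral>\<^sup>+\<omega>. T \<omega> ^ 1 \<partial>M) \<le> ennreal ((S + 1) ^ 1 * (4 * fact 1))"
    unfolding T_def using S by (intro iid_series_moment_le[OF iid]) (auto intro: ennreal_leI)
  also have "\<dots> < \<top>" by simp
  finally have "AE \<omega> in M. T \<omega> \<noteq> \<infinity>"
    by (intro nn_integral_PInf_AE) auto
  then show ?thesis
  proof eventually_elim
    case (elim \<omega>)
    then have "integrable (count_space UNIV) (\<lambda>i. a i \<omega> * b i)"
      by (intro integrableI_bounded) (auto simp: T_def norm_mult ennreal_mult mult.commute less_top)
    then show ?case by (simp add: summable_on_iff_integrable_count_space)
  qed
qed

text \<open>A non-summable family has sum 0, so the bound is unconditional and can be applied at
  every \<omega> without an exceptional set.\<close>

lemma norm_infsum_le_nn_integral: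
  fixes f :: "'i \<Rightarrow> complex"
  shows "ennreal (cmod (infsum f A)) \<le> (\<integral>\<^sup>+i. ennreal (cmod (f i)) \<partial>count_space A)"
proof (cases "integrable (count_space A) f")
  case True
  then show ?thesis unfolding infsum_eq_integral_count_space by (rule integral_norm_bound_ennreal)
next
  case False
  then show ?thesis by (simp add: infsum_eq_integral_count_space not_integrable_integral_eq)
qed

text \<open>Conditioning on the coefficients outside \<open>A\<close>: the two blocks are
  independent, and the block in \<open>A\<close> has the Gaussian product law. The law of the other
  block stays abstract because the inner integral will be bounded uniformly in
  \<open>y\<close>.\<close>

lemma iid_distr_split:
  fixes a :: "'i \<Rightarrow> 'w \<Rightarrow> complex"
  assumes iid: "iid_std_complex_gaussian M a" and A: "finite A" "A \<noteq> {}"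
    and F[measurable]: "F \<in> borel_measurable (PiM A (\<lambda>_. borel) \<Otimes>\<^sub>M PiM (- A) (\<lambda>_. borel))"
  shows "(\<integral>\<^sup>+\<omega>. F (restrict (\<lambda>i. a i \<omega>) A, restrict (\<lambda>i. a i \<omega>) (- A)) \<partial>M)
    = (\<integral>\<^sup>+y. (\<integral>\<^sup>+x. F (x, y) \<partial>PiM A (\<lambda>_. complex_gaussian)) \<partial>distr M (PiM (- A) (\<lambda>_. borel)) (\<lambda>\<omega>. restrict (\<lambda>i. a i \<omega>) (- A)))"
proof -
  note [measurable] = iid_measurable[OF iid]
  interpret prob_space M using iid by (simp add: iid_std_complex_gaussian_def)
  have ind: "indep_vars (\<lambda>_. borel) a UNIV" using iid by (simp add: iid_std_complex_gaussian_def)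
  let ?B = "\<lambda>I. PiM I (\<lambda>_::'i. borel :: complex measure)"
  let ?Y = "\<lambda>I \<omega>. restrict (\<lambda>i. a i \<omega>) I"
  define K where "K = (\<lambda>b. if b then A else - A)"
  have "indep_vars (\<lambda>j. ?B (K j)) (\<lambda>j \<omega>. ?Y (K j) \<omega>) (UNIV :: bool set)"
    by (rule indep_vars_restrict[OF ind]) (auto simp: disjoint_family_on_def K_def)
  then have "indep_var (?B A) (?Y A) (?B (- A)) (?Y (- A))"
    unfolding indep_var_def by (rule indep_vars_cong[THEN iffD1, rotated -1]) (auto simp: K_def split: bool.splits)
  then have eq: "distr M (?B A) (?Y A) \<Otimes>\<^sub>M distr M (?B (- A)) (?Y (- A))
      = distr M (?B A \<Otimes>\<^sub>M ?B (- A)) (\<lambda>\<omega>. (?Y A \<omega>, ?Y (- A) \<omega>))"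
    by (simp add: indep_var_distribution_eq)
  have "indep_vars (\<lambda>_. borel) a A" by (rule indep_vars_subset[OF ind]) auto
  then have dA: "distr M (?B A) (?Y A) = PiM A (\<lambda>_. complex_gaussian)"
    using A by (subst (asm) indep_vars_iff_distr_eq_PiM) (auto simp: iid_distr[OF iid])
  interpret P1: prob_space "distr M (?B A) (?Y A)" by (rule prob_space_distr) measurable
  interpret P2: prob_space "distr M (?B (- A)) (?Y (- A))" by (rule prob_space_distr) measurable
  interpret pair_sigma_finite "distr M (?B A) (?Y A)" "distr M (?B (- A)) (?Y (- A))" ..
  have "(\<integral>\<^sup>+\<omega>. F (?Y A \<omega>, ?Y (- A) \<omega>) \<partial>M)
      = (\<integral>\<^sup>+p. F p \<partial>distr M (?B A \<Otimes>\<^sub>M ?B (- A)) (\<lambda>\<omega>. (?Y A \<omega>, ?Y (- A) \<omega>)))"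
    by (subst nn_integral_distr) auto
  also have "\<dots> = (\<integral>\<^sup>+y. (\<integral>\<^sup>+x. F (x, y) \<partial>distr M (?B A) (?Y A)) \<partial>distr M (?B (- A)) (?Y (- A)))"
    unfolding eq[symmetric] by (rule nn_integral_snd[symmetric]) measurable
  finally show ?thesis by (simp add: dA)
qed

text \<open>Given the coefficients outside \<open>A\<close>, the values are linear forms in finitely
  many Gaussians plus constants. The upper bound on the forms replaces the Gaussian density by a
  product of Gaussians in the forms themselves; each factor of the integrand then depends on one
  form only, and \<open>nn_integral_prod_linear_forms_le\<close> applies.\<close>

lemma iid_prod_inverse_sqrt_le:
  fixes a :: "'i::countable \<Rightarrow> 'w \<Rightarrow> complex" and b :: "'k \<Rightarrow> 'i \<Rightarrow> complex"
  assumes iid: "iid_std_complex_gaussian M a"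
    and fin: "finite A" "finite K" "card K = card A" "A \<noteq> {}"
    and s: "s > 0" and \<kappa>: "\<kappa> > 0"
    and low: "\<And>x. s * (\<Sum>i\<in>A. (cmod (x i))\<^sup>2) \<le> (\<Sum>k\<in>K. (cmod (\<Sum>i\<in>A. b k i * x i))\<^sup>2)"
    and upp: "\<And>x. (\<Sum>k\<in>K. (cmod (\<Sum>i\<in>A. b k i * x i))\<^sup>2) \<le> \<kappa> * (\<Sum>i\<in>A. (cmod (x i))\<^sup>2)"
    and b: "\<And>k. k \<in> K \<Longrightarrow> (\<integral>\<^sup>+i. ennreal (cmod (b k i)) \<partial>count_space UNIV) < \<infinity>"
  shows "(\<integral>\<^sup>+\<omega>. (\<Prod>k\<in>K. 1 + inverse (ennreal (sqrt (cmod (\<Sum>\<^sub>\<infinity>i. a i \<omega> * b k i))))) \<partial>M)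
    \<le> ennreal (((2 * pi * \<kappa> + singular_mass) * card A / (pi * s)) ^ card A)"
proof -
  note [measurable] = iid_measurable[OF iid]
  interpret prob_space M using iid by (simp add: iid_std_complex_gaussian_def)
  let ?h = "\<lambda>z. 1 + inverse (ennreal (sqrt (cmod z)))"
  let ?n = "card A"
  let ?C = "2 * pi * \<kappa> + singular_mass"
  have C: "?C > 0" using \<kappa> singular_mass_nonneg by (simp add: add_pos_nonneg)
  define \<eta> where "\<eta> = (\<lambda>y k. infsum (\<lambda>i. y i * b k i) (- A))"
  define F where "F = (\<lambda>(x, y). \<Prod>k\<in>K. ?h ((\<Sum>i\<in>A. b k i * x i) + \<eta> y k))"
  have "(\<lambda>y. \<eta> y k) \<in> borel_measurable (PiM (- A) (\<lambda>_. borel))" for k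
    unfolding \<eta>_def
  proof (rule borel_measurable_infsum)
    fix i assume [measurable]: "i \<in> - A"
    show "(\<lambda>y. y i * b k i) \<in> borel_measurable (Pi\<^sub>M (- A) (\<lambda>_. borel))" by measurable
  qed auto
  note [measurable] = this
  have F[measurable]: "F \<in> borel_measurable (PiM A (\<lambda>_. borel) \<Otimes>\<^sub>M PiM (- A) (\<lambda>_. borel))"
    unfolding F_def by measurable
  \<comment> \<open>Splitting the series into window and remainder needs summability, which holds
    almost surely for all of the finitely many \<open>k\<close> at once.\<close>
  have "AE \<omega> in M. \<forall>k\<in>K. (\<lambda>i. a i \<omega> * b k i) summable_on UNIV"
    using fin b by (intro AE_finite_allI iid_series_AE_summable[OF iid]) auto
  then have "AE \<omega> in M. (\<Prod>k\<in>K. ?h (\<Sum>\<^sub>\<infinity>i. a i \<omega> * b k i))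
      = F (restrict (\<lambda>i. a i \<omega>) A, restrict (\<lambda>i. a i \<omega>) (- A))"
  proof eventually_elim
    case (elim \<omega>)
    have "(\<Sum>\<^sub>\<infinity>i. a i \<omega> * b k i) = (\<Sum>i\<in>A. b k i * restrict (\<lambda>i. a i \<omega>) A i) + \<eta> (restrict (\<lambda>i. a i \<omega>) (- A)) k"
      if k: "k \<in> K" for k
    proof -
      have "(\<Sum>\<^sub>\<infinity>i\<in>A \<union> - A. a i \<omega> * b k i) = infsum (\<lambda>i. a i \<omega> * b k i) A + infsum (\<lambda>i. a i \<omega> * b k i) (- A)"
        using elim k fin by (intro infsum_Un_disjoint) (auto intro: summable_on_subset_banach)
      moreover have "infsum (\<lambda>i. a i \<omega> * b k i) (- A) = \<eta> (restrict (\<lambda>i. a i \<omega>) (- A)) k"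
        unfolding \<eta>_def by (intro infsum_cong) auto
      ultimately show ?thesis using fin by (simp add: mult.commute)
    qed
    then show ?case unfolding F_def by simp
  qed
  then have "(\<integral>\<^sup>+\<omega>. (\<Prod>k\<in>K. ?h (\<Sum>\<^sub>\<infinity>i. a i \<omega> * b k i)) \<partial>M)
     = (\<integral>\<^sup>+\<omega>. F (restrict (\<lambda>i. a i \<omega>) A, restrict (\<lambda>i. a i \<omega>) (- A)) \<partial>M)"
    by (rule nn_integral_cong_AE)
  also have "\<dots> = (\<integral>\<^sup>+y. (\<integral>\<^sup>+x. F (x, y) \<partial>PiM A (\<lambda>_. complex_gaussian))
      \<partial>distr M (PiM (- A) (\<lambda>_. borel)) (\<lambda>\<omega>. restrict (\<lambda>i. a i \<omega>) (- A)))"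
    using fin by (intro iid_distr_split[OF iid]) auto
  also have "\<dots> \<le> (\<integral>\<^sup>+y. ennreal ((?C * ?n / (pi * s)) ^ ?n)
      \<partial>distr M (PiM (- A) (\<lambda>_. borel)) (\<lambda>\<omega>. restrict (\<lambda>i. a i \<omega>) (- A)))"
  proof (rule nn_integral_mono)
    fix y
    let ?w = "\<lambda>z. ennreal (exp (- (cmod z)\<^sup>2) / pi)"
    have [measurable]: "?w \<in> borel_measurable borel" by measurable
    have "(\<integral>\<^sup>+x. F (x, y) \<partial>PiM A (\<lambda>_. complex_gaussian))
       = (\<integral>\<^sup>+x. F (x, y) \<partial>density (PiM A (\<lambda>_. lborel)) (\<lambda>x. \<Prod>i\<in>A. ?w (x i)))"
      using prob_space_complex_gaussian unfolding complex_gaussian_def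
      by (subst PiM_density_lborel) (use fin in \<open>auto intro: prob_space_imp_sigma_finite\<close>)
    also have "\<dots> = (\<integral>\<^sup>+x. (\<Prod>i\<in>A. ?w (x i)) * F (x, y) \<partial>PiM A (\<lambda>_. lborel))"
      unfolding F_def case_prod_conv by (rule nn_integral_density) measurable
    also have "\<dots> \<le> (\<integral>\<^sup>+x. ennreal ((1 / pi) ^ ?n) * (\<Prod>k\<in>K. ?h ((\<Sum>i\<in>A. b k i * x i) + \<eta> y k)
         * ennreal (exp (- (cmod (\<Sum>i\<in>A. b k i * x i))\<^sup>2 / \<kappa>))) \<partial>PiM A (\<lambda>_. lborel))"
    proof (rule nn_integral_mono)
      fix x
      have "(\<Prod>i\<in>A. ?w (x i)) = ennreal ((1 / pi) ^ ?n * exp (- (\<Sum>i\<in>A. (cmod (x i))\<^sup>2)))"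
        using fin by (simp add: prod_ennreal prod_dividef exp_sum sum_negf[symmetric] power_one_over field_simps)
      \<comment> \<open>Decay in the coefficients is traded for decay in the linear forms, one
        Gaussian factor of width \<kappa> for each \<open>k\<close>.\<close>
      also have "\<dots> \<le> ennreal ((1 / pi) ^ ?n * exp (- (\<Sum>k\<in>K. (cmod (\<Sum>i\<in>A. b k i * x i))\<^sup>2) / \<kappa>))"
        using upp[of x] \<kappa> by (intro ennreal_leI mult_left_mono) (auto simp: field_simps)
      also have "exp (- (\<Sum>k\<in>K. (cmod (\<Sum>i\<in>A. b k i * x i))\<^sup>2) / \<kappa>)
          = (\<Prod>k\<in>K. exp (- (cmod (\<Sum>i\<in>A. b k i * x i))\<^sup>2 / \<kappa>))"
        using fin by (simp add: exp_sum sum_negf sum_divide_distrib flip: sum_negf)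
      finally have "(\<Prod>i\<in>A. ?w (x i)) \<le> ennreal ((1 / pi) ^ ?n) * (\<Prod>k\<in>K. ennreal (exp (- (cmod (\<Sum>i\<in>A. b k i * x i))\<^sup>2 / \<kappa>)))"
        by (simp add: ennreal_mult prod_ennreal prod_nonneg)
      then have "(\<Prod>i\<in>A. ?w (x i)) * F (x, y) \<le> (ennreal ((1 / pi) ^ ?n) * (\<Prod>k\<in>K. ennreal (exp (- (cmod (\<Sum>i\<in>A. b k i * x i))\<^sup>2 / \<kappa>)))) * F (x, y)"
        by (rule mult_right_mono) simp
      then show "(\<Prod>i\<in>A. ?w (x i)) * F (x, y) \<le> ennreal ((1 / pi) ^ ?n) * (\<Prod>k\<in>K. ?h ((\<Sum>i\<in>A. b k i * x i) + \<eta> y k)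
         * ennreal (exp (- (cmod (\<Sum>i\<in>A. b k i * x i))\<^sup>2 / \<kappa>)))"
        by (simp add: F_def prod.distrib mult_ac)
    qed
    also have "\<dots> = ennreal ((1 / pi) ^ ?n) * (\<integral>\<^sup>+x. (\<Prod>k\<in>K. ?h ((\<Sum>i\<in>A. b k i * x i) + \<eta> y k)
         * ennreal (exp (- (cmod (\<Sum>i\<in>A. b k i * x i))\<^sup>2 / \<kappa>))) \<partial>PiM A (\<lambda>_. lborel))"
      by (rule nn_integral_cmult) measurable
    also have "\<dots> \<le> ennreal ((1 / pi) ^ ?n) * ennreal ((?C * ?n / s) ^ ?n)"
      using fin s C low nn_integral_singular_gaussian_le[OF \<kappa>]
      by (intro mult_left_mono nn_integral_prod_linear_forms_le
         [where h="\<lambda>k z. ?h (z + \<eta> y k) * ennreal (exp (- (cmod z)\<^sup>2 / \<kappa>))"]) auto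
    also have "\<dots> = ennreal ((?C * ?n / (pi * s)) ^ ?n)"
      using C s by (simp add: power_mult_distrib power_divide flip: ennreal_mult)
    finally show "(\<integral>\<^sup>+x. F (x, y) \<partial>PiM A (\<lambda>_. complex_gaussian)) \<le> ennreal ((?C * ?n / (pi * s)) ^ ?n)" .
  qed
  also have "\<dots> = ennreal ((?C * ?n / (pi * s)) ^ ?n)"
  proof -
    interpret P2: prob_space "distr M (PiM (- A) (\<lambda>_. borel)) (\<lambda>\<omega>. restrict (\<lambda>i. a i \<omega>) (- A))"
      by (rule prob_space_distr) measurable
    show ?thesis by (simp add: P2.emeasure_space_1 del: space_distr)
  qed
  finally show ?thesis .
qed

section \<open>Negative binomial weights\<close>

text \<open>The probability of \<open>n\<close> under the negative binomial law of real size
  \<open>L\<close>. At \<open>t = (cmod (z $ j))\<^sup>2\<close> it is the factor of coordinate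
  \<open>j\<close> in the squared modulus of a term of \<open>f / \<surd>K\<close>, taken without
  its random coefficient.\<close>

definition neg_binomial :: "real \<Rightarrow> real \<Rightarrow> nat \<Rightarrow> real" where
  "neg_binomial L t n = Gamma (L + real n) / (fact n * Gamma L) * t ^ n * (1 - t) powr L"

lemma Gamma_plus1_pos:
  fixes x :: real
  assumes "x > 0"
  shows "Gamma (x + 1) = x * Gamma x"
  using assms by (intro Gamma_plus1) (auto dest: nonpos_Ints_nonpos)

lemma neg_binomial_nonneg:
  assumes "L > 0" "t \<ge> 0"
  shows "neg_binomial L t n \<ge> 0"
proof -
  have "Gamma (L + real n) > 0" "Gamma L > 0" using assms by (auto intro!: Gamma_real_pos)
  then show ?thesis using assms by (simp add: neg_binomial_def)
qed

lemma neg_binomial_sums: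
  assumes L: "L > 0" and t: "0 \<le> t" "t < 1"
  shows "neg_binomial L t sums 1"
proof -
  have "(\<lambda>n. ((- L) gchoose n) * (- t) ^ n) sums (1 + - t) powr (- L)"
    using t by (intro gen_binomial_real) auto
  moreover have "((- L) gchoose n) * (- t) ^ n = Gamma (L + real n) / (fact n * Gamma L) * t ^ n" for n
  proof -
    have "L \<notin> \<int>\<^sub>\<le>\<^sub>0" using L by (auto dest: nonpos_Ints_nonpos)
    then have "pochhammer L n = Gamma (L + real n) / Gamma L" by (rule pochhammer_Gamma)
    then have "((- L) gchoose n) * (- t) ^ n = Gamma (L + real n) / (fact n * Gamma L) * ((- 1) ^ n * (- t) ^ n)"
      by (simp add: gbinomial_pochhammer mult_ac)
    also have "(- 1) ^ n * (- t) ^ n = t ^ n"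
      by (simp flip: power_mult_distrib)
    finally show ?thesis .
  qed
  ultimately have "(\<lambda>n. Gamma (L + real n) / (fact n * Gamma L) * t ^ n) sums (1 - t) powr (- L)"
    by simp
  then have "(\<lambda>n. Gamma (L + real n) / (fact n * Gamma L) * t ^ n * (1 - t) powr L) sums ((1 - t) powr (- L) * (1 - t) powr L)"
    by (rule sums_mult2)
  also have "(1 - t) powr (- L) * (1 - t) powr L = 1"
    using t by (simp flip: powr_add)
  finally show ?thesis by (simp add: neg_binomial_def[abs_def])
qed

text \<open>By the functional equation of Gamma, the factor \<open>(L + n) * (L + n + 1)\<close>
  turns the law of size \<open>L\<close> into a multiple of the law of size \<open>L + 2\<close>,
  which has total mass 1.\<close>

lemma neg_binomial_second_moment_sums:
  fixes L t :: real
  assumes L: "L > 0" and t: "0 \<le> t" "t < 1"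
  shows "(\<lambda>n. (L + n) * (L + n + 1) * neg_binomial L t n) sums (L * (L + 1) / (1 - t)\<^sup>2)"
proof -
  have "(\<lambda>n. L * (L + 1) / (1 - t)\<^sup>2 * neg_binomial (L + 2) t n) sums (L * (L + 1) / (1 - t)\<^sup>2 * 1)"
    using L t by (intro sums_mult neg_binomial_sums) auto
  moreover have "L * (L + 1) / (1 - t)\<^sup>2 * neg_binomial (L + 2) t n = (L + n) * (L + n + 1) * neg_binomial L t n" for n
  proof -
    have G: "Gamma (x + 2) = (x + 1) * x * Gamma x" if "x > 0" for x :: real
      using that Gamma_plus1_pos[of x] Gamma_plus1_pos[of "x + 1"] by (simp add: add.assoc)
    have g: "Gamma L > 0" using L by (rule Gamma_real_pos)
    have "Gamma (L + 2 + n) = (L + n + 1) * (L + n) * Gamma (L + n)"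
      using G[of "L + n"] L by (simp add: add_ac)
    moreover have "Gamma (L + 2) = (L + 1) * L * Gamma L" by (rule G) fact
    moreover have "(1 - t) powr (L + 2) = (1 - t) powr L * (1 - t)\<^sup>2"
      using t by (simp add: powr_add powr_numeral)
    ultimately show ?thesis
      using L t g unfolding neg_binomial_def by (simp add: divide_simps)
  qed
  ultimately show ?thesis by simp
qed

text \<open>Consecutive ratios are \<open>t * (L + n) / (n + 1)\<close>, which is at least
  \<open>t\<close> because \<open>L \<ge> 1\<close>. Moving \<open>i\<close> steps into a window
  thus costs at most \<open>t ^ i\<close>, wherever the window starts.\<close>

lemma neg_binomial_add_ge:
  assumes L: "L \<ge> 1" and t: "0 \<le> t"
  shows "neg_binomial L t (n + i) \<ge> neg_binomial L t n * t ^ i"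
proof (induction i)
  case (Suc i)
  let ?m = "n + i"
  have g: "Gamma L > 0" "Gamma (L + real ?m) > 0" using L by (auto intro!: Gamma_real_pos)
  have "Gamma (L + real (Suc ?m)) = (L + ?m) * Gamma (L + ?m)"
    using Gamma_plus1_pos[of "L + ?m"] L by (simp add: add_ac)
  then have "neg_binomial L t (Suc ?m) = (L + ?m) / (1 + ?m) * (t * neg_binomial L t ?m)"
    unfolding neg_binomial_def by (simp add: field_simps)
  moreover have "(L + ?m) / (1 + ?m) \<ge> 1" using L by (simp add: field_simps)
  moreover have "t * neg_binomial L t ?m \<ge> 0" using L t neg_binomial_nonneg[of L t ?m] by simp
  ultimately have "neg_binomial L t (Suc ?m) \<ge> t * neg_binomial L t ?m"
    using mult_right_mono[of 1 "(L + ?m) / (1 + ?m)" "t * neg_binomial L t ?m"] by simp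
  moreover have "t * neg_binomial L t ?m \<ge> t * (neg_binomial L t n * t ^ i)"
    using Suc t by (intro mult_left_mono) auto
  ultimately show ?case by (simp add: mult_ac)
qed simp

text \<open>Compares \<open>1 + n\<close> with \<open>L + n\<close>, using \<open>L \<ge> 1\<close>.
  A bound polynomial in \<open>L\<close> is enough, as it will enter through a logarithm.\<close>

lemma neg_binomial_square_moment_le:
  assumes L: "L \<ge> 1" and t: "0 \<le> t" "t \<le> r" "r < 1"
  shows "summable (\<lambda>n. (1 + real n)\<^sup>2 * neg_binomial L t n)"
    and "(\<Sum>n. (1 + real n)\<^sup>2 * neg_binomial L t n) \<le> 2 * L\<^sup>2 / (1 - r)\<^sup>2"
proof -
  have S: "(\<lambda>n. (L + n) * (L + n + 1) * neg_binomial L t n) sums (L * (L + 1) / (1 - t)\<^sup>2)"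
    by (rule neg_binomial_second_moment_sums) (use L t in auto)
  have nn: "neg_binomial L t n \<ge> 0" for n using L t by (intro neg_binomial_nonneg) auto
  have le: "(1 + real n)\<^sup>2 * neg_binomial L t n \<le> (L + n) * (L + n + 1) * neg_binomial L t n" for n
    using L by (intro mult_right_mono nn) (auto simp: power2_eq_square intro!: mult_mono)
  show sm: "summable (\<lambda>n. (1 + real n)\<^sup>2 * neg_binomial L t n)"
    by (rule summable_comparison_test'[OF sums_summable[OF S], of 0]) (use le nn in auto)
  have "(\<Sum>n. (1 + real n)\<^sup>2 * neg_binomial L t n) \<le> L * (L + 1) / (1 - t)\<^sup>2"
    using suminf_le[OF le sm sums_summable[OF S]] sums_unique[OF S] by simp
  also have "\<dots> \<le> 2 * L\<^sup>2 / (1 - r)\<^sup>2"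
    using L t by (intro frac_le) (auto simp: power2_eq_square intro!: mult_mono)
  finally show "(\<Sum>n. (1 + real n)\<^sup>2 * neg_binomial L t n) \<le> 2 * L\<^sup>2 / (1 - r)\<^sup>2" .
qed

text \<open>The root of a weight is \<open>((1 + n) * sqrt q) * (1 / (1 + n))\<close>, at most half
  the sum of the two squares; their series are the second moment and the inverse squares. The roots
  are the moduli of the terms of the random series in one variable, hence their sum controls its
  size.\<close>

lemma nn_integral_sqrt_neg_binomial_le:
  assumes L: "L \<ge> 1" and t: "0 \<le> t" "t \<le> r" "r < 1"
  shows "(\<integral>\<^sup>+n. ennreal (sqrt (neg_binomial L t n)) \<partial>count_space UNIV) \<le> ennreal (2 * L\<^sup>2 / (1 - r)\<^sup>2 + 2)"
proof -
  let ?q = "neg_binomial L t"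
  have nn: "?q n \<ge> 0" for n using L t by (intro neg_binomial_nonneg) auto
  note m = neg_binomial_square_moment_le[OF L t]
  have sq: "(\<lambda>n. 1 / real ((n + 1)\<^sup>2)) sums (pi\<^sup>2 / 6)" by (rule inverse_squares_sums)
  have le: "sqrt (?q n) \<le> ((1 + real n)\<^sup>2 * ?q n + 1 / real ((n + 1)\<^sup>2)) / 2" for n
  proof -
    have "2 * ((1 + real n) * sqrt (?q n)) * (1 / (1 + real n)) \<le> ((1 + real n) * sqrt (?q n))\<^sup>2 + (1 / (1 + real n))\<^sup>2"
      by (rule sum_squares_bound)
    then show ?thesis using nn[of n] by (simp add: power_mult_distrib power_divide add.commute)
  qed
  have sm: "summable (\<lambda>n. ((1 + real n)\<^sup>2 * ?q n + 1 / real ((n + 1)\<^sup>2)) / 2)"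
    using m(1) sq by (intro summable_divide summable_add) (auto simp: sums_iff)
  have sm': "summable (\<lambda>n. sqrt (?q n))"
    by (rule summable_comparison_test'[OF sm, of 0]) (use le nn in auto)
  define V where "V = 2 * L\<^sup>2 / (1 - r)\<^sup>2"
  have "(\<Sum>n. sqrt (?q n)) \<le> (\<Sum>n. ((1 + real n)\<^sup>2 * ?q n + 1 / real ((n + 1)\<^sup>2)) / 2)"
    by (rule suminf_le[OF le sm' sm])
  also have "\<dots> = ((\<Sum>n. (1 + real n)\<^sup>2 * ?q n) + pi\<^sup>2 / 6) / 2"
    using m(1) sq by (simp add: suminf_divide suminf_add[symmetric] sums_iff summable_add)
  also have "\<dots> \<le> V + 2"
  proof -
    have "pi\<^sup>2 \<le> 16" using pi_less_4 power_mono[of pi 4 2] by simp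
    moreover have "0 \<le> V" by (simp add: V_def)
    moreover have "(x + p / 6) / 2 \<le> v + 2" if "p \<le> 16" "0 \<le> v" "x \<le> v" for x p v :: real
      using that by (simp add: field_simps)
    ultimately show ?thesis using m(2)[folded V_def] by blast
  qed
  finally show ?thesis
    unfolding V_def[symmetric] using sm' nn by (simp add: nn_integral_count_space_nat suminf_ennreal2 ennreal_leI)
qed

text \<open>Chebyshev: with second moment at most \<open>V\<close>, the indices from about
  \<open>2 * V\<close> on carry at most half of the mass. If the earlier values, at most
  \<open>2 * V + 1\<close> in number, were all below \<open>1 / (4 * V + 2)\<close>, they would
  carry less than the other half.\<close>

lemma neg_binomial_large_value:
  assumes L: "L \<ge> 1" and t: "0 \<le> t" "t \<le> r" "r < 1"
  shows "\<exists>n. neg_binomial L t n \<ge> 1 / (4 * (2 * L\<^sup>2 / (1 - r)\<^sup>2) + 2)"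
proof (rule ccontr)
  let ?q = "neg_binomial L t"
  define V where "V = 2 * L\<^sup>2 / (1 - r)\<^sup>2"
  assume "\<not> ?thesis"
  then have small: "?q n < 1 / (4 * V + 2)" for n by (auto simp: V_def not_le)
  have nn: "?q n \<ge> 0" for n using L t by (intro neg_binomial_nonneg) auto
  note m = neg_binomial_square_moment_le[OF L t, folded V_def]
  have V: "V > 0" using L t by (simp add: V_def)
  define A where "A = nat \<lceil>2 * V\<rceil>"
  have A: "2 * V \<le> real A" "real A \<le> 2 * V + 1" using V unfolding A_def by linarith+
  have A0: "A \<noteq> 0" using A V by auto
  have le: "?q n \<le> (if n \<in> {..<A} then ?q n else 0) + (1 + real n)\<^sup>2 * ?q n / (1 + real A)\<^sup>2" for n
  proof (cases "n < A")
    case False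
    then have "(1 + real A)\<^sup>2 \<le> (1 + real n)\<^sup>2" by (intro power_mono) auto
    then have "?q n * (1 + real A)\<^sup>2 \<le> ?q n * (1 + real n)\<^sup>2" by (intro mult_left_mono nn)
    then show ?thesis using False by (simp add: divide_simps mult.commute)
  qed (use nn in simp)
  have s0: "?q sums 1" using L t by (intro neg_binomial_sums) auto
  have s1: "(\<lambda>n. if n \<in> {..<A} then ?q n else 0) sums (\<Sum>n<A. ?q n)"
    by (rule sums_If_finite_set) simp
  have s2: "(\<lambda>n. (1 + real n)\<^sup>2 * ?q n / (1 + real A)\<^sup>2) sums ((\<Sum>n. (1 + real n)\<^sup>2 * ?q n) / (1 + real A)\<^sup>2)"
    using m(1) by (intro sums_divide summable_sums)
  have "1 \<le> (\<Sum>n<A. ?q n) + (\<Sum>n. (1 + real n)\<^sup>2 * ?q n) / (1 + real A)\<^sup>2"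
    by (rule sums_le[OF le s0 sums_add[OF s1 s2]])
  also have "(\<Sum>n. (1 + real n)\<^sup>2 * ?q n) / (1 + real A)\<^sup>2 \<le> V / (1 + real A)\<^sup>2"
    using m(2) by (intro divide_right_mono) auto
  also have "V / (1 + real A)\<^sup>2 \<le> 1 / 2"
  proof -
    have "2 * V \<le> 1 + real A" using A by simp
    also have "\<dots> \<le> (1 + real A)\<^sup>2" by (rule self_le_power) auto
    finally have "2 * V \<le> (1 + real A)\<^sup>2" .
    then show ?thesis using A V by (simp add: divide_simps)
  qed
  also have "(\<Sum>n<A. ?q n) < (\<Sum>n<A. 1 / (4 * V + 2))"
    using A0 by (intro sum_strict_mono small) (auto simp: lessThan_empty_iff)
  also have "\<dots> = A / (4 * V + 2)" by simp
  also have "\<dots> \<le> 1 / 2" using A V by (simp add: divide_simps)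
  finally show False by simp
qed

section \<open>Characters of a product of cyclic groups\<close>

text \<open>With \<open>l = 0\<close> the box indexes the rotations of an orbit, with a general
  \<open>l\<close> the window of coefficients. Equal side lengths make the matrix of values against
  window coefficients square.\<close>

definition nat_box :: "('n::finite \<Rightarrow> nat) \<Rightarrow> ('n \<Rightarrow> nat) \<Rightarrow> (nat ^ 'n) set" where
  "nat_box l m = {\<alpha>. \<forall>j. l j \<le> \<alpha> $ j \<and> \<alpha> $ j < l j + m j}"

lemma nat_box_eq_image: "nat_box l m = vec_lambda ` (PiE UNIV (\<lambda>j. {l j..<l j + m j}))"
proof -
  have "\<alpha> \<in> vec_lambda ` (PiE UNIV (\<lambda>j. {l j..<l j + m j}))" if "\<alpha> \<in> nat_box l m" for \<alpha>
    using that by (intro image_eqI[of _ _ "vec_nth \<alpha>"]) (auto simp: nat_box_def)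
  then show ?thesis by (auto simp: nat_box_def)
qed

lemma finite_nat_box: "finite (nat_box l m)"
  unfolding nat_box_eq_image by (intro finite_imageI finite_PiE) auto

lemma sum_nat_box_prod:
  fixes f :: "'n::finite \<Rightarrow> nat \<Rightarrow> 'a::comm_semiring_1"
  shows "(\<Sum>\<alpha>\<in>nat_box l m. \<Prod>j\<in>UNIV. f j (\<alpha> $ j)) = (\<Prod>j\<in>UNIV. \<Sum>i\<in>{l j..<l j + m j}. f j i)"
proof -
  have inj: "inj_on vec_lambda (PiE UNIV (\<lambda>j. {l j..<l j + m j}))"
    by (auto simp: inj_on_def vec_eq_iff)
  show ?thesis
    unfolding nat_box_eq_image by (subst sum.reindex[OF inj]) (simp add: prod_sum_PiE)
qed

lemma card_nat_box: "card (nat_box l m) = (\<Prod>j\<in>UNIV. m j)"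
  using sum_nat_box_prod[of "\<lambda>_ _. 1::nat" l m] by simp

text \<open>Characters of a product of cyclic groups of orders \<open>m j\<close>: the factor that
  the monomial of index \<alpha> picks up under the rotation of index \<open>k\<close>.\<close>

definition root_char :: "('n::finite \<Rightarrow> nat) \<Rightarrow> nat ^ 'n \<Rightarrow> nat ^ 'n \<Rightarrow> complex" where
  "root_char m k \<alpha> = (\<Prod>j\<in>UNIV. cis (2 * pi * real (k $ j) / real (m j)) ^ (\<alpha> $ j))"

lemma norm_root_char: "cmod (root_char m k \<alpha>) = 1"
  by (simp add: root_char_def norm_power flip: prod_norm)

text \<open>A geometric sum over an \<open>m\<close>-th root of unity, which equals 1 only if
  \<open>m\<close> divides \<open>a - b\<close>. The bound on the difference, valid in any window of
  \<open>m\<close> consecutive integers, excludes this for distinct \<open>a\<close> and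
  \<open>b\<close>.\<close>

lemma sum_roots_of_unity_pair:
  assumes m: "m > 0" and d: "\<bar>int a - int b\<bar> < int m"
  shows "(\<Sum>i<m. cis (2 * pi * real i / real m) ^ a * cnj (cis (2 * pi * real i / real m) ^ b))
    = (if a = b then of_nat m else 0)"
proof -
  define z where "z = cis (2 * pi * (real a - real b) / real m)"
  have z: "cis (2 * pi * real i / real m) ^ a * cnj (cis (2 * pi * real i / real m) ^ b) = z ^ i" for i
    unfolding z_def complex_cnj_power cis_cnj Complex.DeMoivre cis_mult
    by (rule arg_cong[where f = cis]) (simp add: algebra_simps diff_divide_distrib)
  have "(\<Sum>i<m. z ^ i) = (if a = b then of_nat m else 0)"
  proof (cases "a = b")
    case False
    have zm: "z ^ m = 1"
    proof -
      have "z ^ m = cis (2 * pi * of_int (int a - int b))"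
        using m by (simp add: z_def Complex.DeMoivre)
      also have "\<dots> = 1" by (rule cis_multiple_2pi) simp
      finally show ?thesis .
    qed
    have "z \<noteq> 1"
    proof
      assume "z = 1"
      then have "cos (2 * pi * (real a - real b) / real m) = 1" by (simp add: z_def complex_eq_iff)
      then obtain n :: int where n: "2 * pi * (real a - real b) / real m = of_int n * 2 * pi"
        by (auto simp: cos_one_2pi_int)
      then have "(2 * pi) * ((real a - real b) / real m) = (2 * pi) * of_int n"
        by (simp add: mult_ac)
      then have "(real a - real b) / real m = of_int n"
        by (subst (asm) mult_left_cancel) auto
      then have "of_int (int a - int b) = (of_int (n * int m) :: real)"
        using m by (simp add: field_simps)
      then have e: "int a - int b = n * int m" by (simp only: of_int_eq_iff)
      then have "n \<noteq> 0" using False by auto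
      then have "int m \<le> \<bar>n * int m\<bar>" using m by (simp add: abs_mult mult_le_cancel_right1)
      then show False using d e by simp
    qed
    then show ?thesis using False zm by (simp add: geometric_sum)
  qed (simp add: z_def)
  then show ?thesis by (simp only: z)
qed

lemma root_char_orthogonal:
  fixes m :: "'n::finite \<Rightarrow> nat"
  assumes m: "\<And>j. m j > 0" and \<alpha>: "\<alpha> \<in> nat_box l m" and \<beta>: "\<beta> \<in> nat_box l m"
  shows "(\<Sum>k\<in>nat_box (\<lambda>_. 0) m. root_char m k \<alpha> * cnj (root_char m k \<beta>))
    = (if \<alpha> = \<beta> then of_nat (\<Prod>j\<in>UNIV. m j) else 0)"
proof -
  have "(\<Sum>k\<in>nat_box (\<lambda>_. 0) m. root_char m k \<alpha> * cnj (root_char m k \<beta>))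
    = (\<Sum>k\<in>nat_box (\<lambda>_. 0) m. \<Prod>j\<in>UNIV. cis (2 * pi * real (k $ j) / real (m j)) ^ (\<alpha> $ j)
        * cnj (cis (2 * pi * real (k $ j) / real (m j)) ^ (\<beta> $ j)))"
    by (simp add: root_char_def prod.distrib)
  also have "\<dots> = (\<Prod>j\<in>UNIV. \<Sum>i<m j. cis (2 * pi * real i / real (m j)) ^ (\<alpha> $ j)
        * cnj (cis (2 * pi * real i / real (m j)) ^ (\<beta> $ j)))"
    by (subst sum_nat_box_prod) (simp add: atLeast0LessThan)
  also have "\<dots> = (\<Prod>j\<in>UNIV. if \<alpha> $ j = \<beta> $ j then of_nat (m j) else 0)"
  proof (rule prod.cong[OF refl])
    fix j
    have "\<bar>int (\<alpha> $ j) - int (\<beta> $ j)\<bar> < int (m j)"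
      using \<alpha> \<beta> unfolding nat_box_def by (auto dest!: spec[of _ j])
    then show "(\<Sum>i<m j. cis (2 * pi * real i / real (m j)) ^ (\<alpha> $ j)
        * cnj (cis (2 * pi * real i / real (m j)) ^ (\<beta> $ j))) = (if \<alpha> $ j = \<beta> $ j then of_nat (m j) else 0)"
      by (rule sum_roots_of_unity_pair[OF m])
  qed
  also have "\<dots> = (if \<alpha> = \<beta> then of_nat (\<Prod>j\<in>UNIV. m j) else 0)"
  proof (cases "\<alpha> = \<beta>")
    case False
    then obtain j where "\<alpha> $ j \<noteq> \<beta> $ j" by (auto simp: vec_eq_iff)
    then show ?thesis using False by (auto intro!: prod_zero)
  qed simp
  finally show ?thesis .
qed

text \<open>By orthogonality the square character matrix is a unitary matrix times the root of its
  size, so it distorts no direction; this yields the upper and the lower bound on the linear forms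
  together.\<close>

lemma root_char_Parseval:
  fixes m :: "'n::finite \<Rightarrow> nat"
  assumes m: "\<And>j. m j > 0"
  shows "(\<Sum>k\<in>nat_box (\<lambda>_. 0) m. (cmod (\<Sum>\<alpha>\<in>nat_box l m. root_char m k \<alpha> * y \<alpha>))\<^sup>2)
    = (\<Prod>j\<in>UNIV. m j) * (\<Sum>\<alpha>\<in>nat_box l m. (cmod (y \<alpha>))\<^sup>2)"
proof -
  let ?A = "nat_box l m" and ?K = "nat_box (\<lambda>_. 0) m"
  have "complex_of_real (\<Sum>k\<in>?K. (cmod (\<Sum>\<alpha>\<in>?A. root_char m k \<alpha> * y \<alpha>))\<^sup>2)
     = (\<Sum>k\<in>?K. \<Sum>\<alpha>\<in>?A. \<Sum>\<beta>\<in>?A. (y \<alpha> * cnj (y \<beta>)) * (root_char m k \<alpha> * cnj (root_char m k \<beta>)))"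
    unfolding of_real_sum complex_norm_square cnj_sum sum_product complex_cnj_mult
    by (intro sum.cong refl) (simp only: mult_ac)
  also have "\<dots> = (\<Sum>\<alpha>\<in>?A. \<Sum>\<beta>\<in>?A. \<Sum>k\<in>?K. (y \<alpha> * cnj (y \<beta>)) * (root_char m k \<alpha> * cnj (root_char m k \<beta>)))"
    by (subst sum.swap, rule sum.cong[OF refl], rule sum.swap)
  also have "\<dots> = (\<Sum>\<alpha>\<in>?A. \<Sum>\<beta>\<in>?A. (y \<alpha> * cnj (y \<beta>)) * (if \<alpha> = \<beta> then of_nat (\<Prod>j\<in>UNIV. m j) else 0))"
    by (intro sum.cong refl) (simp only: sum_distrib_left[symmetric] root_char_orthogonal[OF m])
  also have "\<dots> = (\<Sum>\<alpha>\<in>?A. (y \<alpha> * cnj (y \<alpha>)) * of_nat (\<Prod>j\<in>UNIV. m j))"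
    by (intro sum.cong refl) (simp add: finite_nat_box if_distrib[of "\<lambda>x. _ * x"] sum.delta cong: if_cong)
  also have "\<dots> = complex_of_real ((\<Prod>j\<in>UNIV. m j) * (\<Sum>\<alpha>\<in>?A. (cmod (y \<alpha>))\<^sup>2))"
    by (simp add: complex_norm_square[symmetric] sum_distrib_left mult_ac)
  finally show ?thesis by (simp only: of_real_eq_iff)
qed

section \<open>Exponential moments along orbits of rotations\<close>

lemma nn_integral_count_space_vec_prod:
  fixes f :: "'n::finite \<Rightarrow> nat \<Rightarrow> ennreal"
  shows "(\<integral>\<^sup>+\<alpha>. (\<Prod>j\<in>UNIV. f j (\<alpha> $ j)) \<partial>count_space (UNIV :: (nat ^ 'n) set))
    = (\<Prod>j\<in>UNIV. \<integral>\<^sup>+i. f j i \<partial>count_space UNIV)"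
proof -
  interpret product_sigma_finite "\<lambda>_::'n. count_space (UNIV :: nat set)"
    by (intro product_sigma_finite.intro sigma_finite_measure_count_space_countable) auto
  have "PiM UNIV (\<lambda>_::'n. count_space (UNIV :: nat set)) = count_space (PiE UNIV (\<lambda>_. UNIV))"
    by (rule count_space_PiM_finite) auto
  then have P: "PiM UNIV (\<lambda>_::'n. count_space (UNIV :: nat set)) = count_space UNIV"
    by simp
  have "bij_betw vec_nth (UNIV :: (nat ^ 'n) set) UNIV"
    by (rule bij_betwI[where g = vec_lambda]) auto
  then have "(\<integral>\<^sup>+\<alpha>. (\<Prod>j\<in>UNIV. f j (\<alpha> $ j)) \<partial>count_space (UNIV :: (nat ^ 'n) set))
    = (\<integral>\<^sup>+g. (\<Prod>j\<in>UNIV. f j (g j)) \<partial>PiM UNIV (\<lambda>_::'n. count_space (UNIV :: nat set)))"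
    unfolding P by (rule nn_integral_bij_count_space[where f = "\<lambda>g. \<Prod>j\<in>UNIV. f j (g j)"])
  also have "\<dots> = (\<Prod>j\<in>UNIV. \<integral>\<^sup>+i. f j i \<partial>count_space UNIV)"
    by (rule product_nn_integral_prod) auto
  finally show ?thesis .
qed

section \<open>Normalized values along a rotation orbit\<close>

definition rotate_by :: "('n::finite \<Rightarrow> nat) \<Rightarrow> nat ^ 'n \<Rightarrow> complex ^ 'n \<Rightarrow> complex ^ 'n" where
  "rotate_by m k z = (\<chi> j. z $ j * cis (2 * pi * real (k $ j) / real (m j)))"

definition log_kernel :: "real ^ 'n \<Rightarrow> complex ^ 'n::finite \<Rightarrow> real" where
  "log_kernel L z = (\<Sum>j\<in>UNIV. - L $ j * ln (1 - (cmod (z $ j))\<^sup>2))"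

definition log_deviation ::
  "real ^ 'n \<Rightarrow> (nat ^ 'n \<Rightarrow> 'w \<Rightarrow> complex) \<Rightarrow> 'w \<Rightarrow> complex ^ 'n::finite \<Rightarrow> real" where
  "log_deviation L a \<omega> z = ln ((cmod (hyp_GAF L a \<omega> z))\<^sup>2) - log_kernel L z"

text \<open>A term of the series for \<open>f / \<surd>K\<close> with its random coefficient
  removed. The squared moduli are products of \<open>neg_binomial\<close> weights and thus form a
  probability distribution over \<alpha>.\<close>

definition normalized_term :: "real ^ 'n \<Rightarrow> complex ^ 'n::finite \<Rightarrow> nat ^ 'n \<Rightarrow> complex" where
  "normalized_term L z \<alpha> =
     (\<Prod>j\<in>UNIV. complex_of_real (sqrt (Gamma (L $ j + real (\<alpha> $ j)) / (fact (\<alpha> $ j) * Gamma (L $ j)))))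
     * (\<Prod>j\<in>UNIV. (z $ j) ^ (\<alpha> $ j)) * complex_of_real (exp (- log_kernel L z / 2))"

lemma hyp_GAF_normalized:
  "hyp_GAF L a \<omega> z * complex_of_real (exp (- log_kernel L z / 2)) = (\<Sum>\<^sub>\<infinity>\<alpha>. a \<alpha> \<omega> * normalized_term L z \<alpha>)"
  unfolding hyp_GAF_def normalized_term_def
  by (subst infsum_cmult_left'[symmetric]) (simp add: mult_ac)

lemma log_kernel_rotate_by: "log_kernel L (rotate_by m k z) = log_kernel L z"
  by (simp add: log_kernel_def rotate_by_def norm_mult)

text \<open>Rotations act on the terms through unimodular characters only. Hence the matrix of
  values on an orbit is a character matrix times the diagonal of the terms at the base
  point.\<close>

lemma normalized_term_rotate_by:
  "normalized_term L (rotate_by m k z) \<alpha> = root_char m k \<alpha> * normalized_term L z \<alpha>"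
  unfolding normalized_term_def log_kernel_rotate_by
  by (simp add: root_char_def rotate_by_def power_mult_distrib prod.distrib mult_ac)

lemma norm_normalized_term:
  assumes L: "\<And>j. L $ j > 0" and z: "\<And>j. cmod (z $ j) < 1"
  shows "cmod (normalized_term L z \<alpha>) = (\<Prod>j\<in>UNIV. sqrt (neg_binomial (L $ j) ((cmod (z $ j))\<^sup>2) (\<alpha> $ j)))"
proof -
  have t: "1 - (cmod (z $ j))\<^sup>2 > 0" for j
    using z[of j] power_strict_mono[of "cmod (z $ j)" 1 2] by simp
  have "exp (- log_kernel L z / 2) = (\<Prod>j\<in>UNIV. exp (L $ j * ln (1 - (cmod (z $ j))\<^sup>2) / 2))"
    by (simp add: log_kernel_def exp_sum sum_divide_distrib flip: sum_negf)
  also have "\<dots> = (\<Prod>j\<in>UNIV. sqrt ((1 - (cmod (z $ j))\<^sup>2) powr (L $ j)))"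
    using t by (intro prod.cong refl) (simp add: powr_def less_imp_neq powr_half_sqrt[symmetric] exp_powr_real)
  finally have e: "exp (- log_kernel L z / 2) = (\<Prod>j\<in>UNIV. sqrt ((1 - (cmod (z $ j))\<^sup>2) powr (L $ j)))" .
  have g: "Gamma (L $ j + real (\<alpha> $ j)) / (fact (\<alpha> $ j) * Gamma (L $ j)) \<ge> 0" for j
    using Gamma_real_pos[of "L $ j"] Gamma_real_pos[of "L $ j + real (\<alpha> $ j)"] L[of j] by simp
  have "cmod (normalized_term L z \<alpha>)
     = (\<Prod>j\<in>UNIV. sqrt (Gamma (L $ j + real (\<alpha> $ j)) / (fact (\<alpha> $ j) * Gamma (L $ j))))
       * (\<Prod>j\<in>UNIV. cmod (z $ j) ^ (\<alpha> $ j)) * exp (- log_kernel L z / 2)"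
    using g by (simp add: normalized_term_def norm_mult norm_power flip: prod_norm del: of_real_prod real_sqrt_divide real_sqrt_mult)
  also have "\<dots> = (\<Prod>j\<in>UNIV. sqrt (neg_binomial (L $ j) ((cmod (z $ j))\<^sup>2) (\<alpha> $ j)))"
    unfolding e prod.distrib[symmetric]
  proof (rule prod.cong[OF refl])
    fix j
    have "sqrt (((cmod (z $ j))\<^sup>2) ^ (\<alpha> $ j)) = cmod (z $ j) ^ (\<alpha> $ j)"
      by (simp add: real_sqrt_power)
    then show "sqrt (Gamma (L $ j + real (\<alpha> $ j)) / (fact (\<alpha> $ j) * Gamma (L $ j))) * cmod (z $ j) ^ \<alpha> $ j
        * sqrt ((1 - (cmod (z $ j))\<^sup>2) powr L $ j)
      = sqrt (neg_binomial (L $ j) ((cmod (z $ j))\<^sup>2) (\<alpha> $ j))"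
      unfolding neg_binomial_def by (simp only: real_sqrt_mult)
  qed
  finally show ?thesis .
qed

text \<open>The mean of two numbers is at most the larger one. This separates positive from negative
  parts at the price of halving the exponent.\<close>

lemma sum_exp_half_le: "exp ((u + v) / 2) \<le> exp u + exp (v::real)"
proof (cases "u \<le> v")
  case True
  then have "exp ((u + v) / 2) \<le> exp v" by simp
  then show ?thesis using exp_gt_zero[of u] by linarith
next
  case False
  then have "exp ((u + v) / 2) \<le> exp u" by simp
  then show ?thesis using exp_gt_zero[of v] by linarith
qed

text \<open>If some \<open>x k\<close> vanishes, the product on the right is infinite, so \<open>d k\<close> may be arbitrary there;
  this absorbs the junk value \<open>ln 0 = 0\<close> in \<open>log_deviation\<close>.\<close>
lemma exp_sum_abs_log_le:
  fixes x :: "'k \<Rightarrow> real" and T :: ennreal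
  assumes K: "finite K" and x: "\<And>k. k \<in> K \<Longrightarrow> x k \<ge> 0" and T: "\<And>k. k \<in> K \<Longrightarrow> ennreal (x k) \<le> T"
    and d: "\<And>k. k \<in> K \<Longrightarrow> x k > 0 \<Longrightarrow> d k = 2 * ln (x k)"
  shows "ennreal (exp (1 / 8 * (\<Sum>k\<in>K. \<bar>d k\<bar>)))
    \<le> (1 + T ^ card K) + (\<Prod>k\<in>K. 1 + inverse (ennreal (sqrt (x k))))"
proof (cases "\<exists>k\<in>K. x k = 0")
  case True
  then have "(\<Prod>k\<in>K. 1 + inverse (ennreal (sqrt (x k)))) = \<top>"
    using K by (subst ennreal_prod_eq_top) (auto intro!: bexI)
  then show ?thesis by simp
next
  case False
  then have x: "\<And>k. k \<in> K \<Longrightarrow> x k > 0" using x by (force simp: less_le)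
  \<comment> \<open>Positive and negative part of \<open>ln (x k)\<close>, so that
    \<open>\<bar>d k\<bar> = 2 * (p k + q k)\<close>. After the halving in
    \<open>sum_exp_half_le\<close>, the constant 1/8 leaves \<open>exp (p k / 2)\<close> and
    \<open>exp (q k / 2)\<close>; the latter involves only the inverse square root of
    \<open>x k\<close>, whose singularity is integrable.\<close>
  define p q where "p = (\<lambda>k. max 0 (ln (x k)))" and "q = (\<lambda>k. max 0 (- ln (x k)))"
  have "(\<Sum>k\<in>K. \<bar>d k\<bar>) = (\<Sum>k\<in>K. 2 * p k + 2 * q k)"
    using d x by (intro sum.cong refl) (auto simp: p_def q_def)
  then have "1 / 8 * (\<Sum>k\<in>K. \<bar>d k\<bar>) = ((\<Sum>k\<in>K. p k / 2) + (\<Sum>k\<in>K. q k / 2)) / 2"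
    by (simp add: sum.distrib sum_divide_distrib[symmetric] sum_distrib_left[symmetric])
  then have "exp (1 / 8 * (\<Sum>k\<in>K. \<bar>d k\<bar>)) \<le> exp (\<Sum>k\<in>K. p k / 2) + exp (\<Sum>k\<in>K. q k / 2)"
    by (simp only: sum_exp_half_le)
  then have "ennreal (exp (1 / 8 * (\<Sum>k\<in>K. \<bar>d k\<bar>)))
      \<le> (\<Prod>k\<in>K. ennreal (exp (p k / 2))) + (\<Prod>k\<in>K. ennreal (exp (q k / 2)))"
    using K by (simp add: exp_sum prod_ennreal prod_nonneg flip: ennreal_plus)
  also have "(\<Prod>k\<in>K. ennreal (exp (p k / 2))) \<le> (\<Prod>k\<in>K. max 1 T)"
  proof (rule prod_mono_ennreal)
    fix k assume k: "k \<in> K"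
    have "exp (p k / 2) \<le> exp (p k)" by (simp add: p_def)
    also have "exp (p k) = max 1 (x k)" using x[OF k] by (simp add: p_def max_def)
    finally have "ennreal (exp (p k / 2)) \<le> max 1 (ennreal (x k))"
      using x[OF k] by (auto simp: max_def ennreal_leI split: if_splits)
    also have "\<dots> \<le> max 1 T" by (rule max.mono[OF order_refl T[OF k]])
    finally show "ennreal (exp (p k / 2)) \<le> max 1 T" .
  qed
  also have "(\<Prod>k\<in>K. max 1 T) \<le> 1 + T ^ card K" by (auto simp: max_def)
  also have "(\<Prod>k\<in>K. ennreal (exp (q k / 2))) \<le> (\<Prod>k\<in>K. 1 + inverse (ennreal (sqrt (x k))))"
  proof (rule prod_mono_ennreal)
    fix k assume k: "k \<in> K"
    have "exp (- ln (x k) / 2) = 1 / sqrt (x k)"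
      using x[OF k] by (simp add: exp_minus powr_half_sqrt[symmetric] powr_def field_simps)
    then have "exp (q k / 2) \<le> 1 + 1 / sqrt (x k)"
      using x[OF k] by (auto simp: q_def max_def)
    then have "ennreal (exp (q k / 2)) \<le> ennreal (1 + 1 / sqrt (x k))" by (rule ennreal_leI)
    also have "\<dots> = 1 + inverse (ennreal (sqrt (x k)))"
      using x[OF k] by (simp add: inverse_ennreal inverse_eq_divide)
    finally show "ennreal (exp (q k / 2)) \<le> 1 + inverse (ennreal (sqrt (x k)))" .
  qed
  finally show ?thesis by (simp add: add_mono)
qed

lemma power_sum_le_sum_power:
  fixes x y :: real
  assumes "x \<ge> 0" "y \<ge> 0" "N > 0"
  shows "x ^ N + y ^ N \<le> (x + y) ^ N"
proof -
  obtain n where n: "N = Suc n" using assms by (cases N) auto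
  have "x * x ^ n + y * y ^ n \<le> x * (x + y) ^ n + y * (x + y) ^ n"
    using assms by (intro add_mono mult_left_mono power_mono) auto
  then show ?thesis by (simp add: n algebra_simps)
qed

text \<open>For the matrix of normalized values against window coefficients, the squared singular
  values lie between \<open>N * (Z / W)\<close> and \<open>N\<close>: \<open>1 / W\<close> bounds
  the product of the weights at the start of the window from below, and \<open>Z\<close> bounds the
  decay across it. Negative parts of the logarithms are controlled through this matrix, positive
  parts through the \<open>N\<close>-th moment of a common majorant. \<open>W\<close> also bounds
  the sum of the moduli of all terms, so one constant serves both.\<close>

lemma iid_rotated_exp_moment_le:
  fixes a :: "nat ^ 'n::finite \<Rightarrow> 'w \<Rightarrow> complex" and L :: "real ^ 'n"
  assumes iid: "iid_std_complex_gaussian M a"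
    and L: "\<And>j. L $ j \<ge> 1" and r: "r < 1"
    and z: "\<And>j. z $ j \<noteq> 0" "\<And>j. (cmod (z $ j))\<^sup>2 \<le> r"
    and m: "\<And>j. m j > 0"
  defines "N \<equiv> (\<Prod>j\<in>UNIV. m j)"
    and "W \<equiv> (\<Prod>j\<in>UNIV. 4 * (2 * (L $ j)\<^sup>2 / (1 - r)\<^sup>2) + 2)"
    and "Z \<equiv> (\<Prod>j\<in>UNIV. ((cmod (z $ j))\<^sup>2) ^ m j)"
  shows "(\<integral>\<^sup>+\<omega>. ennreal (exp (1 / 8 * (\<Sum>k\<in>nat_box (\<lambda>_. 0) m. \<bar>log_deviation L a \<omega> (rotate_by m k z)\<bar>))) \<partial>M)
    \<le> ennreal (((1 + 4 * W * N + 2 * N + singular_mass) * W / Z) ^ N)"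
proof -
  note [measurable] = iid_measurable[OF iid]
  interpret prob_space M using iid by (simp add: iid_std_complex_gaussian_def)
  let ?K = "nat_box (\<lambda>_::'n. 0) m"
  let ?q = "\<lambda>j. neg_binomial (L $ j) ((cmod (z $ j))\<^sup>2)"
  let ?V = "\<lambda>j. 2 * (L $ j)\<^sup>2 / (1 - r)\<^sup>2"
  have z1: "cmod (z $ j) < 1" for j
  proof -
    have "(cmod (z $ j))\<^sup>2 < 1\<^sup>2" using z(2)[of j] r by simp
    then show ?thesis by (rule power2_less_imp_less) simp
  qed
  have L0: "L $ j > 0" for j using L[of j] by linarith
  have V: "?V j \<ge> 0" for j by simp
  have W1: "W \<ge> 1" unfolding W_def by (intro prod_ge_1) (use V in \<open>simp add: add_increasing\<close>)
  have N0: "N > 0" using m by (simp add: N_def prod_pos)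
  have Z0: "Z > 0" unfolding Z_def using z(1) by (intro prod_pos) auto
  have Z1: "Z \<le> 1" unfolding Z_def
    using z1 by (intro prod_le_1) (auto intro!: power_le_one simp: less_imp_le)
  have cardK: "card ?K = N" by (simp add: card_nat_box N_def)
  have "\<exists>n. ?q j n \<ge> 1 / (4 * ?V j + 2)" for j
    by (rule neg_binomial_large_value[OF L _ z(2) r]) simp
  then obtain l where l: "\<And>j. ?q j (l j) \<ge> 1 / (4 * ?V j + 2)" by metis
  define A where "A = nat_box l m"
  have A: "finite A" "card A = N" by (auto simp: A_def finite_nat_box card_nat_box N_def)
  have A': "A \<noteq> {}" using A(2) N0 by auto
  define b where "b = normalized_term L z"
  have nb: "cmod (b \<alpha>) = (\<Prod>j\<in>UNIV. sqrt (?q j (\<alpha> $ j)))" for \<alpha>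
    unfolding b_def by (rule norm_normalized_term[OF L0 z1])
  have q0: "?q j i \<ge> 0" for i j using L0 by (intro neg_binomial_nonneg) auto
  have b2: "(cmod (b \<alpha>))\<^sup>2 = (\<Prod>j\<in>UNIV. ?q j (\<alpha> $ j))" for \<alpha>
    using q0 by (simp add: nb prod_power_distrib)
  \<comment> \<open>The window starts at a large value of each weight, and every further step shrinks it
    at most by the factor \<open>\<bar>z\<^sub>j\<bar>\<^sup>2\<close>.\<close>
  have b_low: "Z / W \<le> (cmod (b \<alpha>))\<^sup>2" if "\<alpha> \<in> A" for \<alpha>
  proof -
    have "Z / W = (\<Prod>j\<in>UNIV. 1 / (4 * ?V j + 2) * ((cmod (z $ j))\<^sup>2) ^ m j)"
      by (simp add: Z_def W_def prod_dividef)
    also have "\<dots> \<le> (\<Prod>j\<in>UNIV. ?q j (\<alpha> $ j))"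
    proof (intro prod_mono conjI)
      fix j
      show "0 \<le> 1 / (4 * ?V j + 2) * ((cmod (z $ j))\<^sup>2) ^ m j" using V[of j] by simp
      define i where "i = \<alpha> $ j - l j"
      have i: "\<alpha> $ j = l j + i" "i < m j" using that by (auto simp: A_def nat_box_def i_def dest!: spec[of _ j])
      have "1 / (4 * ?V j + 2) * ((cmod (z $ j))\<^sup>2) ^ m j \<le> ?q j (l j) * ((cmod (z $ j))\<^sup>2) ^ i"
        using l[of j] i(2) z1[of j] q0 V[of j]
        by (intro mult_mono power_decreasing) (auto intro: power_le_one less_imp_le)
      also have "\<dots> \<le> ?q j (l j + i)" by (rule neg_binomial_add_ge) (use L in auto)
      finally show "1 / (4 * ?V j + 2) * ((cmod (z $ j))\<^sup>2) ^ m j \<le> ?q j (\<alpha> $ j)" by (simp add: i(1))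
    qed
    finally show ?thesis by (simp add: b2)
  qed
  have b_upp: "(cmod (b \<alpha>))\<^sup>2 \<le> 1" for \<alpha>
  proof -
    have "?q j i \<le> 1" for i j
    proof -
      have s: "?q j sums 1" using L0 z(2)[of j] r by (intro neg_binomial_sums) auto
      have "(\<Sum>n\<in>{i}. ?q j n) \<le> (\<Sum>n. ?q j n)"
        using s q0 by (intro sum_le_suminf) (auto simp: sums_iff)
      then show ?thesis using s by (simp add: sums_iff)
    qed
    then show ?thesis unfolding b2 using q0 by (intro prod_le_1) auto
  qed
  have b_sum: "(\<integral>\<^sup>+\<alpha>. ennreal (cmod (b \<alpha>)) \<partial>count_space UNIV) \<le> ennreal W"
  proof -
    have "(\<integral>\<^sup>+\<alpha>. ennreal (cmod (b \<alpha>)) \<partial>count_space UNIV)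
       = (\<integral>\<^sup>+\<alpha>. (\<Prod>j\<in>UNIV. ennreal (sqrt (?q j (\<alpha> $ j)))) \<partial>count_space UNIV)"
      using q0 by (simp add: nb prod_ennreal)
    also have "\<dots> = (\<Prod>j\<in>UNIV. \<integral>\<^sup>+i. ennreal (sqrt (?q j i)) \<partial>count_space UNIV)"
      by (rule nn_integral_count_space_vec_prod)
    also have "\<dots> \<le> (\<Prod>j\<in>UNIV. ennreal (4 * ?V j + 2))"
    proof (rule prod_mono_ennreal)
      fix j
      have "(\<integral>\<^sup>+i. ennreal (sqrt (?q j i)) \<partial>count_space UNIV) \<le> ennreal (?V j + 2)"
        by (rule nn_integral_sqrt_neg_binomial_le) (use L z r in auto)
      also have "\<dots> \<le> ennreal (4 * ?V j + 2)" using V[of j] by (intro ennreal_leI) linarith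
      finally show "(\<integral>\<^sup>+i. ennreal (sqrt (?q j i)) \<partial>count_space UNIV) \<le> ennreal (4 * ?V j + 2)" .
    qed
    also have "\<dots> = ennreal W" unfolding W_def using V by (intro prod_ennreal) (simp add: add_nonneg_nonneg)
    finally show ?thesis .
  qed
  \<comment> \<open>Characters have modulus 1, so \<open>T\<close> dominates the normalized values
    at all orbit points at once, and its \<open>N\<close>-th power can stand for the product of
    their positive parts.\<close>
  define T where "T = (\<lambda>\<omega>. \<integral>\<^sup>+\<alpha>. ennreal (cmod (b \<alpha>)) * ennreal (cmod (a \<alpha> \<omega>)) \<partial>count_space UNIV)"
  have [measurable]: "T \<in> borel_measurable M"
    unfolding T_def by (rule borel_measurable_nn_integral_count_space) measurable
  define x where "x = (\<lambda>k \<omega>. cmod (\<Sum>\<^sub>\<infinity>\<alpha>. a \<alpha> \<omega> * (root_char m k \<alpha> * b \<alpha>)))"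
  have [measurable]: "x k \<in> borel_measurable M" for k
    unfolding x_def by (intro borel_measurable_norm[THEN measurable_compose_rev] borel_measurable_infsum) auto
  have xeq: "x k \<omega> = cmod (hyp_GAF L a \<omega> (rotate_by m k z)) * exp (- log_kernel L z / 2)" for k \<omega>
  proof -
    have "(\<Sum>\<^sub>\<infinity>\<alpha>. a \<alpha> \<omega> * (root_char m k \<alpha> * b \<alpha>))
      = hyp_GAF L a \<omega> (rotate_by m k z) * complex_of_real (exp (- log_kernel L z / 2))"
      using hyp_GAF_normalized[of L a \<omega> "rotate_by m k z"]
      by (simp add: b_def normalized_term_rotate_by log_kernel_rotate_by)
    then show ?thesis by (simp add: x_def norm_mult)
  qed
  have ptw: "ennreal (exp (1 / 8 * (\<Sum>k\<in>?K. \<bar>log_deviation L a \<omega> (rotate_by m k z)\<bar>)))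
     \<le> (1 + T \<omega> ^ N) + (\<Prod>k\<in>?K. 1 + inverse (ennreal (sqrt (x k \<omega>))))" for \<omega>
    unfolding cardK[symmetric]
  proof (rule exp_sum_abs_log_le)
    show "finite ?K" by (rule finite_nat_box)
    fix k
    show "0 \<le> x k \<omega>" by (simp add: x_def)
    show "ennreal (x k \<omega>) \<le> T \<omega>"
      unfolding x_def T_def
      by (rule order.trans[OF norm_infsum_le_nn_integral])
        (simp add: norm_mult norm_root_char ennreal_mult mult.commute)
    assume "0 < x k \<omega>"
    then have "cmod (hyp_GAF L a \<omega> (rotate_by m k z)) > 0" by (auto simp: xeq zero_less_mult_iff)
    then show "log_deviation L a \<omega> (rotate_by m k z) = 2 * ln (x k \<omega>)"
      by (simp add: log_deviation_def xeq log_kernel_rotate_by ln_mult ln_realpow)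
  qed
  have "(\<integral>\<^sup>+\<omega>. ennreal (exp (1 / 8 * (\<Sum>k\<in>?K. \<bar>log_deviation L a \<omega> (rotate_by m k z)\<bar>))) \<partial>M)
    \<le> (\<integral>\<^sup>+\<omega>. (1 + T \<omega> ^ N) + (\<Prod>k\<in>?K. 1 + inverse (ennreal (sqrt (x k \<omega>)))) \<partial>M)"
    by (intro nn_integral_mono ptw)
  also have "\<dots> = (\<integral>\<^sup>+\<omega>. 1 + T \<omega> ^ N \<partial>M) + (\<integral>\<^sup>+\<omega>. (\<Prod>k\<in>?K. 1 + inverse (ennreal (sqrt (x k \<omega>)))) \<partial>M)"
    by (rule nn_integral_add) measurable
  also have "(\<integral>\<^sup>+\<omega>. 1 + T \<omega> ^ N \<partial>M) = 1 + (\<integral>\<^sup>+\<omega>. T \<omega> ^ N \<partial>M)"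
    by (subst nn_integral_add) (auto simp: emeasure_space_1)
  also have "(\<integral>\<^sup>+\<omega>. T \<omega> ^ N \<partial>M) \<le> ennreal (W ^ N * (4 * fact N))"
    unfolding T_def using b_sum W1 N0 by (intro iid_series_moment_le[OF iid]) auto
  also have "(\<integral>\<^sup>+\<omega>. (\<Prod>k\<in>?K. 1 + inverse (ennreal (sqrt (x k \<omega>)))) \<partial>M)
     \<le> ennreal (((2 * pi * real N + singular_mass) * card A / (pi * (real N * (Z / W)))) ^ card A)"
    unfolding x_def
  proof (rule iid_prod_inverse_sqrt_le[OF iid A(1) finite_nat_box])
    have par: "(\<Sum>k\<in>?K. (cmod (\<Sum>\<alpha>\<in>A. root_char m k \<alpha> * b \<alpha> * y \<alpha>))\<^sup>2) = real N * (\<Sum>\<alpha>\<in>A. (cmod (b \<alpha>))\<^sup>2 * (cmod (y \<alpha>))\<^sup>2)" for y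
      using root_char_Parseval[OF m, where l = l and y = "\<lambda>\<alpha>. b \<alpha> * y \<alpha>"]
      by (simp add: A_def N_def mult.assoc norm_mult power_mult_distrib)
    show "card ?K = card A" using A cardK by simp
    show "0 < real N * (Z / W)" "0 < real N" using N0 Z0 W1 by auto
    show "real N * (Z / W) * (\<Sum>i\<in>A. (cmod (y i))\<^sup>2) \<le> (\<Sum>k\<in>?K. (cmod (\<Sum>i\<in>A. root_char m k i * b i * y i))\<^sup>2)" for y
    proof -
      have "(Z / W) * (\<Sum>i\<in>A. (cmod (y i))\<^sup>2) \<le> (\<Sum>\<alpha>\<in>A. (cmod (b \<alpha>))\<^sup>2 * (cmod (y \<alpha>))\<^sup>2)"
        unfolding sum_distrib_left by (intro sum_mono mult_right_mono b_low) auto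
      from mult_left_mono[OF this, of "real N"] show ?thesis unfolding par by (simp add: mult.assoc)
    qed
    show "(\<Sum>k\<in>?K. (cmod (\<Sum>i\<in>A. root_char m k i * b i * y i))\<^sup>2) \<le> real N * (\<Sum>i\<in>A. (cmod (y i))\<^sup>2)" for y
    proof -
      have "(\<Sum>\<alpha>\<in>A. (cmod (b \<alpha>))\<^sup>2 * (cmod (y \<alpha>))\<^sup>2) \<le> (\<Sum>\<alpha>\<in>A. 1 * (cmod (y \<alpha>))\<^sup>2)"
        by (intro sum_mono mult_right_mono b_upp) auto
      then show ?thesis unfolding par by (intro mult_left_mono) auto
    qed
    show "(\<integral>\<^sup>+i. ennreal (cmod (root_char m k i * b i)) \<partial>count_space UNIV) < \<infinity>" for k
      using le_less_trans[OF b_sum ennreal_less_top] by (simp add: norm_mult norm_root_char)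
  qed (use A' in auto)
  also have "1 + ennreal (W ^ N * (4 * fact N)) + ennreal (((2 * pi * real N + singular_mass) * card A / (pi * (real N * (Z / W)))) ^ card A)
     = ennreal (1 + W ^ N * (4 * fact N) + ((2 * pi * real N + singular_mass) * card A / (pi * (real N * (Z / W)))) ^ card A)"
    using W1 Z0 singular_mass_nonneg by (simp flip: ennreal_plus ennreal_1)
  \<comment> \<open>Everything is fitted into one \<open>N\<close>-th power, so that the exponent of
    the final bound is proportional to \<open>N\<close>. The tools are
    \<open>4 * fact N \<le> (4 * N) ^ N\<close> and
    \<open>x ^ N + y ^ N \<le> (x + y) ^ N\<close>.\<close>
  also have "\<dots> \<le> ennreal (((1 + 4 * W * N + 2 * N + singular_mass) * W / Z) ^ N)"
  proof (rule ennreal_leI)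
    have WZ: "1 \<le> W / Z" using W1 Z0 Z1 by (simp add: field_simps)
    have "1 + W ^ N * (4 * fact N) \<le> 1 ^ N + (4 * W * N) ^ N"
    proof -
      have "(fact N :: real) \<le> real N ^ N" using fact_le_power[of N, where 'a = real] by simp
      moreover have "(4::real) \<le> 4 ^ N" using N0 self_le_power[of "4::real" N] by simp
      ultimately have "4 * fact N \<le> 4 ^ N * real N ^ N" by (intro mult_mono) auto
      then have "W ^ N * (4 * fact N) \<le> W ^ N * (4 ^ N * real N ^ N)" using W1 by (intro mult_left_mono) auto
      then show ?thesis by (simp add: power_mult_distrib mult_ac)
    qed
    also have "\<dots> \<le> (1 + 4 * W * N) ^ N" using W1 N0 by (intro power_sum_le_sum_power) auto
    also have "\<dots> \<le> ((1 + 4 * W * N) * (W / Z)) ^ N"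
      using W1 WZ mult_left_mono[OF WZ, of "1 + 4 * W * N"] by (intro power_mono) auto
    finally have 1: "1 + W ^ N * (4 * fact N) \<le> ((1 + 4 * W * N) * (W / Z)) ^ N" .
    have "(2 * pi * real N + singular_mass) * card A / (pi * (real N * (Z / W)))
       = (2 * N + singular_mass / pi) * (W / Z)"
      using A N0 Z0 W1 by (simp add: field_simps)
    also have "\<dots> \<le> (2 * N + singular_mass) * (W / Z)"
      using singular_mass_nonneg pi_ge_two WZ
      by (intro mult_right_mono add_left_mono) (auto simp: divide_le_eq mult_le_cancel_left1)
    finally have "((2 * pi * real N + singular_mass) * card A / (pi * (real N * (Z / W)))) ^ card A
       \<le> ((2 * N + singular_mass) * (W / Z)) ^ N"
      unfolding A(2) using singular_mass_nonneg Z0 W1 by (intro power_mono) auto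
    with 1 have "1 + W ^ N * (4 * fact N) + ((2 * pi * real N + singular_mass) * card A / (pi * (real N * (Z / W)))) ^ card A
       \<le> ((1 + 4 * W * N) * (W / Z)) ^ N + ((2 * N + singular_mass) * (W / Z)) ^ N" by linarith
    also have "\<dots> \<le> ((1 + 4 * W * N) * (W / Z) + (2 * N + singular_mass) * (W / Z)) ^ N"
      using W1 Z0 N0 singular_mass_nonneg by (intro power_sum_le_sum_power) auto
    also have "(1 + 4 * W * N) * (W / Z) + (2 * N + singular_mass) * (W / Z) = (1 + 4 * W * N + 2 * N + singular_mass) * W / Z"
      by (simp add: algebra_simps add_divide_distrib)
    finally show "1 + W ^ N * (4 * fact N) + ((2 * pi * real N + singular_mass) * card A / (pi * (real N * (Z / W)))) ^ card A
       \<le> ((1 + 4 * W * N + 2 * N + singular_mass) * W / Z) ^ N" .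
  qed
  finally show ?thesis by (simp add: add_mono)
qed

section \<open>Averages over orbits\<close>

text \<open>Integrates the tangent line of \<open>exp\<close> at the mean of
  \<open>q\<close>.\<close>

lemma exp_average_le_average_exp:
  fixes q :: "'a \<Rightarrow> real"
  assumes "prob_space \<mu>" and q: "integrable \<mu> q" and e: "integrable \<mu> (\<lambda>z. exp (q z))"
  shows "exp (\<integral>z. q z \<partial>\<mu>) \<le> (\<integral>z. exp (q z) \<partial>\<mu>)"
proof -
  interpret prob_space \<mu> by fact
  let ?m = "\<integral>z. q z \<partial>\<mu>"
  have "exp ?m = (\<integral>z. exp ?m * (1 + (q z - ?m)) \<partial>\<mu>)"
    using q by (simp add: prob_space)
  also have "\<dots> \<le> (\<integral>z. exp (q z) \<partial>\<mu>)"
  proof (rule integral_mono)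
    fix z
    have "exp ?m * (1 + (q z - ?m)) \<le> exp ?m * exp (q z - ?m)"
      by (intro mult_left_mono exp_ge_add_one_self) auto
    then show "exp ?m * (1 + (q z - ?m)) \<le> exp (q z)" by (simp flip: exp_add)
  qed (use q e in auto)
  finally show ?thesis .
qed

text \<open>Jensen's inequality in \<open>z\<close>: the average of \<open>D\<close> over \<open>\<mu>\<close> is also the average of the
  orbit averages, for which exponential moments of order \<open>card K\<close> are available.\<close>
lemma exp_orbit_average_le:
  fixes D :: "'z \<Rightarrow> 'w \<Rightarrow> real" and R :: "'k \<Rightarrow> 'z \<Rightarrow> 'z" and G :: "'z \<Rightarrow> real"
  assumes M: "prob_space M" and \<mu>: "prob_space \<mu>"
    and D[measurable]: "(\<lambda>(z, \<omega>). D z \<omega>) \<in> borel_measurable (\<mu> \<Otimes>\<^sub>M M)"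
    and K: "finite K" "K \<noteq> {}"
    and R[measurable]: "\<And>k. R k \<in> measurable \<mu> \<mu>" and inv: "\<And>k. k \<in> K \<Longrightarrow> distr \<mu> \<mu> (R k) = \<mu>"
    and G: "integrable \<mu> G" and s: "s > 0"
    and bd: "AE z in \<mu>. (\<integral>\<^sup>+\<omega>. ennreal (exp (s * (\<Sum>k\<in>K. \<bar>D (R k z) \<omega>\<bar>))) \<partial>M) \<le> ennreal (exp (card K * G z))"
  shows "AE \<omega> in M. integrable \<mu> (\<lambda>z. D z \<omega>)"
    and "(\<integral>\<^sup>+\<omega>. ennreal (exp (card K * (s * (\<integral>z. \<bar>D z \<omega>\<bar> \<partial>\<mu>) - (\<integral>z. G z \<partial>\<mu>)))) \<partial>M) \<le> 1"
proof -
  interpret M: prob_space M by fact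
  interpret \<mu>: prob_space \<mu> by fact
  interpret pair_sigma_finite \<mu> M ..
  have [measurable]: "G \<in> borel_measurable \<mu>" using G by auto
  have DR[measurable]: "(\<lambda>(z, \<omega>). D (R k z) \<omega>) \<in> borel_measurable (\<mu> \<Otimes>\<^sub>M M)" for k
  proof -
    have "(\<lambda>p. (R k (fst p), snd p)) \<in> measurable (\<mu> \<Otimes>\<^sub>M M) (\<mu> \<Otimes>\<^sub>M M)" by measurable
    from measurable_compose[OF this D] show ?thesis by (simp add: case_prod_beta')
  qed
  let ?N = "real (card K)"
  have N: "?N > 0" using K by (simp add: card_gt_0_iff)
  \<comment> \<open>Subtracting \<open>?N * G z\<close> normalises the exponential moment at almost
    every \<open>z\<close> to at most 1, so Tonelli bounds the expectation of \<open>h\<close> by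
    1.\<close>
  define q where "q = (\<lambda>z \<omega>. s * (\<Sum>k\<in>K. \<bar>D (R k z) \<omega>\<bar>) - ?N * G z)"
  have q[measurable]: "(\<lambda>(z, \<omega>). q z \<omega>) \<in> borel_measurable (\<mu> \<Otimes>\<^sub>M M)"
    using DR unfolding q_def case_prod_beta' by measurable
  define h where "h = (\<lambda>\<omega>. \<integral>\<^sup>+z. ennreal (exp (q z \<omega>)) \<partial>\<mu>)"
  have qe: "(\<lambda>(z, \<omega>). ennreal (exp (q z \<omega>))) \<in> borel_measurable (\<mu> \<Otimes>\<^sub>M M)"
    using q unfolding case_prod_beta' by measurable
  have [measurable]: "h \<in> borel_measurable M"
    unfolding h_def using measurable_pair_swap[OF qe]
    by (intro \<mu>.borel_measurable_nn_integral) (simp add: case_prod_beta')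
  have "(\<integral>\<^sup>+\<omega>. h \<omega> \<partial>M) = (\<integral>\<^sup>+z. \<integral>\<^sup>+\<omega>. ennreal (exp (q z \<omega>)) \<partial>M \<partial>\<mu>)"
    unfolding h_def by (rule Fubini'[OF qe])
  also have "\<dots> \<le> (\<integral>\<^sup>+z. 1 \<partial>\<mu>)"
  proof (rule nn_integral_mono_AE)
    show "AE z in \<mu>. (\<integral>\<^sup>+\<omega>. ennreal (exp (q z \<omega>)) \<partial>M) \<le> 1"
      using bd AE_space
    proof eventually_elim
      case (elim z)
      have m: "(\<lambda>\<omega>. ennreal (exp (s * (\<Sum>k\<in>K. \<bar>D (R k z) \<omega>\<bar>)))) \<in> borel_measurable M"
      proof -
        have "(\<lambda>\<omega>. D (R k z) \<omega>) \<in> borel_measurable M" for k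
          using measurable_compose[OF measurable_Pair1'[OF elim(2)] DR[of k]] by simp
        then show ?thesis by measurable
      qed
      have "(\<integral>\<^sup>+\<omega>. ennreal (exp (q z \<omega>)) \<partial>M)
         = (\<integral>\<^sup>+\<omega>. ennreal (exp (- (?N * G z))) * ennreal (exp (s * (\<Sum>k\<in>K. \<bar>D (R k z) \<omega>\<bar>))) \<partial>M)"
        by (intro nn_integral_cong) (simp add: q_def flip: ennreal_mult exp_add)
      also have "\<dots> = ennreal (exp (- (?N * G z))) * (\<integral>\<^sup>+\<omega>. ennreal (exp (s * (\<Sum>k\<in>K. \<bar>D (R k z) \<omega>\<bar>))) \<partial>M)"
        by (rule nn_integral_cmult[OF m])
      also have "\<dots> \<le> ennreal (exp (- (?N * G z))) * ennreal (exp (?N * G z))"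
        by (intro mult_left_mono elim) auto
      also have "\<dots> = 1" by (simp flip: ennreal_mult exp_add)
      finally show ?case .
    qed
  qed
  also have "\<dots> = 1" by (simp add: \<mu>.emeasure_space_1)
  finally have h1: "(\<integral>\<^sup>+\<omega>. h \<omega> \<partial>M) \<le> 1" .
  have main: "integrable \<mu> (\<lambda>z. D z \<omega>) \<and>
      ennreal (exp (?N * (s * (\<integral>z. \<bar>D z \<omega>\<bar> \<partial>\<mu>) - (\<integral>z. G z \<partial>\<mu>)))) \<le> h \<omega>"
    if \<omega>: "\<omega> \<in> space M" and fin: "h \<omega> < \<infinity>" for \<omega>
  proof -
    have [measurable]: "(\<lambda>z. q z \<omega>) \<in> borel_measurable \<mu>"
      using measurable_compose[OF measurable_Pair2'[OF \<omega>] q] by simp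
    have D\<omega>[measurable]: "(\<lambda>z. D z \<omega>) \<in> borel_measurable \<mu>"
      using measurable_compose[OF measurable_Pair2'[OF \<omega>] D] by simp
    have DR\<omega>[measurable]: "(\<lambda>z. D (R k z) \<omega>) \<in> borel_measurable \<mu>" for k
      using measurable_compose[OF measurable_Pair2'[OF \<omega>] DR[of k]] by simp
    have e: "integrable \<mu> (\<lambda>z. exp (q z \<omega>))"
      using fin by (intro integrableI_bounded) (auto simp: h_def)
    \<comment> \<open>All summands in \<open>q\<close> apart from the one with \<open>G\<close> are
      nonnegative, so each is at most \<open>q z \<omega> + ?N * G z\<close>; then
      \<open>q \<le> exp q\<close> supplies an integrable majorant.\<close>
    have intDR: "integrable \<mu> (\<lambda>z. D (R k z) \<omega>)" if k: "k \<in> K" for k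
    proof (rule Bochner_Integration.integrable_bound)
      show "integrable \<mu> (\<lambda>z. (exp (q z \<omega>) + ?N * \<bar>G z\<bar>) / s)" using e G by auto
      show "AE z in \<mu>. norm (D (R k z) \<omega>) \<le> norm ((exp (q z \<omega>) + ?N * \<bar>G z\<bar>) / s)"
      proof (rule AE_I2)
        fix z
        have "s * \<bar>D (R k z) \<omega>\<bar> \<le> s * (\<Sum>k\<in>K. \<bar>D (R k z) \<omega>\<bar>)"
          using s k K by (intro mult_left_mono member_le_sum) auto
        also have "\<dots> = q z \<omega> + ?N * G z" by (simp add: q_def)
        also have "\<dots> \<le> exp (q z \<omega>) + ?N * \<bar>G z\<bar>"
        proof (intro add_mono mult_left_mono)
          show "q z \<omega> \<le> exp (q z \<omega>)" using exp_ge_add_one_self[of "q z \<omega>"] by linarith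
        qed auto
        finally have "\<bar>D (R k z) \<omega>\<bar> \<le> (exp (q z \<omega>) + ?N * \<bar>G z\<bar>) / s"
          using s by (simp add: field_simps)
        then show "norm (D (R k z) \<omega>) \<le> norm ((exp (q z \<omega>) + ?N * \<bar>G z\<bar>) / s)" using s by simp
      qed
    qed measurable
    obtain k0 where k0: "k0 \<in> K" using K by auto
    \<comment> \<open>Invariance of \<mu> carries integrability from one rotated copy back to
      \<open>D\<close>, and in the next step also the value of the integral.\<close>
    have intD: "integrable \<mu> (\<lambda>z. D z \<omega>)"
      using intDR[OF k0] inv[OF k0] D\<omega> by (subst inv[OF k0, symmetric], subst integrable_distr_eq) auto
    have "(\<integral>z. \<bar>D (R k z) \<omega>\<bar> \<partial>\<mu>) = (\<integral>z. \<bar>D z \<omega>\<bar> \<partial>\<mu>)" if "k \<in> K" for k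
      by (subst (2) inv[OF that, symmetric], subst integral_distr) auto
    then have "(\<integral>z. q z \<omega> \<partial>\<mu>) = ?N * (s * (\<integral>z. \<bar>D z \<omega>\<bar> \<partial>\<mu>) - (\<integral>z. G z \<partial>\<mu>))"
      using intDR G by (simp add: q_def algebra_simps)
    moreover have "integrable \<mu> (\<lambda>z. q z \<omega>)"
      unfolding q_def using intDR G by (intro Bochner_Integration.integrable_diff integrable_mult_right
        Bochner_Integration.integrable_sum integrable_abs) auto
    ultimately have "exp (?N * (s * (\<integral>z. \<bar>D z \<omega>\<bar> \<partial>\<mu>) - (\<integral>z. G z \<partial>\<mu>))) \<le> (\<integral>z. exp (q z \<omega>) \<partial>\<mu>)"
      using exp_average_le_average_exp[OF \<mu> _ e] by simp
    moreover have "h \<omega> = ennreal (\<integral>z. exp (q z \<omega>) \<partial>\<mu>)"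
      unfolding h_def by (rule nn_integral_eq_integral[OF e]) simp
    ultimately show ?thesis using intD by (simp add: ennreal_leI)
  qed
  have fin: "AE \<omega> in M. h \<omega> \<noteq> \<infinity>"
  proof (rule nn_integral_PInf_AE)
    show "integral\<^sup>N M h \<noteq> \<infinity>" using h1 by (auto simp: top_unique)
  qed simp
  show "AE \<omega> in M. integrable \<mu> (\<lambda>z. D z \<omega>)"
    using fin AE_space by eventually_elim (use main in \<open>auto simp: less_top\<close>)
  \<comment> \<open>Where \<open>h\<close> is infinite the pointwise bound is trivial, so the
    comparison holds on all of \<open>M\<close>.\<close>
  have "(\<integral>\<^sup>+\<omega>. ennreal (exp (?N * (s * (\<integral>z. \<bar>D z \<omega>\<bar> \<partial>\<mu>) - (\<integral>z. G z \<partial>\<mu>)))) \<partial>M) \<le> (\<integral>\<^sup>+\<omega>. h \<omega> \<partial>M)"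
    by (intro nn_integral_mono) (metis main infinity_ennreal_def less_top top_greatest)
  with h1 show "(\<integral>\<^sup>+\<omega>. ennreal (exp (?N * (s * (\<integral>z. \<bar>D z \<omega>\<bar> \<partial>\<mu>) - (\<integral>z. G z \<partial>\<mu>)))) \<partial>M) \<le> 1"
    by simp
qed

text \<open>The lower bound \<open>1 + y \<le> exp y\<close> yields integrability and the mean;
  Markov's inequality for the same exponential yields the tail.\<close>

lemma exp_moment_consequences:
  fixes X :: "'w \<Rightarrow> real"
  assumes M: "prob_space M" and X[measurable]: "X \<in> borel_measurable M" and X0: "\<And>\<omega>. X \<omega> \<ge> 0"
    and N: "N > 0" and s: "s > 0"
    and e: "(\<integral>\<^sup>+\<omega>. ennreal (exp (N * (s * X \<omega> - \<Gamma>))) \<partial>M) \<le> 1"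
  shows "integrable M X" and "(\<integral>\<omega>. X \<omega> \<partial>M) \<le> \<Gamma> / s"
    and "measure M {\<omega> \<in> space M. X \<omega> > x} \<le> exp (- N * (s * x - \<Gamma>))"
proof -
  interpret prob_space M by fact
  let ?Y = "\<lambda>\<omega>. N * (s * X \<omega> - \<Gamma>)"
  have le: "1 + ?Y \<omega> \<le> exp (?Y \<omega>)" for \<omega> by (rule exp_ge_add_one_self)
  have ie: "integrable M (\<lambda>\<omega>. exp (?Y \<omega>))"
    using e by (intro integrableI_bounded) (auto simp: le_less_trans)
  have ie1: "(\<integral>\<omega>. exp (?Y \<omega>) \<partial>M) \<le> 1"
    using e by (subst (asm) nn_integral_eq_integral[OF ie]) auto
  show iX: "integrable M X"
  proof (rule Bochner_Integration.integrable_bound)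
    show "integrable M (\<lambda>\<omega>. (exp (?Y \<omega>) + N * \<bar>\<Gamma>\<bar>) / (N * s))" using ie by auto
    show "AE \<omega> in M. norm (X \<omega>) \<le> norm ((exp (?Y \<omega>) + N * \<bar>\<Gamma>\<bar>) / (N * s))"
    proof (rule AE_I2)
      fix \<omega>
      have "N * \<Gamma> \<le> N * \<bar>\<Gamma>\<bar>" using N by (intro mult_left_mono) auto
      then have "X \<omega> * (N * s) \<le> exp (?Y \<omega>) + N * \<bar>\<Gamma>\<bar>" using le[of \<omega>] by (simp add: algebra_simps)
      then have "X \<omega> \<le> (exp (?Y \<omega>) + N * \<bar>\<Gamma>\<bar>) / (N * s)" using N s by (simp add: pos_le_divide_eq)
      then show "norm (X \<omega>) \<le> norm ((exp (?Y \<omega>) + N * \<bar>\<Gamma>\<bar>) / (N * s))" using X0[of \<omega>] N s by simp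
    qed
  qed simp
  have "(\<integral>\<omega>. 1 + ?Y \<omega> \<partial>M) \<le> (\<integral>\<omega>. exp (?Y \<omega>) \<partial>M)"
    using iX ie by (intro integral_mono le) auto
  also have "(\<integral>\<omega>. 1 + ?Y \<omega> \<partial>M) = 1 + N * (s * (\<integral>\<omega>. X \<omega> \<partial>M) - \<Gamma>)"
    using iX by (simp add: prob_space)
  finally have "N * (s * (\<integral>\<omega>. X \<omega> \<partial>M) - \<Gamma>) \<le> 0" using ie1 by linarith
  then show "(\<integral>\<omega>. X \<omega> \<partial>M) \<le> \<Gamma> / s" using N s by (simp add: mult_le_0_iff field_simps)
  have "{\<omega> \<in> space M. X \<omega> > x} \<subseteq> {\<omega> \<in> space M. exp (N * (s * x - \<Gamma>)) \<le> exp (?Y \<omega>)}"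
    using N s by auto
  then have "measure M {\<omega> \<in> space M. X \<omega> > x} \<le> measure M {\<omega> \<in> space M. exp (N * (s * x - \<Gamma>)) \<le> exp (?Y \<omega>)}"
    by (intro finite_measure_mono) auto
  also have "\<dots> \<le> (\<integral>\<omega>. exp (?Y \<omega>) \<partial>M) / exp (N * (s * x - \<Gamma>))"
    using ie by (intro integral_Markov_inequality_measure[where A = "{}"]) auto
  also have "\<dots> \<le> 1 / exp (N * (s * x - \<Gamma>))"
    using ie1 by (intro divide_right_mono) auto
  also have "\<dots> = exp (- N * (s * x - \<Gamma>))"
    by (simp add: exp_minus[symmetric] inverse_eq_divide[symmetric])
  finally show "measure M {\<omega> \<in> space M. X \<omega> > x} \<le> exp (- N * (s * x - \<Gamma>))" .
qed

section \<open>Integration by parts\<close>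

text \<open>Difference quotients integrate to 0 by translation invariance. The mean value inequality
  bounds them by \<open>B\<close> on a fixed ball, so dominated convergence applies.\<close>

lemma integral_directional_derivative_eq_0:
  fixes g g' :: "'a::euclidean_space \<Rightarrow> complex"
  assumes der: "\<And>x. ((\<lambda>t. g (x + t *\<^sub>R e)) has_vector_derivative g' x) (at 0)"
    and bd: "\<And>x. norm (g' x) \<le> B"
    and supp: "bounded S" "\<And>x. x \<notin> S \<Longrightarrow> g x = 0"
    and g: "integrable lborel g" and g'[measurable]: "g' \<in> borel_measurable borel"
  shows "(\<integral>x. g' x \<partial>lborel) = 0"
proof -
  have [measurable]: "g \<in> borel_measurable borel" using g by auto
  have der': "((\<lambda>t. g (x + t *\<^sub>R e)) has_vector_derivative g' (x + t *\<^sub>R e)) (at t)" for x t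
  proof -
    have "((\<lambda>s. g (x + t *\<^sub>R e + s *\<^sub>R e)) \<circ> (\<lambda>u. u - t) has_vector_derivative (1 *\<^sub>R g' (x + t *\<^sub>R e))) (at t)"
      by (rule vector_diff_chain_at) (auto intro!: derivative_eq_intros der)
    then show ?thesis by (simp add: o_def algebra_simps)
  qed
  have lip: "norm (g (x + t *\<^sub>R e) - g x) \<le> B * \<bar>t\<bar>" for x t
  proof -
    have "norm (g (x + t *\<^sub>R e) - g (x + 0 *\<^sub>R e)) \<le> B * norm (t - 0)"
    proof (rule differentiable_bound[of UNIV "\<lambda>t. g (x + t *\<^sub>R e)" "\<lambda>t h. h *\<^sub>R g' (x + t *\<^sub>R e)"])
      show "((\<lambda>t. g (x + t *\<^sub>R e)) has_derivative (\<lambda>h. h *\<^sub>R g' (x + s *\<^sub>R e))) (at s within UNIV)" for s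
        using der'[of x s] by (simp add: has_vector_derivative_def)
      show "onorm (\<lambda>h. h *\<^sub>R g' (x + s *\<^sub>R e)) \<le> B" for s
      proof (rule onorm_le)
        fix h :: real
        show "norm (h *\<^sub>R g' (x + s *\<^sub>R e)) \<le> B * norm h"
          using mult_right_mono[OF bd[of "x + s *\<^sub>R e"], of "\<bar>h\<bar>"] by (simp add: mult.commute)
      qed
    qed auto
    then show ?thesis by simp
  qed
  obtain R where R: "\<And>x. x \<in> S \<Longrightarrow> norm x \<le> R" using supp by (auto simp: bounded_iff)
  \<comment> \<open>The increments \<open>(1 / real (Suc n)) *\<^sub>R e\<close> have norm at most
    \<open>norm e\<close>, so this ball contains the supports of all the difference
    quotients.\<close>
  define C where "C = cball (0::'a) (R + norm e)"
  define h where "h = (\<lambda>n x. real (Suc n) *\<^sub>R (g (x + (1 / real (Suc n)) *\<^sub>R e) - g x))"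
  have "(\<lambda>n. \<integral>x. h n x \<partial>lborel) \<longlonglongrightarrow> (\<integral>x. g' x \<partial>lborel)"
  proof (rule integral_dominated_convergence)
    show "integrable lborel (\<lambda>x. indicator C x *\<^sub>R B)"
      unfolding C_def by (intro borel_integrable_compact) auto
    show "AE x in lborel. (\<lambda>n. h n x) \<longlonglongrightarrow> g' x"
    proof (rule AE_I2)
      fix x
      have "((\<lambda>t. (g (x + t *\<^sub>R e) - g x) /\<^sub>R t) \<longlongrightarrow> g' x) (at 0)"
      proof (rule LIM_zero_cancel, rule tendsto_norm_zero_cancel)
        have "((\<lambda>t. norm (g (x + t *\<^sub>R e) - g x - t *\<^sub>R g' x) / norm t) \<longlongrightarrow> 0) (at 0)"
          using der[of x] unfolding has_vector_derivative_def has_derivative_at by simp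
        then show "((\<lambda>t. norm ((g (x + t *\<^sub>R e) - g x) /\<^sub>R t - g' x)) \<longlongrightarrow> 0) (at 0)"
        proof (rule Lim_transform_eventually)
          have "norm (g (x + t *\<^sub>R e) - g x - t *\<^sub>R g' x) / norm t = norm ((g (x + t *\<^sub>R e) - g x) /\<^sub>R t - g' x)"
            if "t \<noteq> 0" for t
          proof -
            have "(g (x + t *\<^sub>R e) - g x) /\<^sub>R t - g' x = (g (x + t *\<^sub>R e) - g x - t *\<^sub>R g' x) /\<^sub>R t"
              using that by (simp add: scaleR_diff_right)
            then show ?thesis by (simp add: divide_inverse mult.commute)
          qed
          then show "\<forall>\<^sub>F t in at 0. norm (g (x + t *\<^sub>R e) - g x - t *\<^sub>R g' x) / norm t
              = norm ((g (x + t *\<^sub>R e) - g x) /\<^sub>R t - g' x)"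
            by (auto simp: eventually_at_filter)
        qed
      qed
      moreover have "filterlim (\<lambda>n. 1 / real (Suc n)) (at 0) sequentially"
        unfolding filterlim_at using LIMSEQ_Suc[OF lim_1_over_n] by auto
      ultimately have "(\<lambda>n. (g (x + (1 / real (Suc n)) *\<^sub>R e) - g x) /\<^sub>R (1 / real (Suc n))) \<longlonglongrightarrow> g' x"
        by (rule filterlim_compose)
      then show "(\<lambda>n. h n x) \<longlonglongrightarrow> g' x" by (simp add: h_def)
    qed
    show "AE x in lborel. norm (h n x) \<le> indicator C x *\<^sub>R B" for n
    proof (rule AE_I2)
      fix x
      show "norm (h n x) \<le> indicator C x *\<^sub>R B"
      proof (cases "x \<in> C")
        case True
        have "norm (h n x) = real (Suc n) * norm (g (x + (1 / real (Suc n)) *\<^sub>R e) - g x)"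
          by (simp add: h_def)
        also have "\<dots> \<le> real (Suc n) * (B * \<bar>1 / real (Suc n)\<bar>)"
          by (intro mult_left_mono lip) auto
        finally show ?thesis using True by simp
      next
        case False
        have "x \<notin> S" using False R[of x] norm_ge_zero[of e] by (fastforce simp: C_def)
        moreover have "x + (1 / real (Suc n)) *\<^sub>R e \<notin> S"
        proof
          assume "x + (1 / real (Suc n)) *\<^sub>R e \<in> S"
          then have "norm (x + (1 / real (Suc n)) *\<^sub>R e) \<le> R" by (rule R)
          moreover have "norm ((1 / real (Suc n)) *\<^sub>R e) \<le> norm e"
            by (simp add: divide_le_eq mult_le_cancel_left1)
          ultimately have "norm x \<le> R + norm e"
            using norm_triangle_ineq4[of "x + (1 / real (Suc n)) *\<^sub>R e" "(1 / real (Suc n)) *\<^sub>R e"] by simp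
          then show False using False by (simp add: C_def)
        qed
        ultimately show ?thesis using False supp by (simp add: h_def)
      qed
    qed
  qed (simp_all add: h_def)
  moreover have "(\<integral>x. h n x \<partial>lborel) = 0" for n
  proof -
    let ?d = "(1 / real (Suc n)) *\<^sub>R e"
    have "integrable (distr lborel borel ((+) ?d)) g" using g by (simp add: lborel_distr_plus)
    then have i: "integrable lborel (\<lambda>x. g (x + ?d))"
      by (subst (asm) integrable_distr_eq) (auto simp: add.commute)
    have "(\<integral>x. g (x + ?d) \<partial>lborel) = (\<integral>x. g x \<partial>distr lborel borel ((+) ?d))"
      by (subst integral_distr) (auto simp: add.commute)
    then have "(\<integral>x. g (x + ?d) \<partial>lborel) = (\<integral>x. g x \<partial>lborel)" by (simp add: lborel_distr_plus)
    then show ?thesis using i g by (simp add: h_def)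
  qed
  ultimately show ?thesis by (simp add: LIMSEQ_const_iff)
qed

text \<open>Continuity is asked of each directional derivative, the form in which derivatives enter
  \<open>wirtinger\<close> and \<open>wirtinger_bar\<close>, rather than of the derivative in
  operator norm.\<close>

definition C1_on :: "'a::real_normed_vector set \<Rightarrow> ('a \<Rightarrow> 'b::real_normed_vector) \<Rightarrow> bool" where
  "C1_on U v \<longleftrightarrow> (\<forall>z\<in>U. v differentiable (at z)) \<and>
     (\<forall>e. continuous_on U (\<lambda>z. frechet_derivative v (at z) e))"

lemma C1_onI:
  assumes "\<And>z. z \<in> U \<Longrightarrow> (v has_derivative v' z) (at z)" "\<And>e. continuous_on U (\<lambda>z. v' z e)"
  shows "C1_on U v"
proof -
  have "frechet_derivative v (at z) = v' z" if "z \<in> U" for z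
    using frechet_derivative_at[OF assms(1)[OF that]] by simp
  then show ?thesis unfolding C1_on_def
    using assms by (auto simp: differentiable_def cong: continuous_on_cong)
qed

lemma C1_on_has_derivative:
  assumes "C1_on U v" "z \<in> U"
  shows "(v has_derivative frechet_derivative v (at z)) (at z)"
  using assms by (auto simp: C1_on_def frechet_derivative_works)

lemma C1_on_continuous_on:
  assumes "C1_on U v"
  shows "continuous_on U v"
  using assms by (auto simp: C1_on_def intro!: continuous_at_imp_continuous_on differentiable_imp_continuous_within)

lemma frechet_derivative_cong_open:
  assumes "open U" "z \<in> U" "\<And>w. w \<in> U \<Longrightarrow> f w = g w"
  shows "frechet_derivative f (at z) = frechet_derivative g (at z)"
proof -
  have "(f has_derivative D) (at z) \<longleftrightarrow> (g has_derivative D) (at z)" for D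
    by (auto elim!: has_derivative_transform_within_open[OF _ assms(1,2)] simp: assms(3))
  then show ?thesis by (simp add: frechet_derivative_def)
qed

lemma C1_on_frechet_derivative_eq_0:
  fixes v :: "'a::real_normed_vector \<Rightarrow> 'b::real_normed_vector"
  assumes "open U" "closed S" "\<And>z. z \<in> U - S \<Longrightarrow> v z = 0" "z \<in> U - S"
  shows "frechet_derivative v (at z) = (\<lambda>_. 0)"
proof -
  have "frechet_derivative v (at z) = frechet_derivative (\<lambda>_::'a. 0::'b) (at z)"
    using assms by (intro frechet_derivative_cong_open[of "U - S"]) auto
  then show ?thesis by simp
qed

lemma set_integrable_compact_support:
  fixes F :: "'a::euclidean_space \<Rightarrow> complex"
  assumes "continuous_on U F" "compact S" "S \<subseteq> U" "\<And>z. z \<in> U - S \<Longrightarrow> F z = 0"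
  shows "set_integrable lborel U F"
proof -
  have "integrable lborel (\<lambda>x. indicator S x *\<^sub>R F x)"
    using assms by (intro borel_integrable_compact) (auto intro: continuous_on_subset)
  moreover have "(\<lambda>x. indicator S x *\<^sub>R F x) = (\<lambda>x. indicator U x *\<^sub>R F x)"
    using assms by (auto simp: fun_eq_iff indicator_def)
  ultimately show ?thesis by (simp add: set_integrable_def)
qed

text \<open>\<open>u\<close> may blow up at the boundary of \<open>U\<close>, as the logarithm of
  the kernel does: since \<open>v\<close> vanishes off the compact set \<open>S\<close>, the product
  extended by 0 is differentiable everywhere, and its directional derivative integrates to
  0.\<close>

lemma integral_by_parts_frechet:
  fixes u v :: "'a::euclidean_space \<Rightarrow> complex"
  assumes U: "open U" and S: "compact S" "S \<subseteq> U"
    and u: "C1_on U u" and v: "C1_on U v" and v0: "\<And>z. z \<in> U - S \<Longrightarrow> v z = 0"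
  shows "set_integrable lborel U (\<lambda>z. u z * frechet_derivative v (at z) e)"
    and "set_integrable lborel U (\<lambda>z. frechet_derivative u (at z) e * v z)"
    and "(LINT z:U|lborel. u z * frechet_derivative v (at z) e) = - (LINT z:U|lborel. frechet_derivative u (at z) e * v z)"
proof -
  have cS: "closed S" using S(1) by (rule compact_imp_closed)
  have v0': "frechet_derivative v (at z) = (\<lambda>_. 0)" if "z \<in> U - S" for z
    using C1_on_frechet_derivative_eq_0[OF U cS v0 that] .
  have cu: "continuous_on U u" and cv: "continuous_on U v" using u v by (auto intro: C1_on_continuous_on)
  have cu': "continuous_on U (\<lambda>z. frechet_derivative u (at z) e)"
    and cv': "continuous_on U (\<lambda>z. frechet_derivative v (at z) e)" using u v by (auto simp: C1_on_def)
  show i1: "set_integrable lborel U (\<lambda>z. u z * frechet_derivative v (at z) e)"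
    using cu cv' S v0' by (intro set_integrable_compact_support[OF _ S]) (auto intro!: continuous_intros)
  show i2: "set_integrable lborel U (\<lambda>z. frechet_derivative u (at z) e * v z)"
    using cu' cv S v0 by (intro set_integrable_compact_support[OF _ S]) (auto intro!: continuous_intros)
  define g where "g = (\<lambda>z. indicator U z *\<^sub>R (u z * v z))"
  define F where "F = (\<lambda>z. u z * frechet_derivative v (at z) e + frechet_derivative u (at z) e * v z)"
  define g' where "g' = (\<lambda>z. indicator U z *\<^sub>R F z)"
  have cF: "continuous_on U F" unfolding F_def using cu cv cu' cv' by (auto intro!: continuous_intros)
  have F0: "F z = 0" if "z \<in> U - S" for z using v0 v0' that by (simp add: F_def)
  have "bounded (F ` S)"
    using S cF by (intro compact_imp_bounded compact_continuous_image) (auto intro: continuous_on_subset)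
  then obtain B where B: "\<And>z. z \<in> S \<Longrightarrow> norm (F z) \<le> B" by (auto simp: bounded_iff)
  have "(\<integral>x. g' x \<partial>lborel) = 0"
  proof (rule integral_directional_derivative_eq_0[where g = g and e = e and S = S and B = "max B 0"])
    show "((\<lambda>t. g (x + t *\<^sub>R e)) has_vector_derivative g' x) (at 0)" for x
    proof (cases "x \<in> U")
      case True
      have "((\<lambda>z. u z * v z) has_derivative (\<lambda>h. u x * frechet_derivative v (at x) h + frechet_derivative u (at x) h * v x)) (at x)"
        by (intro has_derivative_mult C1_on_has_derivative[OF u True] C1_on_has_derivative[OF v True])
      then have "(g has_derivative (\<lambda>h. u x * frechet_derivative v (at x) h + frechet_derivative u (at x) h * v x)) (at x)"
        using U True by (rule has_derivative_transform_within_open) (simp add: g_def)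
      then have d: "(g has_derivative (\<lambda>h. u x * frechet_derivative v (at x) h + frechet_derivative u (at x) h * v x)) (at (x + 0 *\<^sub>R e))"
        by simp
      have "((\<lambda>t. x + t *\<^sub>R e) has_derivative (\<lambda>t. t *\<^sub>R e)) (at 0)"
        by (auto intro!: derivative_eq_intros)
      from diff_chain_at[OF this d] have "((\<lambda>t. g (x + t *\<^sub>R e)) has_derivative
          (\<lambda>t. u x * frechet_derivative v (at x) (t *\<^sub>R e) + frechet_derivative u (at x) (t *\<^sub>R e) * v x)) (at 0)"
        by (simp add: o_def)
      moreover have "frechet_derivative u (at x) (t *\<^sub>R e) = t *\<^sub>R frechet_derivative u (at x) e"
        "frechet_derivative v (at x) (t *\<^sub>R e) = t *\<^sub>R frechet_derivative v (at x) e" for t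
        using C1_on_has_derivative[OF u True] C1_on_has_derivative[OF v True]
        by (auto dest!: has_derivative_linear simp: linear_cmul)
      ultimately show ?thesis
        using True by (simp add: has_vector_derivative_def g'_def F_def scaleR_add_right)
    next
      case False
      then have x: "x \<in> - S" using S by auto
      have "(g has_derivative (\<lambda>_. 0)) (at x)"
        by (rule has_derivative_transform_within_open[OF has_derivative_const _ x])
           (use cS v0 in \<open>auto simp: g_def indicator_def\<close>)
      then have d: "(g has_derivative (\<lambda>_. 0)) (at (x + 0 *\<^sub>R e))" by simp
      have "((\<lambda>t. x + t *\<^sub>R e) has_derivative (\<lambda>t. t *\<^sub>R e)) (at 0)"
        by (auto intro!: derivative_eq_intros)
      from diff_chain_at[OF this d] show ?thesis
        using False by (simp add: o_def has_vector_derivative_def g'_def)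
    qed
    show "norm (g' x) \<le> max B 0" for x
      using B[of x] F0[of x] S by (cases "x \<in> S"; cases "x \<in> U") (auto simp: g'_def)
    show "bounded S" using S(1) by (rule compact_imp_bounded)
    show "g x = 0" if "x \<notin> S" for x using v0[of x] that by (auto simp: g_def indicator_def)
    show "integrable lborel g"
      using set_integrable_compact_support[OF _ S, of "\<lambda>z. u z * v z"] cu cv v0
      by (simp add: g_def set_integrable_def continuous_on_mult)
    have "integrable lborel g'"
      using set_integrable_compact_support[OF cF S F0] by (simp add: g'_def set_integrable_def)
    then show "g' \<in> borel_measurable borel" by auto
  qed
  moreover have "(\<integral>x. g' x \<partial>lborel) = (LINT z:U|lborel. u z * frechet_derivative v (at z) e) + (LINT z:U|lborel. frechet_derivative u (at z) e * v z)"
    unfolding g'_def F_def using set_integral_add(2)[OF i1 i2] by (simp add: set_lebesgue_integral_def)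
  ultimately show "(LINT z:U|lborel. u z * frechet_derivative v (at z) e) = - (LINT z:U|lborel. frechet_derivative u (at z) e * v z)"
    by (simp add: eq_neg_iff_add_eq_0)
qed

lemma integral_by_parts_wirtinger:
  fixes u v :: "complex ^ 'n::finite \<Rightarrow> complex"
  assumes U: "open U" and S: "compact S" "S \<subseteq> U"
    and u: "C1_on U u" and v: "C1_on U v" and v0: "\<And>z. z \<in> U - S \<Longrightarrow> v z = 0"
  shows "(LINT z:U|lborel. u z * wirtinger j v z) = - (LINT z:U|lborel. wirtinger j u z * v z)"
    and "(LINT z:U|lborel. u z * wirtinger_bar j v z) = - (LINT z:U|lborel. wirtinger_bar j u z * v z)"
proof -
  note ibp = integral_by_parts_frechet[OF U S u v v0]
  have *: "(LINT z:U|lborel. u z * ((frechet_derivative v (at z) e + c * frechet_derivative v (at z) e') / 2))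
     = - (LINT z:U|lborel. (frechet_derivative u (at z) e + c * frechet_derivative u (at z) e') / 2 * v z)" for c e e'
  proof -
    have "(LINT z:U|lborel. u z * ((frechet_derivative v (at z) e + c * frechet_derivative v (at z) e') / 2))
      = (LINT z:U|lborel. 1 / 2 * (u z * frechet_derivative v (at z) e) + c / 2 * (u z * frechet_derivative v (at z) e'))"
      by (intro arg_cong[where f = "set_lebesgue_integral lborel U"]) (auto simp: fun_eq_iff field_simps)
    also have "\<dots> = 1 / 2 * (LINT z:U|lborel. u z * frechet_derivative v (at z) e) + c / 2 * (LINT z:U|lborel. u z * frechet_derivative v (at z) e')"
      using ibp(1) by (subst set_integral_add(2)) (auto simp: set_integral_mult_right)
    also have "\<dots> = - (1 / 2 * (LINT z:U|lborel. frechet_derivative u (at z) e * v z) + c / 2 * (LINT z:U|lborel. frechet_derivative u (at z) e' * v z))"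
      using ibp(3)[of e] ibp(3)[of e'] by simp
    also have "1 / 2 * (LINT z:U|lborel. frechet_derivative u (at z) e * v z) + c / 2 * (LINT z:U|lborel. frechet_derivative u (at z) e' * v z)
       = (LINT z:U|lborel. 1 / 2 * (frechet_derivative u (at z) e * v z) + c / 2 * (frechet_derivative u (at z) e' * v z))"
      using ibp(2) by (subst set_integral_add(2)) (auto simp: set_integral_mult_right)
    also have "\<dots> = (LINT z:U|lborel. (frechet_derivative u (at z) e + c * frechet_derivative u (at z) e') / 2 * v z)"
      by (intro arg_cong[where f = "set_lebesgue_integral lborel U"]) (auto simp: fun_eq_iff field_simps)
    finally show ?thesis .
  qed
  show "(LINT z:U|lborel. u z * wirtinger j v z) = - (LINT z:U|lborel. wirtinger j u z * v z)"
    using *[of "axis j 1" "- \<i>" "axis j \<i>"] by (simp add: wirtinger_def)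
  show "(LINT z:U|lborel. u z * wirtinger_bar j v z) = - (LINT z:U|lborel. wirtinger_bar j u z * v z)"
    using *[of "axis j 1" "\<i>" "axis j \<i>"] by (simp add: wirtinger_bar_def)
qed

lemma C2_on_imp_C1_on:
  fixes g :: "'a::real_normed_vector \<Rightarrow> 'b::real_normed_vector"
  assumes U: "open U" and g: "C2_on U g"
  shows "C1_on U g" and "C1_on U (\<lambda>z. frechet_derivative g (at z) e)"
proof -
  obtain g' :: "'a \<Rightarrow> 'a \<Rightarrow>\<^sub>L 'b" and g'' :: "'a \<Rightarrow> 'a \<Rightarrow>\<^sub>L 'a \<Rightarrow>\<^sub>L 'b" where
    g': "\<And>x. x \<in> U \<Longrightarrow> (g has_derivative blinfun_apply (g' x)) (at x)"
    and g'': "\<And>x. x \<in> U \<Longrightarrow> (g' has_derivative blinfun_apply (g'' x)) (at x)"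
    and c: "continuous_on U g''"
    using g unfolding C2_on_def by blast
  have cg': "continuous_on U g'"
    using g'' by (intro continuous_at_imp_continuous_on) (auto intro: has_derivative_continuous)
  show "C1_on U g"
    by (rule C1_onI[OF g']) (auto intro!: continuous_intros cg')
  have eq: "frechet_derivative g (at z) e = blinfun_apply (g' z) e" if "z \<in> U" for z
    using frechet_derivative_at[OF g'[OF that]] by simp
  show "C1_on U (\<lambda>z. frechet_derivative g (at z) e)"
  proof (rule C1_onI)
    fix z assume z: "z \<in> U"
    have "((\<lambda>z. blinfun_apply (g' z) e) has_derivative (\<lambda>h. blinfun_apply (blinfun_apply (g'' z) h) e)) (at z)"
      by (auto intro!: derivative_eq_intros g''[OF z])
    then show "((\<lambda>z. frechet_derivative g (at z) e) has_derivative (\<lambda>h. blinfun_apply (blinfun_apply (g'' z) h) e)) (at z)"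
      using U z by (rule has_derivative_transform_within_open) (simp add: eq)
  next
    show "continuous_on U (\<lambda>z. blinfun_apply (blinfun_apply (g'' z) h) e)" for h
      by (auto intro!: continuous_intros c)
  qed
qed

lemma C1_on_linear_combination:
  fixes v w :: "'a::real_normed_vector \<Rightarrow> complex"
  assumes v: "C1_on U v" and w: "C1_on U w"
  shows "C1_on U (\<lambda>z. c * v z + d * w z)"
proof (rule C1_onI)
  show "((\<lambda>z. c * v z + d * w z) has_derivative
      (\<lambda>h. c * frechet_derivative v (at z) h + d * frechet_derivative w (at z) h)) (at z)" if "z \<in> U" for z
    by (intro has_derivative_add has_derivative_mult_right C1_on_has_derivative[OF v that]
        C1_on_has_derivative[OF w that])
qed (use v w in \<open>auto simp: C1_on_def intro!: continuous_intros\<close>)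

lemma wirtinger_sum:
  fixes v :: "'k \<Rightarrow> complex ^ 'n::finite \<Rightarrow> complex"
  assumes "finite K" "\<And>k. k \<in> K \<Longrightarrow> C1_on U (v k)" and z: "z \<in> U"
  shows "wirtinger j (\<lambda>z. \<Sum>k\<in>K. c k * v k z) z = (\<Sum>k\<in>K. c k * wirtinger j (v k) z)"
proof -
  have "((\<lambda>z. \<Sum>k\<in>K. c k * v k z) has_derivative (\<lambda>h. \<Sum>k\<in>K. c k * frechet_derivative (v k) (at z) h)) (at z)"
    using assms by (intro has_derivative_sum has_derivative_mult_right C1_on_has_derivative[of U])
  from frechet_derivative_at[OF this, symmetric] show ?thesis
    by (simp add: wirtinger_def sum_distrib_left sum_subtractf[symmetric] sum_divide_distrib algebra_simps)
qed

section \<open>The contribution of the covariance kernel\<close>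

lemma open_polydisk: "open (polydisk :: (complex ^ 'n::finite) set)"
proof -
  have "polydisk = (\<Inter>j. {z :: complex ^ 'n. cmod (z $ j) < 1})" by (auto simp: polydisk_def)
  also have "open \<dots>" by (intro open_INT ballI open_Collect_less continuous_intros) auto
  finally show ?thesis .
qed

lemma one_minus_norm_square_pos:
  assumes "z \<in> polydisk"
  shows "1 - (cmod (z $ j))\<^sup>2 > 0"
  using power_strict_mono[of "cmod (z $ j)" 1 2] assms by (simp add: polydisk_def)

lemma norm_square_component_has_derivative:
  "((\<lambda>z :: complex ^ 'n::finite. (cmod (z $ i))\<^sup>2) has_derivative (\<lambda>h. 2 * (z $ i \<bullet> h $ i))) (at z)"
proof -
  have b: "((\<lambda>z :: complex ^ 'n. z $ i) has_derivative (\<lambda>h. h $ i)) (at z)"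
    by (rule bounded_linear_imp_has_derivative[OF bounded_linear_vec_nth])
  have "z $ i \<bullet> h $ i + h $ i \<bullet> z $ i = 2 * (z $ i \<bullet> h $ i)" for h
    by (simp add: inner_commute[of "h $ i"])
  with has_derivative_inner[OF b b] show ?thesis by (simp only: dot_square_norm)
qed

definition kernel_term :: "'n \<Rightarrow> complex ^ 'n::finite \<Rightarrow> complex" where
  "kernel_term i z = complex_of_real (- ln (1 - (cmod (z $ i))\<^sup>2))"

definition kernel_term_del :: "'n \<Rightarrow> complex ^ 'n::finite \<Rightarrow> complex" where
  "kernel_term_del i z = cnj (z $ i) / complex_of_real (1 - (cmod (z $ i))\<^sup>2)"

lemma kernel_term_has_derivative:
  assumes z: "z \<in> polydisk"
  shows "(kernel_term i has_derivative (\<lambda>h. complex_of_real (2 * (z $ i \<bullet> h $ i) / (1 - (cmod (z $ i))\<^sup>2)))) (at z)"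
proof -
  have p: "1 - (cmod (z $ i))\<^sup>2 > 0" by (rule one_minus_norm_square_pos[OF z])
  have "((\<lambda>z. 1 - (cmod (z $ i))\<^sup>2) has_derivative (\<lambda>h. 0 - 2 * (z $ i \<bullet> h $ i))) (at z)"
    by (intro has_derivative_diff has_derivative_const norm_square_component_has_derivative)
  from DERIV_compose_FDERIV[OF DERIV_ln_divide[OF p] this]
  have "((\<lambda>z. - ln (1 - (cmod (z $ i))\<^sup>2)) has_derivative (\<lambda>h. - ((0 - 2 * (z $ i \<bullet> h $ i)) * (1 / (1 - (cmod (z $ i))\<^sup>2))))) (at z)"
    by (rule has_derivative_minus)
  then have "((\<lambda>z. complex_of_real (- ln (1 - (cmod (z $ i))\<^sup>2))) has_derivative
      (\<lambda>h. complex_of_real (- ((0 - 2 * (z $ i \<bullet> h $ i)) * (1 / (1 - (cmod (z $ i))\<^sup>2)))))) (at z)"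
    by (rule has_derivative_of_real)
  then show ?thesis unfolding kernel_term_def by simp
qed

lemma kernel_term_del_has_derivative:
  assumes z: "z \<in> polydisk"
  shows "(kernel_term_del i has_derivative (\<lambda>h. cnj (h $ i) / complex_of_real (1 - (cmod (z $ i))\<^sup>2)
    + cnj (z $ i) * complex_of_real (2 * (z $ i \<bullet> h $ i)) / (complex_of_real (1 - (cmod (z $ i))\<^sup>2))\<^sup>2)) (at z)"
proof -
  have p: "complex_of_real (1 - (cmod (z $ i))\<^sup>2) \<noteq> 0"
    unfolding of_real_eq_0_iff using one_minus_norm_square_pos[OF z, of i] by simp
  have alg: "- c * (inverse q * - x * inverse q) + d / q = d / q + c * x / q\<^sup>2" for c d x q :: complex
    by (simp add: power2_eq_square divide_inverse mult_ac)
  have n: "((\<lambda>z. cnj (z $ i)) has_derivative (\<lambda>h. cnj (h $ i))) (at z)"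
    by (rule bounded_linear_imp_has_derivative[OF bounded_linear_compose[OF bounded_linear_cnj bounded_linear_vec_nth]])
  have d: "((\<lambda>z. complex_of_real (1 - (cmod (z $ i))\<^sup>2)) has_derivative (\<lambda>h. - complex_of_real (2 * (z $ i \<bullet> h $ i)))) (at z)"
    by (rule has_derivative_eq_rhs[OF has_derivative_of_real[OF has_derivative_diff[OF has_derivative_const
        norm_square_component_has_derivative]]]) simp
  show ?thesis
    unfolding kernel_term_del_def
    by (rule has_derivative_eq_rhs[OF has_derivative_divide[OF n d p]], rule ext, rule alg)
qed

lemma C1_on_kernel_term: "C1_on polydisk (kernel_term i)"
proof (rule C1_onI[OF kernel_term_has_derivative])
  fix e :: "complex ^ 'a"
  show "continuous_on polydisk (\<lambda>z. complex_of_real (2 * (z $ i \<bullet> e $ i) / (1 - (cmod (z $ i))\<^sup>2)))"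
    by (intro continuous_intros ballI) (auto dest: one_minus_norm_square_pos[of _ i])
qed

lemma C1_on_kernel_term_del: "C1_on polydisk (kernel_term_del i)"
proof (rule C1_onI[OF kernel_term_del_has_derivative])
  fix e :: "complex ^ 'a"
  have "complex_of_real (1 - (cmod (z $ i))\<^sup>2) \<noteq> 0" if "z \<in> polydisk" for z :: "complex ^ 'a"
    unfolding of_real_eq_0_iff using one_minus_norm_square_pos[OF that, of i] by simp
  then show "continuous_on polydisk (\<lambda>z. cnj (e $ i) / complex_of_real (1 - (cmod (z $ i))\<^sup>2)
    + cnj (z $ i) * complex_of_real (2 * (z $ i \<bullet> e $ i)) / (complex_of_real (1 - (cmod (z $ i))\<^sup>2))\<^sup>2)"
    by (intro continuous_intros ballI) auto
qed

lemma wirtinger_kernel_term: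
  assumes z: "z \<in> polydisk"
  shows "wirtinger j (kernel_term i) z = (if i = j then kernel_term_del i z else 0)"
proof -
  have "frechet_derivative (kernel_term i) (at z) = (\<lambda>h. complex_of_real (2 * (z $ i \<bullet> h $ i) / (1 - (cmod (z $ i))\<^sup>2)))"
    using frechet_derivative_at[OF kernel_term_has_derivative[OF z]] by simp
  moreover have alg: "(complex_of_real (2 * x / q) - \<i> * complex_of_real (2 * y / q)) / 2
      = (complex_of_real x - \<i> * complex_of_real y) / complex_of_real q" for x y q
    by (cases "q = 0") (auto simp: field_simps)
  ultimately have "wirtinger j (kernel_term i) z
    = (complex_of_real (2 * (z $ i \<bullet> axis j 1 $ i) / (1 - (cmod (z $ i))\<^sup>2))
       - \<i> * complex_of_real (2 * (z $ i \<bullet> axis j \<i> $ i) / (1 - (cmod (z $ i))\<^sup>2))) / 2"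
    by (simp only: wirtinger_def)
  also have "\<dots> = (complex_of_real (z $ i \<bullet> axis j 1 $ i) - \<i> * complex_of_real (z $ i \<bullet> axis j \<i> $ i))
      / complex_of_real (1 - (cmod (z $ i))\<^sup>2)"
    by (rule alg)
  also have "complex_of_real (z $ i \<bullet> axis j 1 $ i) - \<i> * complex_of_real (z $ i \<bullet> axis j \<i> $ i)
      = (if i = j then cnj (z $ i) else 0)"
    by (simp add: axis_def inner_complex_def complex_eq_iff)
  finally show ?thesis by (simp add: kernel_term_del_def)
qed

lemma wirtinger_bar_kernel_term_del:
  assumes z: "z \<in> polydisk"
  shows "wirtinger_bar k (kernel_term_del i) z = (if i = k then complex_of_real (1 / (1 - (cmod (z $ i))\<^sup>2)\<^sup>2) else 0)"
proof -
  define p where "p = complex_of_real (1 - (cmod (z $ i))\<^sup>2)"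
  have p: "p \<noteq> 0"
    unfolding p_def of_real_eq_0_iff using one_minus_norm_square_pos[OF z, of i] by simp
  have fd: "frechet_derivative (kernel_term_del i) (at z) = (\<lambda>h. cnj (h $ i) / p
    + cnj (z $ i) * complex_of_real (2 * (z $ i \<bullet> h $ i)) / p\<^sup>2)"
    unfolding p_def using frechet_derivative_at[OF kernel_term_del_has_derivative[OF z]] by simp
  show ?thesis
  proof (cases "i = k")
    case True
    have "wirtinger_bar k (kernel_term_del i) z
       = (1 / p + cnj (z $ i) * complex_of_real (2 * Re (z $ i)) / p\<^sup>2
          + \<i> * (- \<i> / p + cnj (z $ i) * complex_of_real (2 * Im (z $ i)) / p\<^sup>2)) / 2"
      unfolding wirtinger_bar_def fd using True by (simp add: axis_def inner_complex_def)
    also have "\<dots> = 1 / p + cnj (z $ i) * (complex_of_real (Re (z $ i)) + \<i> * complex_of_real (Im (z $ i))) / p\<^sup>2"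
      using p by (simp add: field_simps power2_eq_square)
    also have "complex_of_real (Re (z $ i)) + \<i> * complex_of_real (Im (z $ i)) = z $ i"
      by (simp add: complex_eq_iff)
    also have "1 / p + cnj (z $ i) * (z $ i) / p\<^sup>2 = (p + (z $ i) * cnj (z $ i)) / p\<^sup>2"
      using p by (simp add: field_simps power2_eq_square)
    \<comment> \<open>This cancellation is what leaves exactly the hyperbolic density of
      \<open>omega_form\<close>.\<close>
    also have "p + (z $ i) * cnj (z $ i) = 1"
      by (simp add: p_def flip: complex_norm_square)
    finally show ?thesis using True by (simp add: p_def)
  next
    case False
    then show ?thesis by (simp add: wirtinger_bar_def fd axis_def)
  qed
qed

lemma C1_on_wirtinger_bar:
  assumes "C2_on polydisk g"
  shows "C1_on polydisk (wirtinger_bar k g)"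
proof -
  have "wirtinger_bar k g = (\<lambda>z. 1 / 2 * frechet_derivative g (at z) (axis k 1) + \<i> / 2 * frechet_derivative g (at z) (axis k \<i>))"
    by (simp add: wirtinger_bar_def fun_eq_iff add_divide_distrib)
  then show ?thesis
    by (simp only:) (intro C1_on_linear_combination C2_on_imp_C1_on(2) open_polydisk assms)
qed

lemma wirtinger_bar_eq_0_outside:
  assumes "closed S" "\<And>z. z \<in> polydisk - S \<Longrightarrow> g z = 0" "z \<in> polydisk - S"
  shows "wirtinger_bar k g z = 0" "wirtinger k g z = 0"
  using C1_on_frechet_derivative_eq_0[OF open_polydisk assms]
  by (simp_all add: wirtinger_bar_def wirtinger_def)

lemma continuous_on_wirtinger:
  assumes "C1_on U v"
  shows "continuous_on U (wirtinger j v)"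
  using assms unfolding wirtinger_def C1_on_def by (intro continuous_intros) auto

text \<open>Two integrations by parts put both derivatives on the kernel term, without boundary
  terms because \<open>g\<close> has compact support. The kernel term depends on the single
  coordinate \<open>z $ i\<close>, so all other second derivatives vanish.\<close>

lemma integral_kernel_term_ddbar:
  fixes g :: "complex ^ 'n::finite \<Rightarrow> complex"
  assumes g: "C2_on polydisk g" and S: "compact S" "S \<subseteq> polydisk" "\<And>z. z \<in> polydisk - S \<Longrightarrow> g z = 0"
  shows "(LINT z:polydisk|lborel. kernel_term i z * wirtinger j (wirtinger_bar k g) z)
    = (if i = j \<and> i = k then (LINT z:polydisk|lborel. complex_of_real (1 / (1 - (cmod (z $ i))\<^sup>2)\<^sup>2) * g z) else 0)"
proof -
  have cS: "closed S" using S(1) by (rule compact_imp_closed)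
  have pm[measurable]: "(polydisk :: (complex ^ 'n) set) \<in> sets borel" using open_polydisk by (rule borel_open)
  have "(LINT z:polydisk|lborel. kernel_term i z * wirtinger j (wirtinger_bar k g) z)
    = - (LINT z:polydisk|lborel. wirtinger j (kernel_term i) z * wirtinger_bar k g z)"
    by (rule integral_by_parts_wirtinger(1)[OF open_polydisk S(1,2) C1_on_kernel_term C1_on_wirtinger_bar[OF g]
        wirtinger_bar_eq_0_outside(1)[OF cS S(3)]])
  also have "\<dots> = (if i = j then - (LINT z:polydisk|lborel. kernel_term_del i z * wirtinger_bar k g z) else 0)"
  proof -
    have "(LINT z:polydisk|lborel. wirtinger j (kernel_term i) z * wirtinger_bar k g z)
      = (LINT z:polydisk|lborel. (if i = j then kernel_term_del i z else 0) * wirtinger_bar k g z)"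
      by (intro set_lebesgue_integral_cong) (auto simp: wirtinger_kernel_term)
    then show ?thesis by (simp add: set_lebesgue_integral_def)
  qed
  also have "(LINT z:polydisk|lborel. kernel_term_del i z * wirtinger_bar k g z)
    = - (LINT z:polydisk|lborel. wirtinger_bar k (kernel_term_del i) z * g z)"
    by (rule integral_by_parts_wirtinger(2)[OF open_polydisk S(1,2) C1_on_kernel_term_del C2_on_imp_C1_on(1)[OF open_polydisk g] S(3)])
  also have "(LINT z:polydisk|lborel. wirtinger_bar k (kernel_term_del i) z * g z)
    = (LINT z:polydisk|lborel. (if i = k then complex_of_real (1 / (1 - (cmod (z $ i))\<^sup>2)\<^sup>2) else 0) * g z)"
    by (intro set_lebesgue_integral_cong) (auto simp: wirtinger_bar_kernel_term_del)
  finally show ?thesis by (auto simp: set_lebesgue_integral_def)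
qed

section \<open>Signs in top degree\<close>

lemma shuffle_sign_square: "shuffle_sign A B * shuffle_sign A B = 1"
  by (simp add: shuffle_sign_def flip: power_mult_distrib)

text \<open>The sign with which the mixed derivative of the coefficient lacking \<open>j\<close> and
  \<open>k\<close> enters the top coefficient of \<open>del (delbar \<phi>)\<close>. Only the
  diagonal survives the pairing with \<open>log_kernel\<close>, and there the two shuffle signs
  cancel.\<close>

definition ddbar_coeff :: "'n::{finite,linorder} \<Rightarrow> 'n \<Rightarrow> complex" where
  "ddbar_coeff j k = shuffle_sign {j} (UNIV - {j}) * ((- 1) ^ (CARD('n) - 1) * shuffle_sign {k} (UNIV - {k}))"

lemma ddbar_coeff_diag:
  fixes i :: "'n::{finite,linorder}"
  shows "ddbar_coeff i i = (- 1) ^ (CARD('n) - 1)"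
  using shuffle_sign_square[of "{i}" "UNIV - {i}"] by (simp add: ddbar_coeff_def)

lemma del_delbar_eq:
  fixes \<phi> :: "'n::{finite,linorder} dform"
  assumes \<phi>: "\<And>J K. C2_on polydisk (\<lambda>z. \<phi> z J K)" and z: "z \<in> polydisk"
  shows "del (delbar \<phi>) z UNIV UNIV = (\<Sum>j\<in>UNIV. \<Sum>k\<in>UNIV. ddbar_coeff j k
    * wirtinger j (wirtinger_bar k (\<lambda>w. \<phi> w (UNIV - {j}) (UNIV - {k}))) z)"
proof -
  have "wirtinger j (\<lambda>w. delbar \<phi> w (UNIV - {j}) UNIV) z
    = (\<Sum>k\<in>UNIV. ((- 1) ^ (CARD('n) - 1) * shuffle_sign {k} (UNIV - {k}))
       * wirtinger j (wirtinger_bar k (\<lambda>w. \<phi> w (UNIV - {j}) (UNIV - {k}))) z)" for j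
  proof -
    have "card (UNIV - {j}) = CARD('n) - 1" by (simp add: card_Diff_singleton)
    then have "delbar \<phi> w (UNIV - {j}) UNIV = (\<Sum>k\<in>UNIV. ((- 1) ^ (CARD('n) - 1) * shuffle_sign {k} (UNIV - {k}))
       * wirtinger_bar k (\<lambda>w. \<phi> w (UNIV - {j}) (UNIV - {k})) w)" for w
      by (simp only: delbar_def)
    then show ?thesis
      using wirtinger_sum[of UNIV polydisk "\<lambda>k. wirtinger_bar k (\<lambda>w. \<phi> w (UNIV - {j}) (UNIV - {k}))" z j
          "\<lambda>k. (- 1) ^ (CARD('n) - 1) * shuffle_sign {k} (UNIV - {k})"] C1_on_wirtinger_bar[OF \<phi>] z
      by (simp only: finite_class.finite simp_thms)
  qed
  then show ?thesis
    by (simp add: del_def ddbar_coeff_def sum_distrib_left mult.assoc)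
qed

text \<open>Only splittings whose second part is \<open>{i}\<close> on both sides meet
  \<open>omega_form\<close>. The two shuffle signs coincide and cancel, and the sign that remains is
  the one in \<open>ddbar_coeff_diag\<close>.\<close>

lemma wedge_omega_form_UNIV:
  fixes \<phi> :: "'n::{finite,linorder} dform"
  shows "wedge \<phi> (omega_form L) z UNIV UNIV = (\<Sum>i\<in>UNIV. (- 1) ^ (CARD('n) - 1) * \<phi> z (UNIV - {i}) (UNIV - {i})
    * (complex_of_real (L $ i / (1 - (cmod (z $ i))\<^sup>2)\<^sup>2) * (\<i> / (2 * complex_of_real pi))))"
proof -
  let ?x = "\<lambda>i. complex_of_real (L $ i / (1 - (cmod (z $ i))\<^sup>2)\<^sup>2) * (\<i> / (2 * complex_of_real pi))"
  let ?c = "\<lambda>J K. (- 1) ^ (card K * card (UNIV - J)) * shuffle_sign J (UNIV - J) * shuffle_sign K (UNIV - K) * \<phi> z J K"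
  have "wedge \<phi> (omega_form L) z UNIV UNIV
    = (\<Sum>J\<in>UNIV. \<Sum>K\<in>UNIV. \<Sum>i\<in>UNIV. if J = UNIV - {i} then (if K = UNIV - {i} then ?c J K * ?x i else 0) else 0)"
    unfolding wedge_def omega_form_def Pow_UNIV sum_distrib_left
  proof (intro sum.cong refl)
    fix J K :: "'n set" and i :: 'n
    have "UNIV - J = {i} \<longleftrightarrow> J = UNIV - {i}" "UNIV - K = {i} \<longleftrightarrow> K = UNIV - {i}" by auto
    then show "?c J K * (if UNIV - J = {i} \<and> UNIV - K = {i} then ?x i else 0)
      = (if J = UNIV - {i} then (if K = UNIV - {i} then ?c J K * ?x i else 0) else 0)" by simp
  qed
  also have "\<dots> = (\<Sum>J\<in>UNIV. \<Sum>i\<in>UNIV. \<Sum>K\<in>UNIV. if J = UNIV - {i} then (if K = UNIV - {i} then ?c J K * ?x i else 0) else 0)"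
    by (rule sum.cong[OF refl], rule sum.swap)
  also have "\<dots> = (\<Sum>i\<in>UNIV. \<Sum>J\<in>UNIV. \<Sum>K\<in>UNIV. if J = UNIV - {i} then (if K = UNIV - {i} then ?c J K * ?x i else 0) else 0)"
    by (rule sum.swap)
  also have "\<dots> = (\<Sum>i\<in>UNIV. ?c (UNIV - {i}) (UNIV - {i}) * ?x i)"
  proof (rule sum.cong[OF refl])
    fix i :: 'n
    have "(\<Sum>K\<in>UNIV. if J = UNIV - {i} then (if K = UNIV - {i} then ?c J K * ?x i else 0) else 0)
      = (if J = UNIV - {i} then ?c J (UNIV - {i}) * ?x i else 0)" for J
    proof (cases "J = UNIV - {i}")
      case True
      show ?thesis
        by (simp only: True refl if_True sum.delta finite_class.finite UNIV_I)
    next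
      case False
      show ?thesis by (simp only: False if_False sum.neutral_const)
    qed
    then show "(\<Sum>J\<in>UNIV. \<Sum>K\<in>UNIV. if J = UNIV - {i} then (if K = UNIV - {i} then ?c J K * ?x i else 0) else 0)
      = ?c (UNIV - {i}) (UNIV - {i}) * ?x i"
      by (simp only: sum.delta finite_class.finite UNIV_I if_True)
  qed
  also have "\<dots> = (\<Sum>i\<in>UNIV. (- 1) ^ (CARD('n) - 1) * \<phi> z (UNIV - {i}) (UNIV - {i}) * ?x i)"
  proof (rule sum.cong[OF refl])
    fix i :: 'n
    have "UNIV - (UNIV - {i}) = {i}" by auto
    then show "?c (UNIV - {i}) (UNIV - {i}) * ?x i = (- 1) ^ (CARD('n) - 1) * \<phi> z (UNIV - {i}) (UNIV - {i}) * ?x i"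
      using shuffle_sign_square[of "UNIV - {i}" "{i}"] by (simp add: card_Diff_singleton mult.assoc[symmetric])
  qed
  finally show ?thesis .
qed

lemma set_integral_sum:
  fixes f :: "'i \<Rightarrow> 'a \<Rightarrow> complex"
  assumes "finite I" "\<And>i. i \<in> I \<Longrightarrow> set_integrable M A (f i)"
  shows "(LINT x:A|M. \<Sum>i\<in>I. f i x) = (\<Sum>i\<in>I. LINT x:A|M. f i x)"
  using assms unfolding set_lebesgue_integral_def set_integrable_def scaleR_sum_right
  by (intro Bochner_Integration.integral_sum)

lemma set_integrable_sum:
  fixes f :: "'i \<Rightarrow> 'a \<Rightarrow> complex"
  assumes "\<And>i. i \<in> I \<Longrightarrow> set_integrable M A (f i)"
  shows "set_integrable M A (\<lambda>x. \<Sum>i\<in>I. f i x)"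
  using assms unfolding set_integrable_def scaleR_sum_right
  by (intro Bochner_Integration.integrable_sum)

lemma continuous_on_del_delbar:
  fixes \<phi> :: "'n::{finite,linorder} dform"
  assumes \<phi>: "\<And>J K. C2_on polydisk (\<lambda>z. \<phi> z J K)"
  shows "continuous_on polydisk (\<lambda>z. del (delbar \<phi>) z UNIV UNIV)"
  by (subst continuous_on_cong[OF refl del_delbar_eq[OF \<phi>]])
     (auto intro!: continuous_intros continuous_on_wirtinger C1_on_wirtinger_bar \<phi>)

lemma del_delbar_eq_0:
  fixes \<phi> :: "'n::{finite,linorder} dform"
  assumes \<phi>: "\<And>J K. C2_on polydisk (\<lambda>z. \<phi> z J K)"
    and S: "closed S" "\<And>z J K. z \<in> polydisk - S \<Longrightarrow> \<phi> z J K = 0" and z: "z \<in> polydisk - S"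
  shows "del (delbar \<phi>) z UNIV UNIV = 0"
proof -
  have "wirtinger j (wirtinger_bar k (\<lambda>w. \<phi> w (UNIV - {j}) (UNIV - {k}))) z = 0" for j k
    by (rule wirtinger_bar_eq_0_outside(2)[OF S(1) wirtinger_bar_eq_0_outside(1)[OF S(1) S(2)] z])
  then show ?thesis using z by (simp add: del_delbar_eq[OF \<phi>])
qed

lemma of_real_log_kernel: "complex_of_real (log_kernel L z) = (\<Sum>i\<in>UNIV. complex_of_real (L $ i) * kernel_term i z)"
  by (simp add: log_kernel_def kernel_term_def)

text \<open>Both quantities reduce to the same combination of the integrals \<open>J i\<close> of
  diagonal coefficients against hyperbolic densities, because the signs agree and the other
  derivatives integrate to 0. Linearity in \<open>L\<close> will turn positivity at the unit vectors
  into a lower bound proportional to the sum of the \<open>L $ j\<close>.\<close>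

lemma mean_form_integral_representation:
  fixes \<phi> :: "'n::{finite,linorder} dform"
  assumes "\<phi> \<in> test_forms (CARD('n) - 1) (CARD('n) - 1)"
  shows "mean_form_integral L \<phi> = (\<Sum>i\<in>UNIV. L $ i * mean_form_integral (axis i 1) \<phi>)"
    and "ddbar_pairing (log_kernel L) \<phi> = mean_form_integral L \<phi>"
proof -
  obtain S where \<phi>: "\<And>J K. C2_on polydisk (\<lambda>z. \<phi> z J K)" and S: "compact S" "S \<subseteq> polydisk"
    and S0: "\<And>z J K. z \<in> polydisk - S \<Longrightarrow> \<phi> z J K = 0"
    using assms unfolding test_forms_def by blast
  let ?cc = "\<i> / (2 * complex_of_real pi)"
  let ?C = "(- 1) ^ (CARD('n) * (CARD('n) - 1) div 2) * (- 2 * \<i>) ^ CARD('n) :: complex"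
  let ?\<phi> = "\<lambda>j k w. \<phi> w (UNIV - {j}) (UNIV - {k})"
  define J where "J = (\<lambda>i. LINT z:polydisk|lborel. complex_of_real (1 / (1 - (cmod (z $ i))\<^sup>2)\<^sup>2) * ?\<phi> i i z)"
  define q where "q = (\<lambda>i. Re (?C * ((- 1) ^ (CARD('n) - 1) * ?cc * J i)))"
  have closedS: "closed S" using S(1) by (rule compact_imp_closed)
  have pm[measurable]: "(polydisk :: ((complex, 'n) vec) set) \<in> sets borel" using open_polydisk by (rule borel_open)
  have iJ: "set_integrable lborel polydisk (\<lambda>z. complex_of_real (1 / (1 - (cmod (z $ i))\<^sup>2)\<^sup>2) * ?\<phi> i i z)" for i
  proof (rule set_integrable_compact_support[OF _ S])
    have "1 - (cmod (z $ i))\<^sup>2 \<noteq> 0" if "z \<in> polydisk" for z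
      using one_minus_norm_square_pos[OF that, of i] by simp
    then have "continuous_on polydisk (\<lambda>z. 1 / (1 - (cmod (z $ i))\<^sup>2)\<^sup>2)"
      by (intro continuous_intros ballI) auto
    then show "continuous_on polydisk (\<lambda>z. complex_of_real (1 / (1 - (cmod (z $ i))\<^sup>2)\<^sup>2) * ?\<phi> i i z)"
      using C1_on_continuous_on[OF C2_on_imp_C1_on(1)[OF open_polydisk \<phi>]]
      by (intro continuous_on_mult continuous_on_of_real) auto
  qed (use S0 in auto)
  have mean: "mean_form_integral L \<phi> = (\<Sum>i\<in>UNIV. L $ i * q i)" for L
  proof -
    have "(LINT z:polydisk|lborel. wedge \<phi> (omega_form L) z UNIV UNIV)
       = (LINT z:polydisk|lborel. \<Sum>i\<in>UNIV. (complex_of_real (L $ i) * ((- 1) ^ (CARD('n) - 1) * ?cc))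
           * (complex_of_real (1 / (1 - (cmod (z $ i))\<^sup>2)\<^sup>2) * ?\<phi> i i z))"
      by (intro set_lebesgue_integral_cong allI impI) (auto simp: wedge_omega_form_UNIV mult_ac intro!: sum.cong)
    also have "\<dots> = (\<Sum>i\<in>UNIV. (complex_of_real (L $ i) * ((- 1) ^ (CARD('n) - 1) * ?cc)) * J i)"
    proof -
      have i1: "set_integrable lborel polydisk (\<lambda>z. (complex_of_real (L $ i) * ((- 1) ^ (CARD('n) - 1) * ?cc))
           * (complex_of_real (1 / (1 - (cmod (z $ i))\<^sup>2)\<^sup>2) * ?\<phi> i i z))" for i
        by (intro set_integrable_mult_right iJ)
      show ?thesis
        by (simp only: J_def set_integral_sum[OF finite_class.finite i1] set_integral_mult_right)
    qed
    finally have "form_integral (wedge \<phi> (omega_form L))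
        = (\<Sum>i\<in>UNIV. complex_of_real (L $ i) * (?C * ((- 1) ^ (CARD('n) - 1) * ?cc * J i)))"
      by (simp add: form_integral_def sum_distrib_left mult_ac)
    then show ?thesis
      unfolding mean_form_integral_def q_def by (simp only: Re_sum Re_complex_of_real times_complex.sel Im_complex_of_real) simp
  qed
  have pair: "ddbar_pairing (log_kernel L) \<phi> = (\<Sum>i\<in>UNIV. L $ i * q i)"
  proof -
    let ?W = "\<lambda>j k. wirtinger j (wirtinger_bar k (?\<phi> j k))"
    let ?I = "\<lambda>i j k. LINT z:polydisk|lborel. kernel_term i z * ?W j k z"
    have int: "set_integrable lborel polydisk (\<lambda>z. kernel_term i z * ?W j k z)" for i j k
    proof (rule set_integrable_compact_support[OF _ S])
      show "continuous_on polydisk (\<lambda>z. kernel_term i z * ?W j k z)"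
        by (intro continuous_on_mult C1_on_continuous_on C1_on_kernel_term continuous_on_wirtinger C1_on_wirtinger_bar \<phi>)
      show "kernel_term i z * ?W j k z = 0" if "z \<in> polydisk - S" for z
        using wirtinger_bar_eq_0_outside(2)[OF closedS wirtinger_bar_eq_0_outside(1)[OF closedS S0] that] by simp
    qed
    have I: "?I i j k = (if i = j \<and> i = k then J i else 0)" for i j k
      using integral_kernel_term_ddbar[OF \<phi> S S0, of i j k] unfolding J_def by auto
    have "(LINT z:polydisk|lborel. complex_of_real (log_kernel L z) * (?cc * del (delbar \<phi>) z UNIV UNIV))
      = (LINT z:polydisk|lborel. \<Sum>i\<in>UNIV. \<Sum>j\<in>UNIV. \<Sum>k\<in>UNIV.
           (complex_of_real (L $ i) * ?cc * ddbar_coeff j k) * (kernel_term i z * ?W j k z))"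
    proof (intro set_lebesgue_integral_cong allI impI)
      fix z :: "(complex, 'n) vec" assume z: "z \<in> polydisk"
      show "complex_of_real (log_kernel L z) * (?cc * del (delbar \<phi>) z UNIV UNIV)
        = (\<Sum>i\<in>UNIV. \<Sum>j\<in>UNIV. \<Sum>k\<in>UNIV. (complex_of_real (L $ i) * ?cc * ddbar_coeff j k) * (kernel_term i z * ?W j k z))"
        unfolding of_real_log_kernel del_delbar_eq[OF \<phi> z] sum_distrib_right
        by (rule sum.cong[OF refl], unfold sum_distrib_left, intro sum.cong refl) (simp only: mult_ac)
    qed simp
    also have "\<dots> = (\<Sum>i\<in>UNIV. \<Sum>j\<in>UNIV. \<Sum>k\<in>UNIV. (complex_of_real (L $ i) * ?cc * ddbar_coeff j k) * ?I i j k)"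
    proof -
      have i3: "set_integrable lborel polydisk (\<lambda>z. (complex_of_real (L $ i) * ?cc * ddbar_coeff j k) * (kernel_term i z * ?W j k z))" for i j k
        by (intro set_integrable_mult_right int)
      have i2: "set_integrable lborel polydisk (\<lambda>z. \<Sum>k\<in>UNIV. (complex_of_real (L $ i) * ?cc * ddbar_coeff j k) * (kernel_term i z * ?W j k z))" for i j
        by (rule set_integrable_sum) (rule i3)
      have i1: "set_integrable lborel polydisk (\<lambda>z. \<Sum>j\<in>UNIV. \<Sum>k\<in>UNIV. (complex_of_real (L $ i) * ?cc * ddbar_coeff j k) * (kernel_term i z * ?W j k z))" for i
        by (rule set_integrable_sum) (rule i2)
      show ?thesis
        by (simp only: set_integral_sum[OF finite_class.finite i1] set_integral_sum[OF finite_class.finite i2]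
            set_integral_sum[OF finite_class.finite i3] set_integral_mult_right)
    qed
    also have "\<dots> = (\<Sum>i\<in>UNIV. \<Sum>j\<in>UNIV. \<Sum>k\<in>UNIV. if k = i then (if j = i then (complex_of_real (L $ i) * ?cc * ddbar_coeff j k) * J i else 0) else 0)"
      unfolding I by (intro sum.cong refl) auto
    also have "\<dots> = (\<Sum>i\<in>UNIV. (complex_of_real (L $ i) * ?cc * ddbar_coeff i i) * J i)"
      by (simp add: sum.delta)
    finally have "?C * (LINT z:polydisk|lborel. complex_of_real (log_kernel L z) * (?cc * del (delbar \<phi>) z UNIV UNIV))
      = (\<Sum>i\<in>UNIV. complex_of_real (L $ i) * (?C * ((- 1) ^ (CARD('n) - 1) * ?cc * J i)))"
      unfolding ddbar_coeff_diag by (simp add: sum_distrib_left mult_ac)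
    then show ?thesis
      unfolding ddbar_pairing_def form_integral_def q_def
      by (simp only: Re_sum Re_complex_of_real times_complex.sel Im_complex_of_real) simp
  qed
  have "mean_form_integral (axis i 1) \<phi> = q i" for i
    unfolding mean by (simp add: axis_def if_distrib[of "\<lambda>x. x * _"] cong: if_cong)
  then show "mean_form_integral L \<phi> = (\<Sum>i\<in>UNIV. L $ i * mean_form_integral (axis i 1) \<phi>)"
    by (simp add: mean)
  show "ddbar_pairing (log_kernel L) \<phi> = mean_form_integral L \<phi>"
    by (simp add: mean pair)
qed

section \<open>Averages over a closed polydisk\<close>

definition closed_polydisk :: "real \<Rightarrow> (complex ^ 'n::finite) set" where
  "closed_polydisk \<rho> = {z. \<forall>j. cmod (z $ j) \<le> \<rho>}"

lemma compact_closed_polydisk: "compact (closed_polydisk \<rho> :: (complex ^ 'n::finite) set)"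
proof -
  have "closed_polydisk \<rho> = (\<Inter>j. {z :: complex ^ 'n. cmod (z $ j) \<le> \<rho>})" by (auto simp: closed_polydisk_def)
  moreover have "closed (\<Inter>j. {z :: complex ^ 'n. cmod (z $ j) \<le> \<rho>})"
  proof (rule closed_INT)
    show "\<forall>j\<in>UNIV. closed {z :: complex ^ 'n. cmod (z $ j) \<le> \<rho>}"
      by (intro ballI closed_Collect_le) (auto intro!: continuous_intros)
  qed
  ultimately have "closed (closed_polydisk \<rho> :: (complex ^ 'n) set)" by simp
  moreover have "bounded (closed_polydisk \<rho> :: (complex ^ 'n) set)"
    unfolding bounded_iff
  proof (intro exI ballI)
    fix z :: "complex ^ 'n" assume "z \<in> closed_polydisk \<rho>"
    then have "(\<Sum>j\<in>UNIV. cmod (z $ j)) \<le> (\<Sum>j\<in>(UNIV::'n set). \<rho>)"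
      by (intro sum_mono) (auto simp: closed_polydisk_def)
    then show "norm z \<le> (\<Sum>j\<in>(UNIV::'n set). \<rho>)" unfolding norm_vec_def using L2_set_le_sum[of UNIV "\<lambda>j. cmod (z $ j)"] by auto
  qed
  ultimately show ?thesis by (simp add: compact_eq_bounded_closed)
qed

lemma sets_closed_polydisk[measurable]: "closed_polydisk \<rho> \<in> sets borel"
  by (rule borel_compact[OF compact_closed_polydisk])

lemma emeasure_closed_polydisk:
  assumes "\<rho> > 0"
  shows "emeasure lborel (closed_polydisk \<rho> :: (complex ^ 'n::finite) set) = ennreal (measure lborel (closed_polydisk \<rho> :: (complex ^ 'n) set))"
    and "measure lborel (closed_polydisk \<rho> :: (complex ^ 'n) set) > 0"
proof -
  let ?B = "closed_polydisk \<rho> :: (complex ^ 'n) set"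
  have fin: "emeasure lborel ?B < \<infinity>"
    using emeasure_compact_finite[OF compact_closed_polydisk] .
  then show e: "emeasure lborel ?B = ennreal (measure lborel ?B)"
    by (intro emeasure_eq_ennreal_measure) auto
  have "ball 0 \<rho> \<subseteq> ?B"
  proof
    fix z :: "complex ^ 'n" assume "z \<in> ball 0 \<rho>"
    then have "cmod (z $ j) \<le> \<rho>" for j using Finite_Cartesian_Product.norm_nth_le[of z j] by simp
    then show "z \<in> ?B" by (simp add: closed_polydisk_def)
  qed
  then have "emeasure lborel (ball (0 :: complex ^ 'n) \<rho>) \<le> emeasure lborel ?B"
    by (intro emeasure_mono) auto
  moreover have "emeasure lborel (ball (0 :: complex ^ 'n) \<rho>) > 0"
    using assms unit_ball_vol_pos[of "real DIM(complex ^ 'n)"] by (simp add: emeasure_ball del: DIM_cart)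
  ultimately have "emeasure lborel ?B > 0" by (rule less_le_trans[rotated])
  then show "measure lborel ?B > 0" unfolding e by simp
qed

definition uniform_polydisk :: "real \<Rightarrow> (complex ^ 'n::finite) measure" where
  "uniform_polydisk \<rho> = density lborel (\<lambda>z. ennreal (indicator (closed_polydisk \<rho>) z / measure lborel (closed_polydisk \<rho> :: (complex ^ 'n) set)))"

lemma sets_uniform_polydisk[simp, measurable_cong]: "sets (uniform_polydisk \<rho>) = sets borel"
  by (simp add: uniform_polydisk_def)

lemma space_uniform_polydisk[simp]: "space (uniform_polydisk \<rho>) = UNIV"
  by (simp add: uniform_polydisk_def)

lemma prob_space_uniform_polydisk:
  assumes "\<rho> > 0"
  shows "prob_space (uniform_polydisk \<rho> :: (complex ^ 'n::finite) measure)"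
proof
  let ?B = "closed_polydisk \<rho> :: (complex ^ 'n) set"
  note B = emeasure_closed_polydisk[OF assms, where 'n = 'n]
  have "emeasure (uniform_polydisk \<rho>) (space (uniform_polydisk \<rho> :: (complex ^ 'n) measure))
    = (\<integral>\<^sup>+z. ennreal (1 / measure lborel ?B) * indicator ?B z \<partial>lborel)"
    unfolding uniform_polydisk_def by (auto simp: emeasure_density intro!: nn_integral_cong split: split_indicator)
  also have "\<dots> = ennreal (1 / measure lborel ?B) * emeasure lborel ?B"
    by (rule nn_integral_cmult_indicator) simp
  also have "\<dots> = 1" using B by (simp flip: ennreal_mult)
  finally show "emeasure (uniform_polydisk \<rho>) (space (uniform_polydisk \<rho> :: (complex ^ 'n) measure)) = 1" .
qed

lemma integrable_uniform_polydisk: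
  fixes f :: "complex ^ 'n::finite \<Rightarrow> 'b::{banach, second_countable_topology}"
  assumes "\<rho> > 0" "f \<in> borel_measurable borel"
  shows "integrable (uniform_polydisk \<rho>) f \<longleftrightarrow> integrable lborel (\<lambda>z. indicator (closed_polydisk \<rho>) z *\<^sub>R f z)"
    and "(\<integral>z. f z \<partial>uniform_polydisk \<rho>) = (1 / measure lborel (closed_polydisk \<rho> :: (complex ^ 'n) set)) *\<^sub>R (\<integral>z. indicator (closed_polydisk \<rho>) z *\<^sub>R f z \<partial>lborel)"
proof -
  let ?c = "measure lborel (closed_polydisk \<rho> :: (complex ^ 'n) set)"
  note B = emeasure_closed_polydisk[OF assms(1), where 'n = 'n]
  have *: "(indicator (closed_polydisk \<rho>) z / ?c) *\<^sub>R f z = (1 / ?c) *\<^sub>R (indicator (closed_polydisk \<rho>) z *\<^sub>R f z)" for z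
    by simp
  have scale: "integrable lborel (\<lambda>z. (1 / ?c) *\<^sub>R h z) \<longleftrightarrow> integrable lborel h" for h :: "complex ^ 'n \<Rightarrow> 'b"
  proof
    assume "integrable lborel (\<lambda>z. (1 / ?c) *\<^sub>R h z)"
    then have "integrable lborel (\<lambda>z. ?c *\<^sub>R ((1 / ?c) *\<^sub>R h z))" by (rule integrable_scaleR_right)
    then show "integrable lborel h" using B by simp
  qed (rule integrable_scaleR_right)
  have "integrable (uniform_polydisk \<rho>) f \<longleftrightarrow> integrable lborel (\<lambda>z. (indicator (closed_polydisk \<rho>) z / ?c) *\<^sub>R f z)"
    unfolding uniform_polydisk_def using assms B by (intro integrable_density) auto
  then show "integrable (uniform_polydisk \<rho>) f \<longleftrightarrow> integrable lborel (\<lambda>z. indicator (closed_polydisk \<rho>) z *\<^sub>R f z)"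
    unfolding * scale .
  have "(\<integral>z. f z \<partial>uniform_polydisk \<rho>) = (\<integral>z. (indicator (closed_polydisk \<rho>) z / ?c) *\<^sub>R f z \<partial>lborel)"
    unfolding uniform_polydisk_def using assms B by (intro integral_density) auto
  then show "(\<integral>z. f z \<partial>uniform_polydisk \<rho>) = (1 / ?c) *\<^sub>R (\<integral>z. indicator (closed_polydisk \<rho>) z *\<^sub>R f z \<partial>lborel)"
    unfolding * by (simp only: integral_scaleR_right)
qed

lemma measurable_vec_nth_borel[measurable]: "(\<lambda>z :: complex ^ 'n::finite. z $ j) \<in> borel_measurable borel"
  by (intro borel_measurable_continuous_onI continuous_intros)

lemma rotate_by_linear: "linear (rotate_by m k)"
  by (rule linearI) (simp_all add: rotate_by_def vec_eq_iff algebra_simps)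

lemma norm_rotate_by: "norm (rotate_by m k z) = norm z"
  by (simp add: rotate_by_def norm_vec_def norm_mult)

lemma measurable_rotate_by[measurable]: "rotate_by m k \<in> borel_measurable borel"
  using rotate_by_linear[of m k] by (intro borel_measurable_continuous_onI) (simp add: linear_continuous_on linear_linear)

text \<open>Coordinate rotations are linear isometries preserving the polydisk, so the similarity
  formula applies with factor 1.\<close>

lemma distr_rotate_by_uniform_polydisk:
  "distr (uniform_polydisk \<rho>) (uniform_polydisk \<rho>) (rotate_by m k) = (uniform_polydisk \<rho> :: (complex ^ 'n::finite) measure)"
proof (rule measure_eqI)
  fix A assume "A \<in> sets (distr (uniform_polydisk \<rho>) (uniform_polydisk \<rho>) (rotate_by m k :: complex ^ 'n \<Rightarrow> _))"
  then have [measurable]: "A \<in> sets borel" by simp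
  let ?B = "closed_polydisk \<rho> :: (complex ^ 'n) set"
  let ?g = "\<lambda>z. ennreal (indicator ?B z / measure lborel ?B) * indicator A z"
  have rB: "rotate_by m k z \<in> ?B \<longleftrightarrow> z \<in> ?B" for z
    by (simp add: closed_polydisk_def rotate_by_def norm_mult)
  have [measurable]: "rotate_by m k -` A \<in> sets borel"
    using measurable_sets[OF measurable_rotate_by \<open>A \<in> sets borel\<close>, of m k] by simp
  have "emeasure (distr (uniform_polydisk \<rho>) (uniform_polydisk \<rho>) (rotate_by m k)) A
     = emeasure (uniform_polydisk \<rho>) (rotate_by m k -` A)"
    by (subst emeasure_distr) simp_all
  also have "\<dots> = (\<integral>\<^sup>+z. ?g (rotate_by m k z) \<partial>lborel)"
    unfolding uniform_polydisk_def
    by (subst emeasure_density) (auto intro!: nn_integral_cong simp: rB indicator_def)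
  also have "\<dots> = (\<integral>\<^sup>+z. ?g z \<partial>lborel)"
    using nn_integral_lborel_similarity[OF rotate_by_linear zero_less_one, of m k ?g] by (simp add: norm_rotate_by)
  also have "\<dots> = emeasure (uniform_polydisk \<rho>) A"
    unfolding uniform_polydisk_def by (subst emeasure_density) auto
  finally show "emeasure (distr (uniform_polydisk \<rho>) (uniform_polydisk \<rho>) (rotate_by m k)) A = emeasure (uniform_polydisk \<rho>) A" .
qed simp

lemma norm_component_ge_inner_axis: "\<bar>z \<bullet> axis j (1::complex)\<bar> \<le> cmod (z $ j)"
  by (simp add: inner_axis inner_complex_def abs_Re_le_cmod)

lemma closed_polydisk_subset_cbox:
  assumes "\<rho> \<le> 1"
  shows "closed_polydisk \<rho> \<subseteq> (cbox (- One) One :: (complex ^ 'n::finite) set)"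
proof
  fix z :: "complex ^ 'n" assume z: "z \<in> closed_polydisk \<rho>"
  have "\<bar>z \<bullet> b\<bar> \<le> 1" if Basis: "b \<in> Basis" for b
  proof -
    obtain j u where b: "b = axis j u" "u \<in> (Basis :: complex set)" using Basis unfolding Basis_vec_def by blast
    have "\<bar>z \<bullet> b\<bar> \<le> norm (z $ j)" unfolding b inner_axis using b(2) by (rule Basis_le_norm)
    also have "\<dots> \<le> 1" using z assms by (auto simp: closed_polydisk_def intro: order_trans)
    finally show ?thesis .
  qed
  then show "z \<in> cbox (- One) One" by (auto simp: mem_box abs_le_iff inner_minus_left)
qed

text \<open>For \<open>0 < r \<le> 1\<close> the absolute value of \<open>ln (r\<^sup>2)\<close> is
  \<open>4 * ln (1 / sqrt r)\<close>, hence at most \<open>4 / sqrt r\<close>, and the inverse root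
  of one real coordinate is integrable over a box.\<close>

lemma integrable_log_component:
  fixes j :: "'n::finite"
  assumes \<rho>: "0 < \<rho>" "\<rho> \<le> 1"
  shows "integrable (uniform_polydisk \<rho>) (\<lambda>z. ln ((cmod (z $ j))\<^sup>2))"
    and "AE z in uniform_polydisk \<rho>. z \<in> closed_polydisk \<rho> \<and> z $ j \<noteq> 0"
proof -
  let ?B = "closed_polydisk \<rho> :: (complex ^ 'n) set"
  let ?i = "\<lambda>z :: complex ^ 'n. inverse (ennreal (sqrt \<bar>z \<bullet> axis j 1\<bar>)) * indicator (cbox (- One) One) z"
  have ax: "axis j (1::complex) \<in> Basis" by (simp add: axis_in_Basis_iff Basis_complex_def)
  have fin: "(\<integral>\<^sup>+z. ?i z \<partial>lborel) < \<infinity>" by (rule nn_integral_inverse_sqrt_cbox[OF ax])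
  have le: "ennreal (norm (indicator ?B z *\<^sub>R ln ((cmod (z $ j))\<^sup>2))) \<le> 4 * ?i z" for z
  proof (cases "z \<in> ?B \<and> z $ j \<noteq> 0")
    case True
    define r where "r = cmod (z $ j)"
    have r: "0 < r" "r \<le> 1" using True \<rho> by (auto simp: r_def closed_polydisk_def intro: order_trans)
    have "ln (1 / sqrt r) \<le> 1 / sqrt r - 1" using r by (intro ln_le_minus_one) simp
    moreover have "ln (r\<^sup>2) = - 4 * ln (1 / sqrt r)"
      using r by (simp add: ln_div ln_sqrt ln_realpow)
    moreover have "ln (r\<^sup>2) \<le> 0" using r by (simp add: ln_realpow)
    ultimately have "\<bar>ln (r\<^sup>2)\<bar> \<le> 4 * (1 / sqrt r)" by simp
    then have "ennreal \<bar>ln (r\<^sup>2)\<bar> \<le> ennreal (4 * (1 / sqrt r))" by (rule ennreal_leI)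
    also have "\<dots> = 4 * inverse (ennreal (sqrt r))" using r by (subst ennreal_mult) (simp_all add: inverse_ennreal inverse_eq_divide)
    also have "\<dots> \<le> 4 * inverse (ennreal (sqrt \<bar>z \<bullet> axis j 1\<bar>))"
      using norm_component_ge_inner_axis[of z j]
      by (intro mult_left_mono inverse_ennreal_antimono ennreal_leI) (auto simp: r_def)
    finally show ?thesis using True closed_polydisk_subset_cbox[OF \<rho>(2), where 'n = 'n] by (auto simp: r_def indicator_def)
  qed (auto simp: indicator_def)
  have "integrable lborel (\<lambda>z. indicator ?B z *\<^sub>R ln ((cmod (z $ j))\<^sup>2))"
  proof (rule integrableI_bounded)
    have "(\<integral>\<^sup>+z. ennreal (norm (indicator ?B z *\<^sub>R ln ((cmod (z $ j))\<^sup>2))) \<partial>lborel) \<le> (\<integral>\<^sup>+z. 4 * ?i z \<partial>lborel)"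
      by (intro nn_integral_mono le)
    also have "\<dots> = 4 * (\<integral>\<^sup>+z. ?i z \<partial>lborel)" by (rule nn_integral_cmult) measurable
    also have "\<dots> < \<infinity>" using fin by (simp add: ennreal_mult_less_top)
    finally show "(\<integral>\<^sup>+z. ennreal (norm (indicator ?B z *\<^sub>R ln ((cmod (z $ j))\<^sup>2))) \<partial>lborel) < \<infinity>" .
  qed measurable
  then show "integrable (uniform_polydisk \<rho>) (\<lambda>z :: complex ^ 'n. ln ((cmod (z $ j))\<^sup>2))"
    by (subst integrable_uniform_polydisk[OF \<rho>(1)]) auto
  \<comment> \<open>The same majorant is infinite wherever its real coordinate vanishes inside the
    box, so finiteness of its integral also shows that almost no point of the polydisk has
    \<open>z $ j = 0\<close>.\<close>
  have "AE z in lborel. ?i z \<noteq> \<infinity>"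
    using fin by (intro nn_integral_PInf_AE) auto
  then have "AE z in lborel. 0 < ennreal (indicator ?B z / measure lborel ?B) \<longrightarrow> z \<in> ?B \<and> z $ j \<noteq> 0"
  proof eventually_elim
    case (elim z)
    show ?case
    proof
      assume "0 < ennreal (indicator ?B z / measure lborel ?B)"
      then have zB: "z \<in> ?B" by (rule contrapos_pp) simp
      then have "z \<in> cbox (- One) One" using closed_polydisk_subset_cbox[OF \<rho>(2)] by blast
      with elim have "z \<bullet> axis j 1 \<noteq> 0" by auto
      then show "z \<in> ?B \<and> z $ j \<noteq> 0" using zB by (auto simp: inner_axis)
    qed
  qed
  then show "AE z in uniform_polydisk \<rho>. z \<in> ?B \<and> z $ j \<noteq> 0"
    unfolding uniform_polydisk_def by (subst AE_density) auto
qed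

lemma measurable_log_kernel[measurable]: "log_kernel L \<in> borel_measurable borel"
  unfolding log_kernel_def by measurable

lemma measurable_hyp_GAF:
  assumes a[measurable]: "\<And>\<alpha>. a \<alpha> \<in> borel_measurable M" and N[measurable_cong]: "sets N = sets borel"
  shows "(\<lambda>(z, \<omega>). hyp_GAF L a \<omega> z) \<in> borel_measurable (N \<Otimes>\<^sub>M M)"
  unfolding hyp_GAF_def case_prod_beta'
  by (rule borel_measurable_infsum) auto

lemma measurable_log_deviation:
  assumes a: "\<And>\<alpha>. a \<alpha> \<in> borel_measurable M" and N[measurable_cong]: "sets N = sets borel"
  shows "(\<lambda>(z, \<omega>). log_deviation L a \<omega> z) \<in> borel_measurable (N \<Otimes>\<^sub>M M)"
proof -
  have [measurable]: "(\<lambda>p. hyp_GAF L a (snd p) (fst p)) \<in> borel_measurable (N \<Otimes>\<^sub>M M)"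
    using measurable_hyp_GAF[OF a N, of L] by (simp add: case_prod_beta')
  show ?thesis unfolding log_deviation_def case_prod_beta' by measurable
qed

text \<open>\<open>G\<close> is the logarithm of the base in the pointwise bound, with
  \<open>Z\<close> contributing logarithms of the coordinates. That bound blows up at the coordinate
  hyperplanes, but the logarithms are integrable and only the average \<Gamma> of \<open>G\<close>
  enters.\<close>

lemma polydisk_average_exp_moment:
  fixes L :: "real ^ 'n::finite" and a :: "nat ^ 'n \<Rightarrow> 'w \<Rightarrow> complex" and m :: "'n \<Rightarrow> nat"
  assumes \<rho>: "0 < \<rho>" "\<rho> < 1" and iid: "iid_std_complex_gaussian M a"
    and L: "\<And>j. L $ j \<ge> 1" and m: "\<And>j. m j > 0"
  defines "N \<equiv> (\<Prod>j\<in>UNIV. m j)"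
    and "W \<equiv> (\<Prod>j\<in>UNIV. 4 * (2 * (L $ j)\<^sup>2 / (1 - \<rho>\<^sup>2)\<^sup>2) + 2)"
  defines "\<Gamma> \<equiv> ln ((1 + 4 * W * N + 2 * N + singular_mass) * W)
      + (\<Sum>j\<in>UNIV. m j * (\<integral>z. - ln ((cmod (z $ j))\<^sup>2) \<partial>uniform_polydisk \<rho>))"
  shows "AE \<omega> in M. integrable (uniform_polydisk \<rho>) (\<lambda>z. log_deviation L a \<omega> z)"
    and "(\<integral>\<^sup>+\<omega>. ennreal (exp (real N * (1 / 8 * (\<integral>z. \<bar>log_deviation L a \<omega> z\<bar> \<partial>uniform_polydisk \<rho>) - \<Gamma>))) \<partial>M) \<le> 1"
proof -
  let ?\<mu> = "uniform_polydisk \<rho> :: (complex ^ 'n) measure"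
  let ?K = "nat_box (\<lambda>_::'n. 0) m"
  let ?Q = "(1 + 4 * W * N + 2 * N + singular_mass) * W"
  define G where "G = (\<lambda>z :: complex ^ 'n. ln ?Q + (\<Sum>j\<in>UNIV. m j * - ln ((cmod (z $ j))\<^sup>2)))"
  have M: "prob_space M" using iid by (simp add: iid_std_complex_gaussian_def)
  have \<mu>: "prob_space ?\<mu>" by (rule prob_space_uniform_polydisk[OF \<rho>(1)])
  interpret \<mu>: prob_space ?\<mu> by (rule \<mu>)
  have cardK: "card ?K = N" by (simp add: card_nat_box N_def)
  have N0: "N > 0" using m by (simp add: N_def prod_pos)
  have W1: "W \<ge> 1" unfolding W_def by (intro prod_ge_1) (simp add: add_increasing)
  have Q: "?Q > 0" using W1 singular_mass_nonneg by (intro mult_pos_pos) (auto simp: add_pos_nonneg)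
  have intl: "integrable ?\<mu> (\<lambda>z. ln ((cmod (z $ j))\<^sup>2))" for j
    using \<rho> by (intro integrable_log_component) auto
  have G: "integrable ?\<mu> G" unfolding G_def using intl by auto
  have intG: "(\<integral>z. G z \<partial>?\<mu>) = \<Gamma>"
    unfolding G_def \<Gamma>_def using intl \<mu>.prob_space by simp
  have "AE z in ?\<mu>. \<forall>j\<in>UNIV. z \<in> closed_polydisk \<rho> \<and> z $ j \<noteq> 0"
    using \<rho> by (intro AE_finite_allI integrable_log_component(2)) auto
  then have bd: "AE z in ?\<mu>. (\<integral>\<^sup>+\<omega>. ennreal (exp (1 / 8 * (\<Sum>k\<in>?K. \<bar>log_deviation L a \<omega> (rotate_by m k z)\<bar>))) \<partial>M)
      \<le> ennreal (exp (card ?K * G z))"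
  proof eventually_elim
    case (elim z)
    let ?Z = "\<Prod>j\<in>UNIV. ((cmod (z $ j))\<^sup>2) ^ m j"
    have z: "z $ j \<noteq> 0" "(cmod (z $ j))\<^sup>2 \<le> \<rho>\<^sup>2" for j
      using elim by (auto simp: closed_polydisk_def intro: power_mono)
    have \<rho>2: "\<rho>\<^sup>2 < 1" using \<rho> power_strict_mono[of \<rho> 1 2] by simp
    define E where "E = (\<Sum>j\<in>UNIV. m j * - ln ((cmod (z $ j))\<^sup>2))"
    have "?Z = exp (- E)"
      unfolding E_def using z by (simp add: exp_sum sum_negf[symmetric] exp_of_nat_mult del: sum_negf)
    then have "?Q / ?Z = ?Q * exp E" by (simp add: exp_minus divide_inverse)
    also have "\<dots> = exp (G z)"
    proof -
      have "G z = ln ?Q + E" by (simp only: G_def E_def)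
      then show ?thesis using Q by (simp only: exp_add exp_ln)
    qed
    finally have "?Q / ?Z = exp (G z)" .
    then have "(?Q / ?Z) ^ N = exp (card ?K * G z)"
      by (simp only: cardK exp_of_nat_mult)
    moreover have "(\<integral>\<^sup>+\<omega>. ennreal (exp (1 / 8 * (\<Sum>k\<in>?K. \<bar>log_deviation L a \<omega> (rotate_by m k z)\<bar>))) \<partial>M)
        \<le> ennreal ((?Q / ?Z) ^ N)"
      using iid_rotated_exp_moment_le[where m = m, OF iid L \<rho>2 z m]
      unfolding N_def[symmetric] W_def[symmetric] by (simp only: of_nat_mult of_nat_numeral)
    ultimately show ?case by (simp only:)
  qed
  have D: "(\<lambda>(z, \<omega>). log_deviation L a \<omega> z) \<in> borel_measurable (?\<mu> \<Otimes>\<^sub>M M)"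
    by (rule measurable_log_deviation[OF iid_measurable[OF iid]]) simp
  have K: "finite ?K" "?K \<noteq> {}" using cardK N0 by (auto simp: finite_nat_box)
  have R: "rotate_by m k \<in> measurable ?\<mu> ?\<mu>" for k by simp
  note main = exp_orbit_average_le[OF M \<mu> D K R distr_rotate_by_uniform_polydisk G _ bd]
  show "AE \<omega> in M. integrable ?\<mu> (\<lambda>z. log_deviation L a \<omega> z)"
    by (rule main(1)) auto
  show "(\<integral>\<^sup>+\<omega>. ennreal (exp (real N * (1 / 8 * (\<integral>z. \<bar>log_deviation L a \<omega> z\<bar> \<partial>?\<mu>) - \<Gamma>))) \<partial>M) \<le> 1"
    using main(2) by (simp add: cardK intG)
qed

section \<open>The deviation bound\<close>

text \<open>\<open>m j\<close> is the integer part of \<open>\<theta> * L $ j\<close>. The sum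
  involving \<Lambda> is linear in \<theta>, so a small \<theta> keeps it within half of the budget
  \<epsilon>; the logarithm grows only like the sum of the \<open>ln (L $ j)\<close> and fits into
  the other half for large \<open>L\<close>. The witness for \<eta> is
  \<open>(\<theta> / 2) ^ CARD('n)\<close>, independent of \<open>L\<close>.\<close>

lemma window_choice:
  fixes \<Lambda> :: "'n::finite \<Rightarrow> real"
  assumes c: "c \<ge> 0" and r: "0 \<le> r" "r < 1" and \<epsilon>: "\<epsilon> > 0"
  shows "\<exists>\<eta>>0. \<exists>L0\<ge>1. \<forall>L :: real ^ 'n. (\<forall>j. L $ j \<ge> L0) \<longrightarrow> (\<exists>m :: 'n \<Rightarrow> nat. (\<forall>j. m j > 0)
    \<and> real (\<Prod>j\<in>UNIV. m j) \<ge> \<eta> * (\<Prod>j\<in>UNIV. L $ j)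
    \<and> (let N = real (\<Prod>j\<in>UNIV. m j); W = (\<Prod>j\<in>UNIV. 4 * (2 * (L $ j)\<^sup>2 / (1 - r)\<^sup>2) + 2)
       in ln ((1 + 4 * W * N + 2 * N + c) * W) + (\<Sum>j\<in>UNIV. m j * \<Lambda> j) \<le> \<epsilon> * (\<Sum>j\<in>UNIV. L $ j)))"
proof -
  define \<Lambda>' where "\<Lambda>' = (\<Sum>j\<in>UNIV. \<bar>\<Lambda> j\<bar>) + 1"
  have \<Lambda>': "\<Lambda>' > 0" by (simp add: \<Lambda>'_def sum_nonneg add_nonneg_pos)
  \<comment> \<open>The bound by 1 keeps \<open>m j \<le> L $ j\<close> and thus
    \<open>N \<le> P\<close>; the other bound is the half budget for the linear term.\<close>
  define \<theta> where "\<theta> = min 1 (\<epsilon> / (2 * \<Lambda>'))"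
  have \<theta>: "\<theta> > 0" "\<theta> \<le> 1" "\<theta> * \<Lambda>' \<le> \<epsilon> / 2"
    using \<epsilon> \<Lambda>' by (auto simp: \<theta>_def min_def field_simps)
  define w where "w = 8 / (1 - r)\<^sup>2 + 2"
  have w: "w \<ge> 1" by (simp add: w_def add_increasing)
  define C where "C = ln ((7 + c) * w ^ (2 * CARD('n)))"
  have Carg: "(7 + c) * w ^ (2 * CARD('n)) \<ge> 1 * 1" using w c by (intro mult_mono one_le_power) auto
  then have C: "C \<ge> 0" by (simp add: C_def)
  have "eventually (\<lambda>x::real. C + 5 * ln x \<le> \<epsilon> / 2 * x) at_top"
    using \<epsilon> by real_asymp
  then obtain x0 where x0: "\<And>x. x \<ge> x0 \<Longrightarrow> C + 5 * ln x \<le> \<epsilon> / 2 * x"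
    by (auto simp: eventually_at_top_linorder)
  \<comment> \<open>\<open>2 / \<theta>\<close> makes \<open>\<theta> * L $ j\<close> at least 2, so
    that rounding down loses at most half of it.\<close>
  define L0 where "L0 = max x0 (max 1 (2 / \<theta>))"
  show ?thesis
  proof (intro exI conjI allI impI)
    show "(\<theta> / 2) ^ CARD('n) > 0" using \<theta> by simp
    show "L0 \<ge> 1" by (simp add: L0_def)
    fix L :: "real ^ 'n" assume "\<forall>j. L $ j \<ge> L0"
    then have L: "L $ j \<ge> x0" "L $ j \<ge> 1" "L $ j \<ge> 2 / \<theta>" for j by (auto simp: L0_def)
    define m where "m = (\<lambda>j. nat \<lfloor>\<theta> * L $ j\<rfloor>)"
    have \<theta>L: "\<theta> * L $ j \<ge> 2" for j using L(3)[of j] \<theta> by (simp add: field_simps)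
    have m: "real (m j) \<le> \<theta> * L $ j" "real (m j) \<ge> \<theta> / 2 * L $ j" for j
      unfolding m_def using \<theta>L[of j] by linarith+
    show "m j > 0" for j unfolding m_def using \<theta>L[of j] by linarith
    define N where "N = real (\<Prod>j\<in>UNIV. m j)"
    define P where "P = (\<Prod>j\<in>UNIV. L $ j)"
    define W where "W = (\<Prod>j\<in>UNIV. 4 * (2 * (L $ j)\<^sup>2 / (1 - r)\<^sup>2) + 2)"
    have P: "P \<ge> 1" unfolding P_def using L(2) by (intro prod_ge_1) auto
    have W: "W \<ge> 1" unfolding W_def by (intro prod_ge_1) (simp add: add_increasing)
    have "m j \<le> L $ j" for j
    proof -
      have "\<theta> * L $ j \<le> 1 * L $ j" using \<theta> L(2)[of j] by (intro mult_right_mono) auto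
      then show ?thesis using m(1)[of j] by simp
    qed
    then have NP: "N \<le> P" unfolding N_def P_def of_nat_prod by (intro prod_mono) auto
    have N0: "N \<ge> 0" by (simp add: N_def prod_nonneg)
    have "(\<theta> / 2) ^ CARD('n) * P = (\<Prod>j\<in>UNIV. \<theta> / 2 * L $ j)"
      by (simp only: P_def prod.distrib prod_constant)
    also have "\<dots> \<le> N" unfolding N_def of_nat_prod
    proof (intro prod_mono conjI m(2))
      fix j
      show "0 \<le> \<theta> / 2 * L $ j" using \<theta>L[of j] by simp
    qed
    finally show "(\<theta> / 2) ^ CARD('n) * (\<Prod>j\<in>UNIV. L $ j) \<le> real (\<Prod>j\<in>UNIV. m j)"
      unfolding P_def N_def .
    have "W \<le> (\<Prod>j\<in>UNIV. w * (L $ j)\<^sup>2)"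
      unfolding W_def
    proof (intro prod_mono conjI)
      fix j
      have "1 \<le> (L $ j)\<^sup>2" using L(2)[of j] by (rule one_le_power)
      then show "4 * (2 * (L $ j)\<^sup>2 / (1 - r)\<^sup>2) + 2 \<le> w * (L $ j)\<^sup>2" by (simp add: w_def distrib_right)
    qed (simp add: add_nonneg_nonneg)
    also have "\<dots> = w ^ CARD('n) * P\<^sup>2" by (simp add: prod.distrib P_def prod_power_distrib)
    finally have Wle: "W \<le> w ^ CARD('n) * P\<^sup>2" .
    have pos: "(1 + 4 * W * N + 2 * N + c) * W > 0"
      using W N0 c by (intro mult_pos_pos) (auto intro!: add_pos_nonneg)
    have "1 + 4 * W * N + 2 * N + c \<le> (7 + c) * (W * P)"
    proof -
      have WP: "W * N \<le> W * P" "P \<le> W * P" "1 \<le> W * P"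
        using W P NP mult_mono[of 1 W 1 P] by (auto intro: mult_left_mono)
      have "c * 1 \<le> c * (W * P)" using WP c by (intro mult_left_mono) auto
      then show ?thesis using WP NP by (simp add: distrib_right)
    qed
    then have "(1 + 4 * W * N + 2 * N + c) * W \<le> (7 + c) * (W * P) * W"
      using W by (intro mult_right_mono) auto
    also have "\<dots> = (7 + c) * P * W\<^sup>2" by (simp add: power2_eq_square)
    also have "\<dots> \<le> (7 + c) * P * (w ^ CARD('n) * P\<^sup>2)\<^sup>2"
      using W P c Wle by (intro mult_left_mono power_mono) auto
    \<comment> \<open>\<open>W\<close> is at most \<open>w ^ CARD('n) * P\<^sup>2\<close> and enters
      twice, while \<open>N \<le> P\<close> enters once: hence the fifth power.\<close>
    also have "\<dots> = (7 + c) * w ^ (2 * CARD('n)) * P ^ 5"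
    proof -
      have "w ^ (2 * CARD('n)) = (w ^ CARD('n))\<^sup>2" by (simp add: mult.commute flip: power_mult)
      moreover have "P ^ 5 = P * (P\<^sup>2)\<^sup>2" by (simp add: eval_nat_numeral)
      ultimately show ?thesis by (simp add: power_mult_distrib)
    qed
    finally have "ln ((1 + 4 * W * N + 2 * N + c) * W) \<le> ln ((7 + c) * w ^ (2 * CARD('n)) * P ^ 5)"
      using pos by (subst ln_le_cancel_iff) auto
    also have "\<dots> = C + 5 * ln P"
      using Carg P w unfolding C_def by (subst ln_mult) (auto simp: ln_realpow)
    also have "ln P = (\<Sum>j\<in>UNIV. ln (L $ j))"
      unfolding P_def
    proof (rule ln_prod)
      show "L $ j \<noteq> 0" for j using L(2)[of j] by linarith
    qed simp
    \<comment> \<open>As \<open>C \<ge> 0\<close>, charging it to every coordinate only increases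
      the bound and reduces the comparison to one variable.\<close>
    also have "C + 5 * (\<Sum>j\<in>UNIV. ln (L $ j)) \<le> (\<Sum>j\<in>UNIV. C + 5 * ln (L $ j))"
    proof -
      have "1 * C \<le> CARD('n) * C" using C by (intro mult_right_mono) auto
      then show ?thesis by (simp add: sum.distrib sum_distrib_left)
    qed
    also have "\<dots> \<le> (\<Sum>j\<in>UNIV. \<epsilon> / 2 * L $ j)" by (intro sum_mono x0 L)
    finally have 1: "ln ((1 + 4 * W * N + 2 * N + c) * W) \<le> \<epsilon> / 2 * (\<Sum>j\<in>UNIV. L $ j)"
      by (simp add: sum_distrib_left)
    have "(\<Sum>j\<in>UNIV. m j * \<Lambda> j) \<le> (\<Sum>j\<in>UNIV. \<epsilon> / 2 * L $ j)"
    proof (rule sum_mono)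
      fix j
      have "\<bar>\<Lambda> j\<bar> \<le> \<Lambda>'"
        using member_le_sum[of j UNIV "\<lambda>j. \<bar>\<Lambda> j\<bar>"] by (simp add: \<Lambda>'_def)
      then have "m j * \<Lambda> j \<le> (\<theta> * L $ j) * \<Lambda>'"
        using m(1)[of j] by (intro order_trans[OF _ mult_mono[OF m(1)[of j]]] mult_left_mono) auto
      also have "\<dots> = \<theta> * \<Lambda>' * L $ j" by simp
      also have "\<dots> \<le> \<epsilon> / 2 * L $ j" using \<theta> L(2)[of j] by (intro mult_right_mono) auto
      finally show "m j * \<Lambda> j \<le> \<epsilon> / 2 * L $ j" .
    qed
    then have 2: "(\<Sum>j\<in>UNIV. m j * \<Lambda> j) \<le> \<epsilon> / 2 * (\<Sum>j\<in>UNIV. L $ j)"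
      by (simp add: sum_distrib_left)
    show "let N = real (\<Prod>j\<in>UNIV. m j); W = (\<Prod>j\<in>UNIV. 4 * (2 * (L $ j)\<^sup>2 / (1 - r)\<^sup>2) + 2)
       in ln ((1 + 4 * W * N + 2 * N + c) * W) + (\<Sum>j\<in>UNIV. m j * \<Lambda> j) \<le> \<epsilon> * (\<Sum>j\<in>UNIV. L $ j)"
      unfolding Let_def N_def[symmetric] W_def[symmetric] using 1 2 by (simp add: field_simps)
  qed
qed

lemma compact_subset_closed_polydisk:
  assumes S: "compact S" "S \<subseteq> (polydisk :: (complex ^ 'n::finite) set)"
  shows "\<exists>\<rho>. 0 < \<rho> \<and> \<rho> < 1 \<and> S \<subseteq> closed_polydisk \<rho>"
proof (cases "S = {}")
  case True
  then show ?thesis by (intro exI[of _ "1/2"]) auto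
next
  case False
  have "\<exists>x\<in>S. \<forall>y\<in>S. cmod (y $ j) \<le> cmod (x $ j)" for j
    using S(1) False by (intro continuous_attains_sup) (auto intro!: continuous_intros)
  then obtain x where x: "\<And>j. x j \<in> S" "\<And>j y. y \<in> S \<Longrightarrow> cmod (y $ j) \<le> cmod (x j $ j)"
    by metis
  \<comment> \<open>The entry 1/2 keeps the radius positive.\<close>
  define \<rho> where "\<rho> = Max (insert (1/2) (range (\<lambda>j. cmod (x j $ j))))"
  have "1/2 \<le> \<rho>" unfolding \<rho>_def by (intro Max_ge) auto
  moreover have "\<rho> < 1" unfolding \<rho>_def using x(1) S(2) by (subst Max_less_iff) (auto simp: polydisk_def)
  moreover have "cmod (x j $ j) \<le> \<rho>" for j unfolding \<rho>_def by (intro Max_ge) auto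
  then have "S \<subseteq> closed_polydisk \<rho>" using x(2) by (fastforce simp: closed_polydisk_def intro: order_trans)
  ultimately show ?thesis by (intro exI[of _ \<rho>]) auto
qed

definition log_deviation_average ::
  "real \<Rightarrow> real ^ 'n \<Rightarrow> (nat ^ 'n \<Rightarrow> 'w \<Rightarrow> complex) \<Rightarrow> 'w \<Rightarrow> real" where
  "log_deviation_average \<rho> L a \<omega> = (\<integral>z. \<bar>log_deviation L a \<omega> z\<bar> \<partial>(uniform_polydisk \<rho> :: (complex ^ 'n::finite) measure))"

lemma measurable_log_deviation_average:
  assumes "\<rho> > 0" "\<And>\<alpha>. a \<alpha> \<in> borel_measurable M"
  shows "log_deviation_average \<rho> L a \<in> borel_measurable M"
proof -
  let ?\<mu> = "uniform_polydisk \<rho> :: (complex ^ 'a) measure"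
  interpret prob_space ?\<mu> by (rule prob_space_uniform_polydisk) fact
  have "(\<lambda>(\<omega>, z). log_deviation L a \<omega> z) \<in> borel_measurable (M \<Otimes>\<^sub>M ?\<mu>)"
    using measurable_pair_swap[OF measurable_log_deviation[where a = a and N = ?\<mu> and L = L]] assms by simp
  then have "(\<lambda>(\<omega>, z). \<bar>log_deviation L a \<omega> z\<bar>) \<in> borel_measurable (M \<Otimes>\<^sub>M ?\<mu>)"
    unfolding case_prod_beta' by measurable
  then show ?thesis
    unfolding log_deviation_average_def by (rule borel_measurable_lebesgue_integral)
qed

text \<open>\<rho> and \<open>C\<close> are chosen before \<open>M\<close>, \<open>a\<close> and
  \<open>L\<close>, which makes the estimate uniform in them. The decomposition into
  \<open>log_kernel\<close> and \<open>log_deviation\<close> is exact at every point, zeros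
  included, because the latter is defined as a difference. The kernel part gives
  \<open>mean_form_integral L \<phi>\<close>, and the rest is paired with a bounded density
  supported in the closed polydisk.\<close>

lemma I_stat_approximation:
  fixes \<phi> :: "'n::{finite,linorder} dform"
  assumes test: "\<phi> \<in> test_forms (CARD('n) - 1) (CARD('n) - 1)"
  shows "\<exists>\<rho> C. 0 < \<rho> \<and> \<rho> < 1 \<and> 0 < C \<and> (\<forall>(M :: 'w measure) a L.
    (\<forall>\<alpha>. a \<alpha> \<in> borel_measurable M) \<longrightarrow> I_stat L a \<phi> \<in> borel_measurable M \<and>
    (\<forall>\<omega>\<in>space M. integrable (uniform_polydisk \<rho>) (\<lambda>z. log_deviation L a \<omega> z) \<longrightarrow>
      \<bar>I_stat L a \<phi> \<omega> - mean_form_integral L \<phi>\<bar> \<le> C * log_deviation_average \<rho> L a \<omega>))"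
proof -
  obtain S where \<phi>: "\<And>J K. C2_on polydisk (\<lambda>z. \<phi> z J K)" and S: "compact S" "S \<subseteq> polydisk"
    and S0: "\<And>z J K. z \<in> polydisk - S \<Longrightarrow> \<phi> z J K = 0"
    using test unfolding test_forms_def by blast
  have closedS: "closed S" using S(1) by (rule compact_imp_closed)
  obtain \<rho> where \<rho>: "0 < \<rho>" "\<rho> < 1" "S \<subseteq> closed_polydisk \<rho>"
    using compact_subset_closed_polydisk[OF S] by blast
  let ?B = "closed_polydisk \<rho> :: ((complex, 'n) vec) set"
  let ?C = "(- 1) ^ (CARD('n) * (CARD('n) - 1) div 2) * (- 2 * \<i>) ^ CARD('n) :: complex"
  define H where "H = (\<lambda>z. \<i> / (2 * complex_of_real pi) * del (delbar \<phi>) z UNIV UNIV)"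
  define h where "h = (\<lambda>z. indicator polydisk z *\<^sub>R H z)"
  have H: "continuous_on polydisk H"
    unfolding H_def by (intro continuous_intros continuous_on_del_delbar \<phi>) auto
  have H0: "H z = 0" if "z \<in> polydisk - S" for z
    using del_delbar_eq_0[OF \<phi> closedS S0 that] by (simp add: H_def)
  have hS: "h z = 0" if "z \<notin> S" for z using H0[of z] that by (auto simp: h_def indicator_def)
  have "integrable lborel h"
    using set_integrable_compact_support[OF H S H0] by (simp add: h_def set_integrable_def)
  then have [measurable]: "h \<in> borel_measurable borel" by auto
  have "bounded (H ` S)"
    using S H by (intro compact_imp_bounded compact_continuous_image) (auto intro: continuous_on_subset)
  then obtain b where b: "\<And>z. z \<in> S \<Longrightarrow> cmod (H z) \<le> b" by (auto simp: bounded_iff)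
  \<comment> \<open>The added 1 keeps \<open>C\<close> positive even if the density
    vanishes.\<close>
  define b' where "b' = max b 0 + 1"
  have hb: "cmod (h z) \<le> b' * indicator ?B z" for z
  proof (cases "z \<in> S")
    case True
    then have "z \<in> polydisk" "z \<in> ?B" using S(2) \<rho>(3) by auto
    then show ?thesis using b[OF True] by (simp add: h_def b'_def)
  next
    case False
    then show ?thesis by (simp add: hS b'_def)
  qed
  define C where "C = cmod ?C * b' * measure lborel ?B"
  have Cpos: "C > 0"
    using emeasure_closed_polydisk(2)[OF \<rho>(1), where 'n = 'n]
    by (auto simp: C_def b'_def norm_mult norm_power intro!: mult_pos_pos)
  have pair: "ddbar_pairing u \<phi> = Re (?C * (\<integral>z. complex_of_real (u z) * h z \<partial>lborel))" for u
    unfolding ddbar_pairing_def form_integral_def set_lebesgue_integral_def h_def H_def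
    by (simp only: mult_scaleR_right)
  have I: "I_stat L a \<phi> \<omega> = Re (?C * (\<integral>z. complex_of_real (ln ((cmod (hyp_GAF L a \<omega> z))\<^sup>2)) * h z \<partial>lborel))" for L :: "(real, 'n) vec" and a and \<omega> :: 'w
    unfolding I_stat_def zero_current_def by (rule pair)
  have mean: "mean_form_integral L \<phi> = Re (?C * (\<integral>z. complex_of_real (log_kernel L z) * h z \<partial>lborel))" for L
    unfolding mean_form_integral_representation(2)[OF test, symmetric] by (rule pair)
  show ?thesis
  proof (rule exI[of _ \<rho>], rule exI[of _ C], intro conjI allI impI ballI)
    fix M :: "'w measure" and a :: "(nat, 'n) vec \<Rightarrow> 'w \<Rightarrow> complex" and L :: "(real, 'n) vec"
    assume a: "\<forall>\<alpha>. a \<alpha> \<in> borel_measurable M"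
    have "(\<lambda>(\<omega>, z). hyp_GAF L a \<omega> z) \<in> borel_measurable (M \<Otimes>\<^sub>M lborel)"
      using measurable_pair_swap[OF measurable_hyp_GAF[where a = a and N = lborel and L = L]] a by simp
    then have [measurable]: "(\<lambda>p. hyp_GAF L a (fst p) (snd p)) \<in> borel_measurable (M \<Otimes>\<^sub>M lborel)"
      by (simp add: case_prod_beta')
    have "(\<lambda>(\<omega>, z). complex_of_real (ln ((cmod (hyp_GAF L a \<omega> z))\<^sup>2)) * h z) \<in> borel_measurable (M \<Otimes>\<^sub>M lborel)"
      unfolding case_prod_beta' by measurable
    then have [measurable]: "(\<lambda>\<omega>. \<integral>z. complex_of_real (ln ((cmod (hyp_GAF L a \<omega> z))\<^sup>2)) * h z \<partial>lborel) \<in> borel_measurable M"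
      by (rule lborel.borel_measurable_lebesgue_integral)
    show "I_stat L a \<phi> \<in> borel_measurable M"
      unfolding I[abs_def] by measurable
    fix \<omega> assume \<omega>: "\<omega> \<in> space M" and int: "integrable (uniform_polydisk \<rho>) (\<lambda>z. log_deviation L a \<omega> z)"
    let ?D = "log_deviation L a \<omega>"
    have [measurable]: "?D \<in> borel_measurable borel" using int by auto
    have iD: "integrable lborel (\<lambda>z. indicator ?B z *\<^sub>R \<bar>?D z\<bar>)"
      using integrable_abs[OF int] by (subst (asm) integrable_uniform_polydisk[OF \<rho>(1)]) auto
    have le: "norm (complex_of_real (?D z) * h z) \<le> b' * (indicator ?B z *\<^sub>R \<bar>?D z\<bar>)" for z
      using mult_left_mono[OF hb[of z], of "\<bar>?D z\<bar>"] by (simp add: norm_mult mult_ac)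
    have iDh: "integrable lborel (\<lambda>z. complex_of_real (?D z) * h z)"
    proof (rule Bochner_Integration.integrable_bound)
      show "integrable lborel (\<lambda>z. b' * (indicator ?B z *\<^sub>R \<bar>?D z\<bar>))" using iD by simp
      show "AE z in lborel. norm (complex_of_real (?D z) * h z) \<le> norm (b' * (indicator ?B z *\<^sub>R \<bar>?D z\<bar>))"
        using le by (auto intro: order_trans[OF _ abs_ge_self])
    qed measurable
    have iKh: "integrable lborel (\<lambda>z. complex_of_real (log_kernel L z) * h z)"
    proof -
      have "continuous_on polydisk (\<lambda>z. complex_of_real (log_kernel L z) * H z)"
        unfolding of_real_log_kernel
        by (intro continuous_intros H C1_on_continuous_on C1_on_kernel_term)
      from set_integrable_compact_support[OF this S] H0 show ?thesis
        by (simp add: set_integrable_def h_def)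
    qed
    have "complex_of_real (ln ((cmod (hyp_GAF L a \<omega> z))\<^sup>2)) * h z
       = complex_of_real (log_kernel L z) * h z + complex_of_real (?D z) * h z" for z
      by (simp add: log_deviation_def algebra_simps)
    then have diff: "I_stat L a \<phi> \<omega> - mean_form_integral L \<phi> = Re (?C * (\<integral>z. complex_of_real (?D z) * h z \<partial>lborel))"
      unfolding I mean using iKh iDh by (simp add: distrib_left)
    have "\<bar>I_stat L a \<phi> \<omega> - mean_form_integral L \<phi>\<bar> \<le> cmod (?C * (\<integral>z. complex_of_real (?D z) * h z \<partial>lborel))"
      unfolding diff by (rule abs_Re_le_cmod)
    also have "\<dots> = cmod ?C * cmod (\<integral>z. complex_of_real (?D z) * h z \<partial>lborel)" by (rule norm_mult)
    also have "cmod (\<integral>z. complex_of_real (?D z) * h z \<partial>lborel) \<le> (\<integral>z. b' * (indicator ?B z *\<^sub>R \<bar>?D z\<bar>) \<partial>lborel)"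
      using iD le by (intro Bochner_Integration.integral_norm_bound_integral iDh) auto
    also have "\<dots> = b' * (\<integral>z. indicator ?B z *\<^sub>R \<bar>?D z\<bar> \<partial>lborel)" by (rule integral_mult_right_zero)
    also have "(\<integral>z. indicator ?B z *\<^sub>R \<bar>?D z\<bar> \<partial>lborel) = measure lborel ?B * log_deviation_average \<rho> L a \<omega>"
      unfolding log_deviation_average_def
      using emeasure_closed_polydisk(2)[OF \<rho>(1), where 'n = 'n]
      by (subst integrable_uniform_polydisk(2)[OF \<rho>(1)]) auto
    finally show "\<bar>I_stat L a \<phi> \<omega> - mean_form_integral L \<phi>\<bar> \<le> C * log_deviation_average \<rho> L a \<omega>"
      by (simp add: C_def mult_left_mono mult.assoc)
  qed (use \<rho> Cpos in auto)
qed

theorem theorem2: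
  fixes \<phi> :: "'n::{finite,linorder} dform" and \<delta> :: real
  assumes test: "\<phi> \<in> test_forms (CARD('n) - 1) (CARD('n) - 1)"
    and delta: "\<delta> > 0"
    and mean_pos: "\<forall>j. 0 < mean_form_integral (axis j 1) \<phi>"
  shows "\<exists>c>0. \<exists>L0 :: (real, 'n) vec. \<forall>L :: (real, 'n) vec.
    (\<forall>j. 0 < L $ j \<and> L0 $ j \<le> L $ j) \<longrightarrow>
    (\<forall>(M :: 'w measure) (a :: (nat, 'n) vec \<Rightarrow> 'w \<Rightarrow> complex).
       iid_std_complex_gaussian M a \<longrightarrow>
       measure M {\<omega> \<in> space M.
           \<bar>I_stat L a \<phi> \<omega> - prob_space.expectation M (I_stat L a \<phi>)\<bar>
             > \<delta> * prob_space.expectation M (I_stat L a \<phi>)}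
         \<le> exp (- c * (\<Sum>j\<in>UNIV. L $ j) * (\<Prod>j\<in>UNIV. L $ j)))"
proof -
  obtain \<rho> C where \<rho>: "0 < \<rho>" "\<rho> < 1" and C: "0 < C"
    and I: "\<And>(M :: 'w measure) a L. (\<forall>\<alpha>. a \<alpha> \<in> borel_measurable M) \<Longrightarrow> I_stat L a \<phi> \<in> borel_measurable M"
    and approx: "\<And>(M :: 'w measure) a L \<omega>. (\<forall>\<alpha>. a \<alpha> \<in> borel_measurable M) \<Longrightarrow> \<omega> \<in> space M \<Longrightarrow>
      integrable (uniform_polydisk \<rho>) (\<lambda>z. log_deviation L a \<omega> z) \<Longrightarrow>
      \<bar>I_stat L a \<phi> \<omega> - mean_form_integral L \<phi>\<bar> \<le> C * log_deviation_average \<rho> L a \<omega>"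
    using I_stat_approximation[OF test, where 'w = 'w] by blast
  \<comment> \<open>By linearity, \<open>mean_form_integral L \<phi>\<close> is at least \<kappa>
    times the sum of the \<open>L $ j\<close>, which makes relative deviations comparable with
    errors of size \<epsilon> times that sum.\<close>
  define \<kappa> where "\<kappa> = Min (range (\<lambda>j. mean_form_integral (axis j 1) \<phi>))"
  have \<kappa>: "\<kappa> > 0" unfolding \<kappa>_def using mean_pos by (subst Min_gr_iff) auto
  have \<kappa>_le: "\<kappa> \<le> mean_form_integral (axis j 1) \<phi>" for j unfolding \<kappa>_def by (intro Min_le) auto
  \<comment> \<open>The expectation of \<open>I_stat\<close> differs from
    \<open>mean_form_integral L \<phi>\<close> by at most
    \<open>8 * C * \<epsilon> * \<Sigma>\<close>. The first entry keeps it above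
    \<open>\<kappa> / 2 * \<Sigma>\<close>; the second keeps the difference below
    \<open>\<delta> * \<kappa> / 8 * \<Sigma>\<close> and saves half of the exponent in the tail
    bound.\<close>
  define \<epsilon> where "\<epsilon> = min (\<kappa> / (16 * C)) (\<delta> * \<kappa> / (64 * C))"
  have \<epsilon>: "\<epsilon> > 0" using \<kappa> C delta by (simp add: \<epsilon>_def)
  have \<epsilon>1: "8 * C * \<epsilon> \<le> \<kappa> / 2" and \<epsilon>2: "\<epsilon> \<le> \<delta> * \<kappa> / (64 * C)" and \<epsilon>3: "8 * C * \<epsilon> \<le> \<delta> * \<kappa> / 8"
  proof -
    have "\<epsilon> \<le> \<kappa> / (16 * C)" by (simp add: \<epsilon>_def)
    then show "8 * C * \<epsilon> \<le> \<kappa> / 2" using C by (simp add: field_simps)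
    show e: "\<epsilon> \<le> \<delta> * \<kappa> / (64 * C)" by (simp add: \<epsilon>_def)
    show "8 * C * \<epsilon> \<le> \<delta> * \<kappa> / 8" using C e by (simp add: field_simps)
  qed
  have \<rho>2: "0 \<le> \<rho>\<^sup>2" "\<rho>\<^sup>2 < 1" using \<rho> power_strict_mono[of \<rho> 1 2] by auto
  define \<Lambda> where "\<Lambda> = (\<lambda>j::'n. \<integral>z. - ln ((cmod (z $ j))\<^sup>2) \<partial>uniform_polydisk \<rho>)"
  obtain \<eta> L0 where \<eta>: "\<eta> > 0" and L0: "L0 \<ge> 1" and win: "\<And>L :: (real, 'n) vec. (\<forall>j. L $ j \<ge> L0) \<Longrightarrow>
    (\<exists>m :: 'n \<Rightarrow> nat. (\<forall>j. m j > 0)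
    \<and> real (\<Prod>j\<in>UNIV. m j) \<ge> \<eta> * (\<Prod>j\<in>UNIV. L $ j)
    \<and> (let N = real (\<Prod>j\<in>UNIV. m j); W = (\<Prod>j\<in>UNIV. 4 * (2 * (L $ j)\<^sup>2 / (1 - \<rho>\<^sup>2)\<^sup>2) + 2)
       in ln ((1 + 4 * W * N + 2 * N + singular_mass) * W) + (\<Sum>j\<in>UNIV. m j * \<Lambda> j) \<le> \<epsilon> * (\<Sum>j\<in>UNIV. L $ j)))"
    using window_choice[OF singular_mass_nonneg \<rho>2 \<epsilon>, of \<Lambda>] by blast
  define c where "c = \<eta> * (\<delta> * \<kappa> / (64 * C))"
  show ?thesis
  proof (intro exI conjI allI impI)
    show "c > 0" using \<eta> delta \<kappa> C by (simp add: c_def)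
    fix L :: "(real, 'n) vec" and M :: "'w measure" and a :: "(nat, 'n) vec \<Rightarrow> 'w \<Rightarrow> complex"
    assume "\<forall>j. 0 < L $ j \<and> (\<chi> j. L0) $ j \<le> L $ j" and iid: "iid_std_complex_gaussian M a"
    then have L: "\<And>j. L $ j \<ge> L0" by simp
    then have L1: "\<And>j. L $ j \<ge> 1" using L0 by (meson order_trans)
    interpret prob_space M using iid by (simp add: iid_std_complex_gaussian_def)
    have a: "\<forall>\<alpha>. a \<alpha> \<in> borel_measurable M" using iid_measurable[OF iid] by blast
    obtain m :: "'n \<Rightarrow> nat" where m: "\<And>j. m j > 0"
      and mN: "real (\<Prod>j\<in>UNIV. m j) \<ge> \<eta> * (\<Prod>j\<in>UNIV. L $ j)"
      and mG: "let N = real (\<Prod>j\<in>UNIV. m j); W = (\<Prod>j\<in>UNIV. 4 * (2 * (L $ j)\<^sup>2 / (1 - \<rho>\<^sup>2)\<^sup>2) + 2)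
       in ln ((1 + 4 * W * N + 2 * N + singular_mass) * W) + (\<Sum>j\<in>UNIV. m j * \<Lambda> j) \<le> \<epsilon> * (\<Sum>j\<in>UNIV. L $ j)"
      using win[of L] L by blast
    define N where "N = real (\<Prod>j\<in>UNIV. m j)"
    define W where "W = (\<Prod>j\<in>UNIV. 4 * (2 * (L $ j)\<^sup>2 / (1 - \<rho>\<^sup>2)\<^sup>2) + 2)"
    define \<Gamma> where "\<Gamma> = ln ((1 + 4 * W * N + 2 * N + singular_mass) * W) + (\<Sum>j\<in>UNIV. m j * \<Lambda> j)"
    define \<Sigma> where "\<Sigma> = (\<Sum>j\<in>UNIV. L $ j)"
    define P where "P = (\<Prod>j\<in>UNIV. L $ j)"
    define X where "X = log_deviation_average \<rho> L a"
    let ?I = "I_stat L a \<phi>"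
    let ?\<mu> = "mean_form_integral L \<phi>"
    have \<Sigma>0: "\<Sigma> \<ge> 0" unfolding \<Sigma>_def using L1 by (intro sum_nonneg) (auto intro: order_trans[OF zero_le_one])
    have P0: "P \<ge> 0" unfolding P_def using L1 by (intro prod_nonneg) (auto intro: order_trans[OF zero_le_one])
    have \<Gamma>: "\<Gamma> \<le> \<epsilon> * \<Sigma>" using mG unfolding \<Gamma>_def N_def W_def \<Sigma>_def Let_def .
    have N: "N \<ge> \<eta> * P" "N > 0" using mN m by (auto simp: N_def P_def intro!: prod_pos)
    note avg = polydisk_average_exp_moment[OF \<rho> iid L1 m]
    have e: "(\<integral>\<^sup>+\<omega>. ennreal (exp (N * (1 / 8 * X \<omega> - \<Gamma>))) \<partial>M) \<le> 1"
      using avg(2) unfolding X_def log_deviation_average_def \<Gamma>_def N_def W_def \<Lambda>_def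
      by (simp only: of_nat_mult of_nat_numeral)
    have X[measurable]: "X \<in> borel_measurable M"
      unfolding X_def using measurable_log_deviation_average[OF \<rho>(1)] a by blast
    have X0: "X \<omega> \<ge> 0" for \<omega> unfolding X_def log_deviation_average_def by simp
    note ec = exp_moment_consequences[OF prob_space_axioms X X0 N(2) _ e]
    have iX: "integrable M X" by (rule ec(1)) simp
    have EX: "expectation X \<le> 8 * \<Gamma>" using ec(2) by simp
    have tail: "prob {\<omega> \<in> space M. X \<omega> > x} \<le> exp (- N * (1 / 8 * x - \<Gamma>))" for x
      by (rule ec(3)) simp
    have I[measurable]: "?I \<in> borel_measurable M" by (rule I[OF a])
    have close: "AE \<omega> in M. \<bar>?I \<omega> - ?\<mu>\<bar> \<le> C * X \<omega>"
      using avg(1) AE_space by eventually_elim (use approx[OF a] in \<open>simp add: X_def\<close>)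
    have iIm: "integrable M (\<lambda>\<omega>. ?I \<omega> - ?\<mu>)"
    proof (rule Bochner_Integration.integrable_bound)
      show "integrable M (\<lambda>\<omega>. C * X \<omega>)" using iX by simp
      show "AE \<omega> in M. norm (?I \<omega> - ?\<mu>) \<le> norm (C * X \<omega>)"
        using close by eventually_elim (auto intro: order_trans[OF _ abs_ge_self])
    qed measurable
    have iI: "integrable M ?I"
      using Bochner_Integration.integrable_add[OF iIm integrable_const[of ?\<mu>]] by simp
    have "\<bar>expectation ?I - ?\<mu>\<bar> = \<bar>expectation (\<lambda>\<omega>. ?I \<omega> - ?\<mu>)\<bar>"
      using iI by (simp add: prob_space)
    also have "\<dots> \<le> expectation (\<lambda>\<omega>. \<bar>?I \<omega> - ?\<mu>\<bar>)" by (rule integral_abs_bound)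
    also have "\<dots> \<le> expectation (\<lambda>\<omega>. C * X \<omega>)"
      using iIm iX close by (intro integral_mono_AE) auto
    also have "\<dots> \<le> C * (8 * (\<epsilon> * \<Sigma>))"
      using EX \<Gamma> C by simp
    finally have EI: "\<bar>expectation ?I - ?\<mu>\<bar> \<le> 8 * C * \<epsilon> * \<Sigma>" by simp
    have mu: "?\<mu> \<ge> \<kappa> * \<Sigma>"
      unfolding mean_form_integral_representation(1)[OF test, of L] \<Sigma>_def sum_distrib_left
    proof (rule sum_mono)
      fix j
      show "\<kappa> * L $ j \<le> L $ j * mean_form_integral (axis j 1) \<phi>"
        using mult_left_mono[OF \<kappa>_le[of j], of "L $ j"] L1[of j] by (simp add: mult.commute)
    qed
    have "8 * C * \<epsilon> * \<Sigma> \<le> \<kappa> / 2 * \<Sigma>" using \<epsilon>1 \<Sigma>0 by (rule mult_right_mono)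
    with EI mu have EI_low: "expectation ?I \<ge> \<kappa> / 2 * \<Sigma>" by linarith
    have err: "8 * C * \<epsilon> * \<Sigma> \<le> \<delta> * \<kappa> / 8 * \<Sigma>" using \<epsilon>3 \<Sigma>0 by (rule mult_right_mono)
    \<comment> \<open>A deviation in the event exceeds
      \<open>\<delta> * \<kappa> / 2 * \<Sigma>\<close>. Replacing the expectation by
      \<open>?\<mu>\<close> takes at most \<open>\<delta> * \<kappa> / 8 * \<Sigma>\<close> of this,
      so \<open>C * X \<omega>\<close> still exceeds
      \<open>\<delta> * \<kappa> / 4 * \<Sigma>\<close>.\<close>
    define x where "x = \<delta> * \<kappa> / (4 * C) * \<Sigma>"
    have ev: "X \<omega> > x" if "\<bar>?I \<omega> - ?\<mu>\<bar> \<le> C * X \<omega>" "\<bar>?I \<omega> - expectation ?I\<bar> > \<delta> * expectation ?I" for \<omega>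
    proof -
      have "\<delta> * (\<kappa> / 2 * \<Sigma>) \<le> \<delta> * expectation ?I" using EI_low delta by (intro mult_left_mono) auto
      moreover have "\<delta> * expectation ?I < C * X \<omega> + \<delta> * \<kappa> / 8 * \<Sigma>" using that EI err by linarith
      moreover have "\<delta> * \<kappa> / 2 * \<Sigma> = \<delta> * (\<kappa> / 2 * \<Sigma>)" by simp
      ultimately have "\<delta> * \<kappa> / 2 * \<Sigma> < C * X \<omega> + \<delta> * \<kappa> / 8 * \<Sigma>" by linarith
      moreover have "\<delta> * \<kappa> * \<Sigma> \<ge> 0" using delta \<kappa> \<Sigma>0 by simp
      ultimately have "\<delta> * \<kappa> / 4 * \<Sigma> < C * X \<omega>" by (simp add: mult.commute)
      then show ?thesis using C by (simp add: x_def field_simps)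
    qed
    have "prob {\<omega> \<in> space M. \<bar>?I \<omega> - expectation ?I\<bar> > \<delta> * expectation ?I} \<le> prob {\<omega> \<in> space M. X \<omega> > x}"
    proof (rule finite_measure_mono_AE)
      show "AE \<omega> in M. \<omega> \<in> {\<omega> \<in> space M. \<bar>?I \<omega> - expectation ?I\<bar> > \<delta> * expectation ?I} \<longrightarrow> \<omega> \<in> {\<omega> \<in> space M. X \<omega> > x}"
        using close by eventually_elim (use ev in auto)
    qed measurable
    also have "\<dots> \<le> exp (- N * (1 / 8 * x - \<Gamma>))" by (rule tail)
    also have "\<dots> \<le> exp (- c * \<Sigma> * P)"
    proof -
      \<comment> \<open>Here \<open>x / 8\<close> is
        \<open>\<delta> * \<kappa> / (32 * C) * \<Sigma>\<close>, and \<Gamma> takes at most half of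
        it; what remains, multiplied by \<open>N \<ge> \<eta> * P\<close>, is the exponent with the
        constant \<open>c\<close>.\<close>
      have "\<epsilon> * \<Sigma> \<le> \<delta> * \<kappa> / (64 * C) * \<Sigma>" using \<epsilon>2 \<Sigma>0 by (rule mult_right_mono)
      then have "1 / 8 * x - \<Gamma> \<ge> \<delta> * \<kappa> / (64 * C) * \<Sigma>"
        using \<Gamma> by (simp add: x_def)
      moreover have "\<delta> * \<kappa> / (64 * C) * \<Sigma> \<ge> 0" using delta \<kappa> C \<Sigma>0 by simp
      ultimately have "\<eta> * P * (\<delta> * \<kappa> / (64 * C) * \<Sigma>) \<le> N * (1 / 8 * x - \<Gamma>)"
        using N P0 \<eta> by (intro mult_mono) auto
      then show ?thesis by (simp add: c_def mult_ac)
    qed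
    finally show "prob {\<omega> \<in> space M. \<delta> * expectation ?I < \<bar>?I \<omega> - expectation ?I\<bar>}
        \<le> exp (- c * (\<Sum>j\<in>UNIV. L $ j) * (\<Prod>j\<in>UNIV. L $ j))"
      unfolding \<Sigma>_def P_def .
  qed
qed

end
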